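(* Let $n\ge2$ and let $\Omega\subsetneq\mathbb{R}^n$ be a domain with boundary of class $\mathcal{C}^2$ satisfying a uniform interior sphere condition. Then $\mu:=(-\Delta d)\,dx$ (the negative distributional Laplacian of $d$) is a signed Radon measure on $\Omega$. Let $\mu=\mu_{ac}+\mu_s$ be the Lebesgue decomposition of $\mu$ with respect to Lebesgue measure $\mathcal{L}^n$, i.e. $\mu_{ac}\ll\mathcal{L}^n$ and $\mu_s\perp\mathcal{L}^n$. Then $\mu_s\ge 0$ in $\Omega$, and $\mu_{ac}\ge (n-1)\underline{\mathcal{H}}\,dx$ a.e. in $\Omega$ (i.e. the density of $\mu_{ac}$ with respect to $\mathcal{L}^n$ is at least $(n-1)\underline{\mathcal{H}}$ a.e. in $\Omega$), where $\underline{\mathcal{H}}:=\inf_{y\in\partial\Omega}\mathcal{H}(y)$.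
   Context: A domain is an open connected subset of $\mathbb{R}^n$. $d(x):=\operatorname{dist}(x,\mathbb{R}^n\setminus\Omega)$ for $x\in\Omega$. That $\mu=(-\Delta d)dx$ is a signed Radon measure means that there is a (locally finite) signed Radon measure $\mu$ on $\Omega$ with $-\int_\Omega d\,\Delta\phi\,dx=\int_\Omega\phi\,d\mu$ for all $\phi\in C_c^\infty(\Omega)$. Mean curvature: $\mathcal{H}(y):=\frac{1}{n-1}\sum_{i=1}^{n-1}\kappa_i(y)$, where $\kappa_i(y)$ are the principal curvatures of $\partial\Omega$ at $y$, with the sign convention that they equal $1/R$ when $\Omega$ is a ball of radius $R$. $\Omega$ satisfies a uniform interior sphere condition if there is $r_0>0$ such that for every $y\in\partial\Omega$ there is an open ball $B\subset\Omega$ of radius at least $r_0$ with $\overline{B}\cap(\mathbb{R}^n\setminus\Omega)=\{y\}$. *)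

theory Defs
  imports "HOL-Analysis.Analysis"
begin

section \<open>Differentiability classes and the Laplacian\<close>

definition dir_deriv :: "'a \<Rightarrow> ('a::euclidean_space \<Rightarrow> real) \<Rightarrow> 'a \<Rightarrow> real" where
  "dir_deriv v f = (\<lambda>x. frechet_derivative f (at x) v)"

text \<open>The set \<open>S\<close> is meant to be open.\<close>

primrec Ck_on :: "nat \<Rightarrow> 'a::euclidean_space set \<Rightarrow> ('a \<Rightarrow> real) \<Rightarrow> bool" where
  "Ck_on 0 S f \<longleftrightarrow> continuous_on S f"
| "Ck_on (Suc k) S f \<longleftrightarrow>
     (\<forall>x\<in>S. f differentiable (at x)) \<and> (\<forall>b\<in>Basis. Ck_on k S (dir_deriv b f))"

definition laplacian :: "('a::euclidean_space \<Rightarrow> real) \<Rightarrow> 'a \<Rightarrow> real" where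
  "laplacian f x = (\<Sum>b\<in>Basis. dir_deriv b (dir_deriv b f) x)"

definition test_function :: "'a::euclidean_space set \<Rightarrow> ('a \<Rightarrow> real) \<Rightarrow> bool" where
  "test_function \<Omega> \<phi> \<longleftrightarrow>
     (\<forall>k. Ck_on k UNIV \<phi>) \<and> compact (closure {x. \<phi> x \<noteq> 0}) \<and> closure {x. \<phi> x \<noteq> 0} \<subseteq> \<Omega>"


section \<open>Geometry of the boundary\<close>

definition bdist :: "'a::euclidean_space set \<Rightarrow> 'a \<Rightarrow> real" where
  "bdist \<Omega> x = infdist x (- \<Omega>)"

definition hyp_proj :: "'a::euclidean_space \<Rightarrow> 'a \<Rightarrow> 'a" where
  "hyp_proj e x = x - (x \<bullet> e) *\<^sub>R e"

text \<open>
  Near \<open>y\<close>, in orthonormal coordinates whose last axis is the unit vector \<open>e\<close>, the set \<open>\<Omega>\<close> is the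
  strict epigraph of a \<open>C\<^sup>2\<close> function of the remaining \<open>n - 1\<close> coordinates.  A function on the
  hyperplane orthogonal to \<open>e\<close> is represented by a function \<open>\<gamma>\<close> on the whole space of which only
  the values on that hyperplane matter.
\<close>

definition epigraph_chart ::
  "'a::euclidean_space set \<Rightarrow> 'a \<Rightarrow> 'a \<Rightarrow> ('a \<Rightarrow> real) \<Rightarrow> bool" where
  "epigraph_chart \<Omega> y e \<gamma> \<longleftrightarrow>
     norm e = 1 \<and> Ck_on 2 UNIV \<gamma> \<and>
     (\<exists>r>0. \<Omega> \<inter> ball y r = {x \<in> ball y r. \<gamma> (hyp_proj e x) < x \<bullet> e})"

definition C2_boundary :: "'a::euclidean_space set \<Rightarrow> bool" where
  "C2_boundary \<Omega> \<longleftrightarrow> (\<forall>y\<in>frontier \<Omega>. \<exists>e \<gamma>. epigraph_chart \<Omega> y e \<gamma>)"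

text \<open>
  The principal curvatures at \<open>y\<close> are the eigenvalues, with multiplicity, of the Hessian at \<open>y\<close>
  of a function \<open>\<gamma>\<close> whose graph over the tangent hyperplane at \<open>y\<close> is the boundary near \<open>y\<close>.
  The condition that the gradient of \<open>\<gamma>\<close> vanishes at the projection of \<open>y\<close> makes \<open>e\<close> the inner
  unit normal at \<open>y\<close>; as \<open>\<Omega>\<close> lies above the graph, a ball of radius \<open>R\<close> has curvatures \<open>1 / R\<close>.
  The \<open>v i\<close> with \<open>i < n - 1\<close> form an orthonormal basis of the tangent hyperplane consisting of
  principal directions; the values \<open>\<kappa> i\<close> with \<open>i \<ge> n - 1\<close> are irrelevant.
\<close>

definition principal_curvatures ::
  "'a::euclidean_space set \<Rightarrow> 'a \<Rightarrow> (nat \<Rightarrow> real) \<Rightarrow> bool" where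
  "principal_curvatures \<Omega> y \<kappa> \<longleftrightarrow>
     (\<exists>e \<gamma> v. epigraph_chart \<Omega> y e \<gamma> \<and>
        (\<forall>w. w \<bullet> e = 0 \<longrightarrow> dir_deriv w \<gamma> (hyp_proj e y) = 0) \<and>
        (\<forall>i < DIM('a) - 1. v i \<bullet> e = 0) \<and>
        (\<forall>i < DIM('a) - 1. \<forall>j < DIM('a) - 1. v i \<bullet> v j = (if i = j then 1 else 0)) \<and>
        (\<forall>i < DIM('a) - 1. \<forall>w. w \<bullet> e = 0 \<longrightarrow>
           dir_deriv w (dir_deriv (v i) \<gamma>) (hyp_proj e y) = \<kappa> i * (v i \<bullet> w)))"

definition mean_curvature :: "'a::euclidean_space set \<Rightarrow> 'a \<Rightarrow> real" where
  "mean_curvature \<Omega> y =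
     (THE h. \<exists>\<kappa>. principal_curvatures \<Omega> y \<kappa> \<and>
        h = (\<Sum>i < DIM('a) - 1. \<kappa> i) / (real DIM('a) - 1))"

definition uniform_interior_sphere :: "'a::euclidean_space set \<Rightarrow> bool" where
  "uniform_interior_sphere \<Omega> \<longleftrightarrow>
     (\<exists>r0>0. \<forall>y\<in>frontier \<Omega>. \<exists>c R. R \<ge> r0 \<and> ball c R \<subseteq> \<Omega> \<and> closure (ball c R) \<inter> (- \<Omega>) = {y})"


section \<open>Signed Radon measures\<close>

text \<open>
  A locally finite signed measure on \<open>\<Omega>\<close> may have infinite positive and infinite negative part on
  \<open>\<Omega>\<close>, so it is a real set function on the Borel sets contained in a compact subset of \<open>\<Omega>\<close>
  (its values on other sets are irrelevant), countably additive there.  In particular it is a finite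
  signed measure on the Borel sets of each compact subset of \<open>\<Omega>\<close>.
\<close>

definition rc_borel :: "'a::euclidean_space set \<Rightarrow> 'a set set" where
  "rc_borel \<Omega> = {A \<in> sets borel. \<exists>K. compact K \<and> K \<subseteq> \<Omega> \<and> A \<subseteq> K}"

definition signed_radon :: "'a::euclidean_space set \<Rightarrow> ('a set \<Rightarrow> real) \<Rightarrow> bool" where
  "signed_radon \<Omega> \<nu> \<longleftrightarrow>
     (\<forall>A :: nat \<Rightarrow> 'a set. range A \<subseteq> rc_borel \<Omega> \<longrightarrow> disjoint_family A \<longrightarrow>
        (\<Union>i. A i) \<in> rc_borel \<Omega> \<longrightarrow> (\<lambda>i. \<nu> (A i)) sums \<nu> (\<Union>i. A i))"

text \<open>
  The positive and negative variations (Jordan decomposition), as Borel measures on the whole space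
  that vanish outside \<open>\<Omega>\<close>.  Sets \<open>B\<close> with \<open>\<nu> B < 0\<close> contribute \<open>ennreal (\<nu> B) = 0\<close>.
\<close>

definition pos_variation :: "'a::euclidean_space set \<Rightarrow> ('a set \<Rightarrow> real) \<Rightarrow> 'a measure" where
  "pos_variation \<Omega> \<nu> =
     measure_of UNIV (sets borel) (\<lambda>A. SUP B \<in> {B \<in> rc_borel \<Omega>. B \<subseteq> A}. ennreal (\<nu> B))"

definition neg_variation :: "'a::euclidean_space set \<Rightarrow> ('a set \<Rightarrow> real) \<Rightarrow> 'a measure" where
  "neg_variation \<Omega> \<nu> = pos_variation \<Omega> (\<lambda>A. - \<nu> A)"

definition signed_integral ::
  "'a::euclidean_space set \<Rightarrow> ('a set \<Rightarrow> real) \<Rightarrow> ('a \<Rightarrow> real) \<Rightarrow> real" where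
  "signed_integral \<Omega> \<nu> \<phi> =
     (LINT x|pos_variation \<Omega> \<nu>. \<phi> x) - (LINT x|neg_variation \<Omega> \<nu>. \<phi> x)"

definition represents_neg_laplacian ::
  "'a::euclidean_space set \<Rightarrow> ('a \<Rightarrow> real) \<Rightarrow> ('a set \<Rightarrow> real) \<Rightarrow> bool" where
  "represents_neg_laplacian \<Omega> u \<nu> \<longleftrightarrow>
     (\<forall>\<phi>. test_function \<Omega> \<phi> \<longrightarrow>
        - (LINT x:\<Omega>|lborel. u x * laplacian \<phi> x) = signed_integral \<Omega> \<nu> \<phi>)"

definition signed_nonneg :: "'a::euclidean_space set \<Rightarrow> ('a set \<Rightarrow> real) \<Rightarrow> bool" where
  "signed_nonneg \<Omega> \<nu> \<longleftrightarrow> (\<forall>A\<in>rc_borel \<Omega>. 0 \<le> \<nu> A)"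

definition signed_abs_cont :: "'a::euclidean_space set \<Rightarrow> ('a set \<Rightarrow> real) \<Rightarrow> bool" where
  "signed_abs_cont \<Omega> \<nu> \<longleftrightarrow> (\<forall>A\<in>rc_borel \<Omega>. A \<in> null_sets lborel \<longrightarrow> \<nu> A = 0)"

definition signed_singular :: "'a::euclidean_space set \<Rightarrow> ('a set \<Rightarrow> real) \<Rightarrow> bool" where
  "signed_singular \<Omega> \<nu> \<longleftrightarrow>
     (\<exists>N \<in> null_sets lborel. \<forall>A\<in>rc_borel \<Omega>. A \<inter> N = {} \<longrightarrow> \<nu> A = 0)"

definition lebesgue_decomposition ::
  "'a::euclidean_space set \<Rightarrow> ('a set \<Rightarrow> real) \<Rightarrow> ('a set \<Rightarrow> real) \<Rightarrow> ('a set \<Rightarrow> real) \<Rightarrow> bool" where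
  "lebesgue_decomposition \<Omega> \<mu> \<mu>ac \<mu>s \<longleftrightarrow>
     signed_radon \<Omega> \<mu>ac \<and> signed_radon \<Omega> \<mu>s \<and>
     (\<forall>A\<in>rc_borel \<Omega>. \<mu> A = \<mu>ac A + \<mu>s A) \<and>
     signed_abs_cont \<Omega> \<mu>ac \<and> signed_singular \<Omega> \<mu>s"

definition has_lebesgue_density ::
  "'a::euclidean_space set \<Rightarrow> ('a set \<Rightarrow> real) \<Rightarrow> ('a \<Rightarrow> real) \<Rightarrow> bool" where
  "has_lebesgue_density \<Omega> \<nu> g \<longleftrightarrow>
     g \<in> borel_measurable lborel \<and>
     (\<forall>A\<in>rc_borel \<Omega>. set_integrable lborel A g \<and> \<nu> A = (LINT x:A|lborel. g x))"

end

theory Submission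
  imports Defs
begin

text \<open>
  Let \<open>x\<close> be a point of \<open>\<Omega>\<close> and \<open>y\<close> a nearest boundary point.  Two functions touch the distance
  function \<open>d\<close> from above at \<open>x\<close>: the distance to \<open>y\<close>, and the height above the boundary graph over
  the tangent hyperplane at \<open>y\<close>.  The first bounds the second difference quotients of \<open>d\<close> from above
  by \<open>1 / d(x)\<close>; the second shows that the limit superior of their sum over the coordinate directions
  is at most \<open>- (n - 1) H(y)\<close>.  Moving the difference quotients to a test function and passing to the
  limit gives \<open>- \<Delta>d + c \<ge> 0\<close> as a distribution, where \<open>c\<close> is the constant \<open>- (n - 1) inf H\<close> if the
  infimum is finite, and \<open>n / d\<close> otherwise.  By the Riesz representation theorem this is a Radon
  measure \<open>M\<close>, so that \<open>\<mu> = M - c dx\<close>.  The singular part of \<open>\<mu>\<close> is that of \<open>M\<close> and its absolutely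
  continuous part has density at least \<open>- c\<close>.
\<close>

section \<open>Functions of class \<open>C\<^sup>k\<close>\<close>

text \<open>Both touching functions lie above the distance function, so its Laplacian is controlled
  on one side only. This is why the argument produces a positive functional and never an explicit
  formula; no differentiability of the distance enters. The functional contains second derivatives
  of the test function, hence lives on C^2 functions with compact support instead of all continuous
  ones, and the Riesz construction is carried out on that class with cut-offs of this regularity.
  The function n / d is the sum of the bounds 1 / d over the n coordinate directions; it is locally
  bounded in \<Omega>, which is all that the measure theory asks of c. Since M and c dx can both be
  infinite on \<Omega>, their difference is treated through a density with respect to M + dx, whose
  sign gives the variations. On the geometric side, the charts of the hypothesis need not be tangent
  to the boundary, and the mean curvature is a definite description. Tangent charts come from the
  implicit function theorem, principal directions from the spectral theorem, uniqueness from the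
  fact that \<Omega> determines its graph near the point.\<close>

lemma dir_deriv_eq:
  "(f has_derivative f') (at x) \<Longrightarrow> dir_deriv v f x = f' v"
  unfolding dir_deriv_def by (metis frechet_derivative_at)

lemma Ck_on_SucD: "Ck_on (Suc k) S f \<Longrightarrow> Ck_on k S f"
proof (induction k arbitrary: f)
  case 0
  then show ?case
    by (auto intro!: continuous_at_imp_continuous_on differentiable_imp_continuous_within)
next
  case (Suc k)
  then show ?case by (meson Ck_on.simps(2))
qed

lemma Ck_on_mono: "Ck_on k S f \<Longrightarrow> j \<le> k \<Longrightarrow> Ck_on j S f"
  by (induction k) (auto simp: le_Suc_eq simp del: Ck_on.simps dest: Ck_on_SucD)

lemma Ck_on_continuous: "Ck_on k S f \<Longrightarrow> continuous_on S f"
  using Ck_on_mono[of k S f 0] by simp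

lemma dir_deriv_has_derivative:
  "f differentiable (at x) \<Longrightarrow> (f has_derivative (\<lambda>v. dir_deriv v f x)) (at x)"
  by (simp add: dir_deriv_def frechet_derivative_works)

lemma dir_deriv_transform:
  assumes "f differentiable (at x)" "open S" "x \<in> S" "\<And>y. y \<in> S \<Longrightarrow> f y = g y"
  shows "dir_deriv v g x = dir_deriv v f x" "g differentiable (at x)"
proof -
  have "(g has_derivative (\<lambda>v. dir_deriv v f x)) (at x)"
    using dir_deriv_has_derivative[OF assms(1)] assms(2-4) by (rule has_derivative_transform_within_open)
  then show "dir_deriv v g x = dir_deriv v f x" "g differentiable (at x)"
    by (auto simp: dir_deriv_eq differentiable_def)
qed

lemma Ck_on_cong:
  "Ck_on k S f \<Longrightarrow> open S \<Longrightarrow> (\<And>x. x \<in> S \<Longrightarrow> f x = g x) \<Longrightarrow> Ck_on k S g"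
proof (induction k arbitrary: f g)
  case 0
  then show ?case by (simp cong: continuous_on_cong)
next
  case (Suc k)
  have "Ck_on k S (dir_deriv b g)" if "b \<in> Basis" for b
  proof (rule Suc.IH)
    show "Ck_on k S (dir_deriv b f)" using Suc.prems that by simp
    show "dir_deriv b f x = dir_deriv b g x" if "x \<in> S" for x
      using dir_deriv_transform(1)[of f x S g b] Suc.prems that by simp
  qed (use Suc.prems in simp)
  moreover have "g differentiable (at x)" if "x \<in> S" for x
    using dir_deriv_transform(2)[of f x S g] Suc.prems that by simp
  ultimately show ?case by simp
qed

text \<open>\<open>Ck_on\<close> refers to the choice operator inside
  \<open>frechet_derivative\<close>. This rule works with an explicit derivative instead, so that
  the closure lemmas below become inductions on k.\<close>

lemma Ck_on_SucI:
  assumes "open S"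
    and "\<And>x. x \<in> S \<Longrightarrow> (f has_derivative (\<lambda>v. f' v x)) (at x)"
    and "\<And>b. b \<in> Basis \<Longrightarrow> Ck_on k S (f' b)"
  shows "Ck_on (Suc k) S f"
proof -
  have "Ck_on k S (dir_deriv b f)" if "b \<in> Basis" for b
    by (rule Ck_on_cong[OF assms(3)[OF that] assms(1)]) (simp add: dir_deriv_eq[OF assms(2)])
  then show ?thesis using assms(2) by (auto simp: differentiable_def)
qed

lemma Ck_on_has_derivative:
  "Ck_on (Suc k) S f \<Longrightarrow> x \<in> S \<Longrightarrow> (f has_derivative (\<lambda>v. dir_deriv v f x)) (at x)"
  by (auto intro: dir_deriv_has_derivative)

lemma linear_dir_deriv: "f differentiable (at x) \<Longrightarrow> linear (\<lambda>v. dir_deriv v f x)"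
  using dir_deriv_has_derivative has_derivative_linear by blast

lemma dir_deriv_expand:
  assumes "f differentiable (at x)"
  shows "dir_deriv v f x = (\<Sum>b\<in>Basis. (v \<bullet> b) * dir_deriv b f x)"
proof -
  note lin = linear_dir_deriv[OF assms]
  have "dir_deriv v f x = dir_deriv (\<Sum>b\<in>Basis. (v \<bullet> b) *\<^sub>R b) f x"
    by (simp add: euclidean_representation)
  also have "\<dots> = (\<Sum>b\<in>Basis. (v \<bullet> b) * dir_deriv b f x)"
    using linear_sum[OF lin, of "\<lambda>b. (v \<bullet> b) *\<^sub>R b" Basis] linear_scale[OF lin] by simp
  finally show ?thesis .
qed

lemma Ck_on_const: "open S \<Longrightarrow> Ck_on k S (\<lambda>x. c)"
proof (induction k arbitrary: c)
  case (Suc k)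
  show ?case by (rule Ck_on_SucI[where f' = "\<lambda>v x. 0"]) (use Suc in auto)
qed simp

lemma Ck_on_add:
  "open S \<Longrightarrow> Ck_on k S f \<Longrightarrow> Ck_on k S g \<Longrightarrow> Ck_on k S (\<lambda>x. f x + g x)"
proof (induction k arbitrary: f g)
  case (Suc k)
  have "Ck_on k S (\<lambda>x. dir_deriv b f x + dir_deriv b g x)" if "b \<in> Basis" for b
    using Suc that by simp
  moreover have "((\<lambda>x. f x + g x) has_derivative (\<lambda>v. dir_deriv v f x + dir_deriv v g x)) (at x)"
    if "x \<in> S" for x
    using Suc.prems that by (intro has_derivative_add Ck_on_has_derivative)
  ultimately show ?case
    using \<open>open S\<close> by (intro Ck_on_SucI[where f' = "\<lambda>v x. dir_deriv v f x + dir_deriv v g x"]) auto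
qed (auto intro: continuous_intros)

lemma Ck_on_mult:
  "open S \<Longrightarrow> Ck_on k S f \<Longrightarrow> Ck_on k S g \<Longrightarrow> Ck_on k S (\<lambda>x. f x * g x)"
proof (induction k arbitrary: f g)
  case (Suc k)
  have "Ck_on k S f" "Ck_on k S g" using Suc.prems Ck_on_SucD by blast+
  then have "Ck_on k S (\<lambda>x. f x * dir_deriv b g x + dir_deriv b f x * g x)" if "b \<in> Basis" for b
    using Suc that by (intro Ck_on_add) auto
  moreover have "((\<lambda>x. f x * g x) has_derivative
      (\<lambda>v. f x * dir_deriv v g x + dir_deriv v f x * g x)) (at x)" if "x \<in> S" for x
    using Suc.prems that by (intro has_derivative_mult Ck_on_has_derivative)
  ultimately show ?case
    using \<open>open S\<close>
    by (intro Ck_on_SucI[where f' = "\<lambda>v x. f x * dir_deriv v g x + dir_deriv v f x * g x"]) auto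
qed (auto intro: continuous_intros)

lemma Ck_on_scale: "open S \<Longrightarrow> Ck_on k S f \<Longrightarrow> Ck_on k S (\<lambda>x. c * f x)"
  by (intro Ck_on_mult Ck_on_const)

lemma Ck_on_diff:
  "open S \<Longrightarrow> Ck_on k S f \<Longrightarrow> Ck_on k S g \<Longrightarrow> Ck_on k S (\<lambda>x. f x - g x)"
  using Ck_on_add[of S k f "\<lambda>x. (-1) * g x"] Ck_on_scale[of S k g "-1"] by simp

lemma Ck_on_sum:
  "open S \<Longrightarrow> (\<And>i. i \<in> I \<Longrightarrow> Ck_on k S (f i)) \<Longrightarrow> Ck_on k S (\<lambda>x. \<Sum>i\<in>I. f i x)"
  by (induction I rule: infinite_finite_induct) (auto intro: Ck_on_const Ck_on_add)

text \<open>\<open>Ck_on\<close> speaks only of basis directions; an arbitrary direction is a linear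
  combination of them. Arbitrary directions are needed for tangent vectors of the boundary.\<close>

lemma Ck_on_dir_deriv:
  assumes "open S" "Ck_on (Suc k) S f" shows "Ck_on k S (dir_deriv v f)"
proof (rule Ck_on_cong)
  show "Ck_on k S (\<lambda>x. \<Sum>b\<in>Basis. (v \<bullet> b) * dir_deriv b f x)"
    using assms by (auto intro!: Ck_on_sum Ck_on_scale)
  show "(\<Sum>b\<in>Basis. (v \<bullet> b) * dir_deriv b f x) = dir_deriv v f x" if "x \<in> S" for x
    using assms that dir_deriv_expand[of f x v] by simp
qed fact

lemma Ck_on_Un:
  "open S \<Longrightarrow> open T \<Longrightarrow> Ck_on k S f \<Longrightarrow> Ck_on k T f \<Longrightarrow> Ck_on k (S \<union> T) f"
  by (induction k arbitrary: f) (auto simp: continuous_on_open_Un)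

lemma Ck_on_subset: "Ck_on k T f \<Longrightarrow> S \<subseteq> T \<Longrightarrow> Ck_on k S f"
  by (induction k arbitrary: f) (auto intro: continuous_on_subset)

lemma Ck_on_inverse:
  "open S \<Longrightarrow> Ck_on k S f \<Longrightarrow> (\<And>x. x \<in> S \<Longrightarrow> f x \<noteq> 0) \<Longrightarrow> Ck_on k S (\<lambda>x. inverse (f x))"
proof (induction k arbitrary: f)
  case (Suc k)
  have "Ck_on k S f" using Suc.prems Ck_on_SucD by blast
  then have inv: "Ck_on k S (\<lambda>x. inverse (f x))" using Suc by blast
  show ?case
  proof (rule Ck_on_SucI[where f' = "\<lambda>v x. (-1) * (inverse (f x) * dir_deriv v f x * inverse (f x))"])
    show "((\<lambda>x. inverse (f x)) has_derivative
        (\<lambda>v. (-1) * (inverse (f x) * dir_deriv v f x * inverse (f x)))) (at x)" if "x \<in> S" for x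
      by (rule has_derivative_eq_rhs[OF Deriv.has_derivative_inverse[OF _ Ck_on_has_derivative[OF Suc.prems(2) that]]])
        (use Suc.prems(3) that in auto)
    show "Ck_on k S (\<lambda>x. (-1) * (inverse (f x) * dir_deriv b f x * inverse (f x)))" for b
      using Suc.prems inv by (intro Ck_on_scale Ck_on_mult Ck_on_dir_deriv)
  qed fact
qed (auto intro!: continuous_intros)

lemma Ck_on_inner: "Ck_on k UNIV (\<lambda>x. x \<bullet> a)"
proof (cases k)
  case (Suc j)
  show ?thesis unfolding Suc
    by (rule Ck_on_SucI[where f' = "\<lambda>v x. v \<bullet> a"]) (auto intro!: Ck_on_const derivative_eq_intros)
qed (auto intro: continuous_intros)

lemma Ck_on_norm_sq: "Ck_on k UNIV (\<lambda>x. (norm (x - a))\<^sup>2)"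
proof -
  have "(norm (x - a))\<^sup>2 = (\<Sum>b\<in>Basis. (x \<bullet> b - a \<bullet> b) * (x \<bullet> b - a \<bullet> b))" for x
    unfolding power2_norm_eq_inner by (subst euclidean_inner) (simp add: inner_diff_left)
  then show ?thesis by (auto intro!: Ck_on_sum Ck_on_mult Ck_on_diff Ck_on_inner Ck_on_const)
qed

lemma Ck_on_compose:
  assumes f: "Ck_on (Suc k) UNIV f"
    and h: "\<And>u. (h has_real_derivative h' u) (at u)"
    and h': "Ck_on k UNIV (\<lambda>x. h' (f x))"
  shows "Ck_on (Suc k) UNIV (\<lambda>x. h (f x))"
proof (rule Ck_on_SucI[where f' = "\<lambda>v x. h' (f x) * dir_deriv v f x"])
  show "((\<lambda>x. h (f x)) has_derivative (\<lambda>v. h' (f x) * dir_deriv v f x)) (at x)" for x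
    by (rule has_derivative_compose[of f "\<lambda>v. dir_deriv v f x" x UNIV h "\<lambda>a. h' (f x) * a"])
      (use f h[of "f x"] in \<open>auto simp: has_field_derivative_def intro!: dir_deriv_has_derivative\<close>)
qed (use f h' in \<open>auto intro!: Ck_on_mult Ck_on_dir_deriv simp del: Ck_on.simps\<close>)

text \<open>Only continuity of \<open>h''\<close> is asked, because the profile used for cut-offs is
  piecewise cubic and has no third derivative at its break points.\<close>

lemma C2_compose:
  assumes f: "Ck_on 2 UNIV f"
    and h: "\<And>u. (h has_real_derivative h' u) (at u)"
    and h': "\<And>u. (h' has_real_derivative h'' u) (at u)"
    and h'': "continuous_on UNIV h''"
  shows "Ck_on 2 UNIV (\<lambda>x. h (f x))"
proof -
  have f': "Ck_on (Suc (Suc 0)) UNIV f" using f by (simp only: numeral_2_eq_2)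
  have "continuous_on UNIV (\<lambda>x. h'' (f x))"
    using h'' Ck_on_continuous[OF f] continuous_on_compose2 by blast
  then show ?thesis unfolding numeral_2_eq_2
    by (intro Ck_on_compose[OF f' h] Ck_on_compose[OF Ck_on_SucD[OF f'] h']) simp
qed

section \<open>Second difference quotients\<close>

lemma line_has_real_derivative:
  assumes "f differentiable (at (x + s *\<^sub>R b))"
  shows "((\<lambda>s. f (x + s *\<^sub>R b)) has_real_derivative dir_deriv b f (x + s *\<^sub>R b)) (at s)"
proof -
  have "((\<lambda>s. f (x + s *\<^sub>R b)) has_derivative (\<lambda>h. dir_deriv (h *\<^sub>R b) f (x + s *\<^sub>R b))) (at s)"
    by (rule has_derivative_compose[of "\<lambda>s. x + s *\<^sub>R b" "\<lambda>h. h *\<^sub>R b" s UNIV f])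
      (use assms in \<open>auto intro!: derivative_eq_intros dir_deriv_has_derivative\<close>)
  moreover have "(\<lambda>h. dir_deriv (h *\<^sub>R b) f (x + s *\<^sub>R b)) = (*) (dir_deriv b f (x + s *\<^sub>R b))"
    using linear_scale[OF linear_dir_deriv[OF assms]] by (auto simp: mult.commute)
  ultimately show ?thesis by (simp add: has_field_derivative_def)
qed

definition second_diff :: "('a::euclidean_space \<Rightarrow> real) \<Rightarrow> 'a \<Rightarrow> 'a \<Rightarrow> real \<Rightarrow> real" where
  "second_diff f x b t = (f (x + t *\<^sub>R b) + f (x - t *\<^sub>R b) - 2 * f x) / t\<^sup>2"

text \<open>Taylor's formula of order two for the even function s -> f (x + s b) + f (x - s b),
  whose first derivative vanishes at 0. In the proof, \<open>D 0\<close>, \<open>D 1\<close> and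
  \<open>D 2\<close> are this function and its two derivatives.\<close>

lemma second_diff_mean:
  assumes f: "Ck_on 2 UNIV f" and t: "0 < t"
  obtains s where "0 < s" "s < t"
    "second_diff f x b t =
       (dir_deriv b (dir_deriv b f) (x + s *\<^sub>R b) + dir_deriv b (dir_deriv b f) (x - s *\<^sub>R b)) / 2"
proof -
  have d: "f differentiable (at y)" "dir_deriv b f differentiable (at y)" for y
    using f Ck_on_dir_deriv[of UNIV "Suc 0" f b] by (simp_all add: numeral_2_eq_2)
  define D where "D n = (if n = 0 then (\<lambda>s. f (x + s *\<^sub>R b) + f (x + s *\<^sub>R (- b)))
     else if n = 1 then (\<lambda>s. dir_deriv b f (x + s *\<^sub>R b) + dir_deriv (- b) f (x + s *\<^sub>R (-b)))
     else (\<lambda>s. dir_deriv b (dir_deriv b f) (x + s *\<^sub>R b)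
         + dir_deriv b (dir_deriv b f) (x + s *\<^sub>R (- b))))" for n :: nat
  have neg: "dir_deriv (- b) f y = - dir_deriv b f y"
    "dir_deriv (- b) (dir_deriv b f) y = - dir_deriv b (dir_deriv b f) y" for y
    using linear_neg[OF linear_dir_deriv] d by blast+
  have 1: "(D 0 has_real_derivative D 1 s) (at s)" for s
    using DERIV_add[OF line_has_real_derivative[OF d(1), where x = x and s = s and b = b]
        line_has_real_derivative[OF d(1), where x = x and s = s and b = "- b"]]
    by (simp add: D_def)
  have 2: "(D 1 has_real_derivative D 2 s) (at s)" for s
  proof -
    have e: "D 1 = (\<lambda>s. dir_deriv b f (x + s *\<^sub>R b) - dir_deriv b f (x + s *\<^sub>R (-b)))"
      unfolding D_def by (auto simp: neg)
    show ?thesis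
      unfolding e using DERIV_diff[OF line_has_real_derivative[OF d(2)[of "x + s *\<^sub>R b"]]
          line_has_real_derivative[OF d(2)[of "x + s *\<^sub>R (-b)"]]]
      by (simp add: D_def neg)
  qed
  have der: "\<forall>m s. m < 2 \<and> 0 \<le> s \<and> s \<le> t \<longrightarrow> (D m has_real_derivative D (Suc m) s) (at s)"
    using 1 2 by (auto simp: less_Suc_eq numeral_2_eq_2)
  obtain s where s: "0 < s" "s < t"
    "D 0 t = (\<Sum>m<2. D m 0 / fact m * t ^ m) + D 2 s / fact 2 * t ^ 2"
    using Maclaurin[of t 2 D "D 0"] t der by auto
  have "D 0 t = 2 * f x + D 2 s / 2 * t\<^sup>2"
    using s(3) by (simp add: numeral_2_eq_2 D_def neg)
  then show ?thesis
    using that[of s] s t by (simp add: D_def second_diff_def field_simps)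
qed

lemma second_diff_tendsto:
  assumes f: "Ck_on 2 UNIV f"
  shows "(second_diff f x b \<longlongrightarrow> dir_deriv b (dir_deriv b f) x) (at_right 0)"
proof -
  let ?D = "dir_deriv b (dir_deriv b f)"
  have "continuous_on UNIV ?D"
    using Ck_on_continuous[OF Ck_on_dir_deriv[OF open_UNIV Ck_on_dir_deriv[of UNIV "Suc 0" f b], of b]] f
    by (simp only: numeral_2_eq_2 open_UNIV)
  then have cont: "isCont ?D x" by (simp add: continuous_on_eq_continuous_at)
  show ?thesis
  proof (rule tendstoI)
    fix e :: real assume e: "0 < e"
    obtain \<delta> where \<delta>: "\<delta> > 0" "\<And>y. dist y x < \<delta> \<Longrightarrow> dist (?D y) (?D x) < e"
      using cont e unfolding continuous_at_eps_delta by blast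
    \<comment> \<open>The summand 1 in the denominator covers b = 0, which occurs later when a
      coordinate vector is projected along itself.\<close>
    have "dist (second_diff f x b t) (?D x) < e" if t: "0 < t" "t < \<delta> / (norm b + 1)" for t
    proof -
      obtain s where s: "0 < s" "s < t" "second_diff f x b t = (?D (x + s *\<^sub>R b) + ?D (x - s *\<^sub>R b)) / 2"
        using second_diff_mean[OF f t(1)] by metis
      have "s * norm b \<le> t * (norm b + 1)" using s t by (intro mult_mono) auto
      also have "\<dots> < \<delta>" using t by (simp add: pos_less_divide_eq add_nonneg_pos)
      finally have "dist (x + s *\<^sub>R b) x < \<delta>" "dist (x - s *\<^sub>R b) x < \<delta>"
        using s by (simp_all add: dist_norm)
      then have "dist (?D (x + s *\<^sub>R b)) (?D x) < e" "dist (?D (x - s *\<^sub>R b)) (?D x) < e"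
        using \<delta>(2) by blast+
      then show ?thesis using s(3) by (simp add: dist_real_def field_simps)
    qed
    moreover have "0 < \<delta> / (norm b + 1)" using \<delta>(1) by (simp add: add_nonneg_pos)
    ultimately show "\<forall>\<^sub>F t in at_right 0. dist (second_diff f x b t) (?D x) < e"
      using eventually_at_right_less[of 0] by (auto simp: eventually_at_right_field)
  qed
qed

section \<open>A C^2 approximation of the positive part\<close>

lemma pos_part_power_derivative:
  "((\<lambda>u::real. (max 0 (u - a)) ^ (k + 2)) has_real_derivative
     real (k + 2) * (max 0 (u - a)) ^ (k + 1)) (at u)"
proof -
  consider "u < a" | "u > a" | "u = a" by linarith
  then show ?thesis
  proof cases
    case 1
    have "((\<lambda>u::real. 0) has_real_derivative 0) (at u)" by simp
    then have "((\<lambda>u::real. (max 0 (u - a)) ^ (k + 2)) has_real_derivative 0) (at u)"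
      by (rule has_field_derivative_transform_within_open[of _ _ _ "{..<a}"]) (use 1 in auto)
    then show ?thesis using 1 by simp
  next
    case 2
    have "((\<lambda>u::real. (u - a) ^ (k + 2)) has_real_derivative real (k + 2) * (u - a) ^ (k + 1)) (at u)"
      using DERIV_fun_pow[of "\<lambda>u. u - a" 1 u "k + 2"]
      by (simp add: DERIV_diff[OF DERIV_ident DERIV_const, simplified])
    then have "((\<lambda>u::real. (max 0 (u - a)) ^ (k + 2)) has_real_derivative real (k + 2) * (u - a) ^ (k + 1)) (at u)"
      by (rule has_field_derivative_transform_within_open[of _ _ _ "{a<..}"]) (use 2 in auto)
    then show ?thesis using 2 by simp
  next
    case 3
    \<comment> \<open>At the kink the difference quotient is (max 0 h)^(k+2) / h, which is at most
      (max 0 h)^(k+1) in absolute value.\<close>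
    have "((\<lambda>h::real. (max 0 h) ^ (k + 2) / h) \<longlongrightarrow> 0) (at 0)"
    proof (rule Lim_null_comparison)
      show "\<forall>\<^sub>F h in at 0. norm ((max 0 h) ^ (k + 2) / h) \<le> (max 0 h) ^ (k + 1)"
        by (rule always_eventually) (auto simp: max_def)
      show "((\<lambda>h::real. (max 0 h) ^ (k + 1)) \<longlongrightarrow> 0) (at 0)"
        by (auto intro!: tendsto_eq_intros)
    qed
    then show ?thesis using 3 by (simp add: DERIV_def)
  qed
qed

text \<open>The second derivative is the piecewise linear hat function on \<open>[0, 2]\<close>.\<close>

definition soft_pos :: "real \<Rightarrow> real" where
  "soft_pos u = ((max 0 (u - 0)) ^ 3 - 2 * (max 0 (u - 1)) ^ 3 + (max 0 (u - 2)) ^ 3) / 6"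

definition soft_step :: "real \<Rightarrow> real" where
  "soft_step u = ((max 0 (u - 0)) ^ 2 - 2 * (max 0 (u - 1)) ^ 2 + (max 0 (u - 2)) ^ 2) / 2"

lemma soft_pos_derivative: "(soft_pos has_real_derivative soft_step u) (at u)"
proof -
  have *: "((\<lambda>u::real. (max 0 (u - a)) ^ 3) has_real_derivative 3 * (max 0 (u - a))\<^sup>2) (at u)" for a
    using pos_part_power_derivative[where k = 1, of a u] by (simp add: numeral_3_eq_3 power2_eq_square)
  show ?thesis unfolding soft_pos_def
    by (rule derivative_eq_intros * | simp add: soft_step_def)+
qed

lemma soft_step_derivative:
  "(soft_step has_real_derivative (max 0 u - 2 * max 0 (u - 1) + max 0 (u - 2))) (at u)"
proof -
  have *: "((\<lambda>u::real. (max 0 (u - a))\<^sup>2) has_real_derivative 2 * (max 0 (u - a))) (at u)" for a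
    using pos_part_power_derivative[where k = 0, of a u] by (simp add: numeral_2_eq_2)
  show ?thesis unfolding soft_step_def
    by (rule derivative_eq_intros * | simp)+
qed

text \<open>The second difference u^3 - 2 (u - 1)^3 + (u - 2)^3 of the cube is 6 (u - 1). Beyond the
  support of the hat function \<open>soft_pos\<close> is therefore affine with slope one, shifted by
  one.\<close>

lemma soft_pos_0: "u \<le> 0 \<Longrightarrow> soft_pos u = 0"
  and soft_pos_large: "u \<ge> 2 \<Longrightarrow> soft_pos u = u - 1"
  by (auto simp: soft_pos_def max_def field_simps power3_eq_cube)

lemma soft_step_bounds: "0 \<le> soft_step u" "soft_step u \<le> 1"
proof -
  consider "u \<le> 0" | "0 < u" "u \<le> 1" | "1 < u" "u \<le> 2" | "2 < u" by linarith
  then have "0 \<le> soft_step u \<and> soft_step u \<le> 1"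
  proof cases
    case 2
    then show ?thesis by (simp add: soft_step_def max_def power_le_one order_trans[of _ 1 2])
  next
    case 3
    have "soft_step u = 1 - (2 - u)\<^sup>2 / 2"
      using 3 by (simp add: soft_step_def max_def power2_eq_square field_simps)
    moreover have "(2 - u)\<^sup>2 \<le> 1\<^sup>2" using 3 by (intro power_mono) auto
    ultimately show ?thesis by simp
  next
    case 4
    then have "soft_step u = 1"
      by (simp add: soft_step_def max_def power2_eq_square field_simps)
    then show ?thesis by simp
  qed (simp add: soft_step_def)
  then show "0 \<le> soft_step u" "soft_step u \<le> 1" by auto
qed

lemma soft_pos_mono: "u \<le> v \<Longrightarrow> soft_pos u \<le> soft_pos v"
  using DERIV_nonneg_imp_nondecreasing[of u v soft_pos] soft_pos_derivative soft_step_bounds by blast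

lemma soft_pos_slope: "u \<le> v \<Longrightarrow> soft_pos v - soft_pos u \<le> v - u"
proof -
  assume "u \<le> v"
  have "((\<lambda>u. u - soft_pos u) has_real_derivative 1 - soft_step u) (at u)" for u
    by (auto intro!: derivative_eq_intros soft_pos_derivative)
  then have "u - soft_pos u \<le> v - soft_pos v"
    using DERIV_nonneg_imp_nondecreasing[of u v "\<lambda>u. u - soft_pos u"] \<open>u \<le> v\<close> soft_step_bounds(2)
    by (metis diff_ge_0_iff_ge)
  then show ?thesis by simp
qed

text \<open>For u \<ge> 0 \<open>soft_pos\<close> differs from the identity by at most one,
  independently of u. Scaling a test function by a large factor makes this error negligible.\<close>

lemma soft_pos_bounds: "0 \<le> soft_pos u" "0 \<le> u \<Longrightarrow> soft_pos u \<le> u" "u - 1 \<le> soft_pos u"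
proof -
  show "0 \<le> soft_pos u"
    using soft_pos_mono[of 0 u] soft_pos_0[of 0] soft_pos_0[of u] by linarith
  show "0 \<le> u \<Longrightarrow> soft_pos u \<le> u"
    using soft_pos_slope[of 0 u] soft_pos_0[of 0] by linarith
  show "u - 1 \<le> soft_pos u"
    using soft_pos_slope[of u "max u 2"] soft_pos_large[of "max u 2"] by (cases "u \<le> 2") (simp_all add: max_def)
qed

lemma soft_pos_pos: "0 < u \<Longrightarrow> 0 < soft_pos u"
proof -
  assume u: "0 < u"
  have "0 < soft_pos (min u 1)" using u by (simp add: soft_pos_def)
  then show ?thesis using soft_pos_mono[of "min u 1" u] by simp
qed

lemma C2_soft_pos: "Ck_on 2 UNIV f \<Longrightarrow> Ck_on 2 UNIV (\<lambda>x. soft_pos (f x))"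
  by (rule C2_compose[OF _ soft_pos_derivative soft_step_derivative])
    (auto intro!: continuous_intros)

section \<open>C^2 functions with compact support and cut-offs\<close>

definition C2c :: "'a::euclidean_space set \<Rightarrow> ('a \<Rightarrow> real) set" where
  "C2c U = {\<phi>. Ck_on 2 UNIV \<phi> \<and> (\<exists>K. compact K \<and> K \<subseteq> U \<and> (\<forall>x. x \<notin> K \<longrightarrow> \<phi> x = 0))}"

lemma C2c_mono: "U \<subseteq> V \<Longrightarrow> \<phi> \<in> C2c U \<Longrightarrow> \<phi> \<in> C2c V"
  unfolding C2c_def by blast

lemma C2c_add:
  assumes "\<phi> \<in> C2c U" "\<psi> \<in> C2c U" shows "(\<lambda>x. \<phi> x + \<psi> x) \<in> C2c U"
proof -
  obtain K L where "compact K" "K \<subseteq> U" "\<forall>x. x \<notin> K \<longrightarrow> \<phi> x = 0"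
    "compact L" "L \<subseteq> U" "\<forall>x. x \<notin> L \<longrightarrow> \<psi> x = 0"
    using assms unfolding C2c_def by blast
  then show ?thesis using assms unfolding C2c_def
    by (auto intro!: Ck_on_add exI[of _ "K \<union> L"])
qed

lemma C2c_mult:
  assumes "\<phi> \<in> C2c U" "Ck_on 2 UNIV \<psi>" shows "(\<lambda>x. \<psi> x * \<phi> x) \<in> C2c U"
  using assms unfolding C2c_def by (auto intro!: Ck_on_mult)

lemma C2c_scale: "\<phi> \<in> C2c U \<Longrightarrow> (\<lambda>x. c * \<phi> x) \<in> C2c U"
  by (intro C2c_mult Ck_on_const open_UNIV)

lemma C2c_diff: "\<phi> \<in> C2c U \<Longrightarrow> \<psi> \<in> C2c U \<Longrightarrow> (\<lambda>x. \<phi> x - \<psi> x) \<in> C2c U"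
  using C2c_add[of \<phi> U "\<lambda>x. (-1) * \<psi> x"] C2c_scale[of \<psi> U "-1"] by simp

lemma C2c_zero: "(\<lambda>x. 0) \<in> C2c U"
  unfolding C2c_def by (auto intro!: Ck_on_const exI[of _ "{}"])

lemma C2c_sum: "(\<And>i. i \<in> I \<Longrightarrow> f i \<in> C2c U) \<Longrightarrow> (\<lambda>x. \<Sum>i\<in>I. f i x) \<in> C2c U"
  by (induction I rule: infinite_finite_induct) (auto intro: C2c_zero C2c_add)

lemma C2c_continuous: "\<phi> \<in> C2c U \<Longrightarrow> continuous_on S \<phi>"
  unfolding C2c_def using Ck_on_continuous continuous_on_subset by blast

lemma C2c_bounded:
  assumes "\<phi> \<in> C2c U" obtains B where "B > 0" "\<And>x. \<bar>\<phi> x\<bar> \<le> B"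
proof -
  obtain K where K: "compact K" "\<forall>x. x \<notin> K \<longrightarrow> \<phi> x = 0"
    using assms unfolding C2c_def by blast
  have "bounded (\<phi> ` K)"
    using compact_continuous_image[OF C2c_continuous[OF assms] K(1)] compact_imp_bounded by blast
  then obtain B where "B > 0" "\<forall>x\<in>K. \<bar>\<phi> x\<bar> \<le> B" unfolding bounded_pos by auto
  then show ?thesis using that[of B] K(2) by (metis abs_zero less_imp_le)
qed

text \<open>A finite sum of radial bumps is positive on K; rescaling makes it large there, and the
  difference of two shifted copies of \<open>soft_pos\<close> truncates it at 1. The value is 1 on
  an open set W around K and not just on K, so that multiplying by 1 - \<eta> removes a whole
  neighbourhood of K from a support.\<close>

lemma C2c_bump:
  fixes K :: "'a::euclidean_space set"
  assumes K: "compact K" and U: "open U" and KU: "K \<subseteq> U"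
  obtains \<eta> W where "\<eta> \<in> C2c U" "\<And>x. 0 \<le> \<eta> x" "\<And>x. \<eta> x \<le> 1" "open W" "K \<subseteq> W" "\<And>x. x \<in> W \<Longrightarrow> \<eta> x = 1"
proof (cases "K = {}")
  case True
  show ?thesis by (rule that[of "\<lambda>x. 0" "{}"]) (use True in \<open>auto intro: C2c_zero\<close>)
next
  case False
  have "\<forall>x\<in>K. \<exists>r>0. cball x r \<subseteq> U" using U KU open_contains_cball by blast
  then obtain r where r: "\<And>x. x \<in> K \<Longrightarrow> r x > 0" "\<And>x. x \<in> K \<Longrightarrow> cball x (r x) \<subseteq> U" by metis
  obtain F where F: "F \<subseteq> K" "finite F" "K \<subseteq> (\<Union>x\<in>F. ball x (r x))"
    by (rule compactE_image[OF K, of K "\<lambda>x. ball x (r x)"]) (use r in force)+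
  define b where "b y = (\<Sum>x\<in>F. soft_pos ((r x)\<^sup>2 - (norm (y - x))\<^sup>2))" for y
  have C: "(\<lambda>y. soft_pos ((r x)\<^sup>2 - (norm (y - x))\<^sup>2)) \<in> C2c U" if "x \<in> F" for x
  proof -
    have x: "r x > 0" "cball x (r x) \<subseteq> U" using that F(1) r[of x] by blast+
    have "soft_pos ((r x)\<^sup>2 - (norm (y - x))\<^sup>2) = 0" if "y \<notin> cball x (r x)" for y
    proof -
      have "r x < norm (y - x)" using that by (simp add: dist_norm norm_minus_commute)
      then have "(r x)\<^sup>2 \<le> (norm (y - x))\<^sup>2" using x by (intro power_mono) auto
      then show ?thesis by (simp add: soft_pos_0)
    qed
    moreover have "Ck_on 2 UNIV (\<lambda>y. soft_pos ((r x)\<^sup>2 - (norm (y - x))\<^sup>2))"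
      by (intro C2_soft_pos Ck_on_diff Ck_on_const Ck_on_norm_sq open_UNIV)
    ultimately show ?thesis unfolding C2c_def using x by (auto intro!: exI[of _ "cball x (r x)"])
  qed
  have bC: "b \<in> C2c U" unfolding b_def using C by (intro C2c_sum) auto
  have bpos: "b y > 0" if yK: "y \<in> K" for y
  proof -
    obtain x where x: "x \<in> F" "y \<in> ball x (r x)" using F yK by auto
    have "norm (y - x) < r x" using x by (simp add: dist_norm norm_minus_commute)
    then have "(norm (y - x))\<^sup>2 < (r x)\<^sup>2" by (intro power_strict_mono) auto
    then show ?thesis unfolding b_def using x F
      by (intro sum_pos2[of _ x]) (auto intro: soft_pos_pos soft_pos_bounds)
  qed
  obtain y0 where y0: "y0 \<in> K" "\<And>y. y \<in> K \<Longrightarrow> b y0 \<le> b y"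
    using continuous_attains_inf[OF K False C2c_continuous[OF bC]] by blast
  \<comment> \<open>On K this gives a * b \<ge> 4. Where a * b > 3, both a * b and a * b - 1 exceed
    2, so \<open>soft_pos\<close> is affine at both and the difference is 1. Taking 4 instead of 3
    leaves room for a strict inequality, hence an open set.\<close>
  define a where "a = 4 / b y0"
  have a: "a > 0" using bpos[OF y0(1)] by (simp add: a_def)
  have b0: "0 \<le> b y" for y unfolding b_def by (intro sum_nonneg soft_pos_bounds)
  define \<eta> where "\<eta> y = soft_pos (a * b y) - soft_pos (a * b y - 1)" for y
  show ?thesis
  proof (rule that[of \<eta> "{y. 3 < a * b y}"])
    have bck: "Ck_on 2 UNIV b" using bC by (simp add: C2c_def)
    obtain L where L: "compact L" "L \<subseteq> U" "\<forall>x. x \<notin> L \<longrightarrow> b x = 0"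
      using bC by (auto simp: C2c_def)
    have "Ck_on 2 UNIV \<eta>" unfolding \<eta>_def
      by (intro Ck_on_diff C2_soft_pos Ck_on_scale Ck_on_const open_UNIV bck)
    moreover have "\<eta> x = 0" if "x \<notin> L" for x using L that by (simp add: \<eta>_def soft_pos_0)
    ultimately show "\<eta> \<in> C2c U" unfolding C2c_def using L by blast
    show "0 \<le> \<eta> x" "\<eta> x \<le> 1" for x
      using soft_pos_mono[of "a * b x - 1" "a * b x"] soft_pos_slope[of "a * b x - 1" "a * b x"]
      by (auto simp: \<eta>_def)
    have "continuous_on UNIV (\<lambda>y. a * b y)"
      by (intro continuous_intros C2c_continuous[OF bC])
    then show "open {y. 3 < a * b y}"
      using open_Collect_less[OF continuous_on_const] by blast
    show "K \<subseteq> {y. 3 < a * b y}"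
    proof
      fix y assume "y \<in> K"
      then have "b y0 \<le> b y" "b y0 > 0" using y0 bpos by auto
      then show "y \<in> {y. 3 < a * b y}" unfolding a_def by (simp add: field_simps)
    qed
    show "\<eta> x = 1" if "x \<in> {y. 3 < a * b y}" for x
      using that by (simp add: \<eta>_def soft_pos_large)
  qed
qed

section \<open>Riesz representation on \<open>C\<^sup>2\<close> functions with compact support\<close>

text \<open>Positivity takes the place of continuity: comparison with a cut-off bounds \<Lambda> on
  functions supported in a fixed compact set.\<close>

locale positive_C2c_functional =
  fixes \<Omega> :: "'a::euclidean_space set" and \<Lambda> :: "('a \<Rightarrow> real) \<Rightarrow> real"
  assumes open_domain: "open \<Omega>"
    and add: "\<phi> \<in> C2c \<Omega> \<Longrightarrow> \<psi> \<in> C2c \<Omega> \<Longrightarrow> \<Lambda> (\<lambda>x. \<phi> x + \<psi> x) = \<Lambda> \<phi> + \<Lambda> \<psi>"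
    and scale: "\<phi> \<in> C2c \<Omega> \<Longrightarrow> \<Lambda> (\<lambda>x. c * \<phi> x) = c * \<Lambda> \<phi>"
    and nonneg: "\<phi> \<in> C2c \<Omega> \<Longrightarrow> (\<And>x. 0 \<le> \<phi> x) \<Longrightarrow> 0 \<le> \<Lambda> \<phi>"
begin

lemma zero: "\<Lambda> (\<lambda>x. 0) = 0"
  using scale[OF C2c_zero, of 0] by simp

lemma diff: "\<phi> \<in> C2c \<Omega> \<Longrightarrow> \<psi> \<in> C2c \<Omega> \<Longrightarrow> \<Lambda> (\<lambda>x. \<phi> x - \<psi> x) = \<Lambda> \<phi> - \<Lambda> \<psi>"
  using add[OF _ C2c_scale, of \<phi> \<psi> "-1"] scale[of \<psi> "-1"] by simp

lemma mono: "\<phi> \<in> C2c \<Omega> \<Longrightarrow> \<psi> \<in> C2c \<Omega> \<Longrightarrow> (\<And>x. \<phi> x \<le> \<psi> x) \<Longrightarrow> \<Lambda> \<phi> \<le> \<Lambda> \<psi>"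
  using nonneg[OF C2c_diff, of \<psi> \<phi>] diff[of \<psi> \<phi>] by simp

lemma sum: "(\<And>i. i \<in> I \<Longrightarrow> f i \<in> C2c \<Omega>) \<Longrightarrow> \<Lambda> (\<lambda>x. \<Sum>i\<in>I. f i x) = (\<Sum>i\<in>I. \<Lambda> (f i))"
  by (induction I rule: infinite_finite_induct) (auto simp: zero add C2c_sum)

section \<open>The outer measure of a positive functional\<close>

definition adm :: "'a set \<Rightarrow> ('a \<Rightarrow> real) set" where
  "adm U = {\<phi> \<in> C2c (U \<inter> \<Omega>). \<forall>x. 0 \<le> \<phi> x \<and> \<phi> x \<le> 1}"

definition open_mass :: "'a set \<Rightarrow> ennreal" where
  "open_mass U = (SUP \<phi>\<in>adm U. ennreal (\<Lambda> \<phi>))"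

text \<open>Only A \<inter> \<Omega> has to be covered. The outcome is a measure on the whole space
  that gives no mass to the complement of \<Omega>.\<close>

definition outer_mass :: "'a set \<Rightarrow> ennreal" where
  "outer_mass A = (INF U\<in>{U. open U \<and> A \<inter> \<Omega> \<subseteq> U}. open_mass U)"

lemma adm_C2c: "\<phi> \<in> adm U \<Longrightarrow> \<phi> \<in> C2c \<Omega>"
  unfolding adm_def using C2c_mono by blast

lemma adm_mono: "U \<inter> \<Omega> \<subseteq> V \<Longrightarrow> adm U \<subseteq> adm V"
  unfolding adm_def using C2c_mono[of "U \<inter> \<Omega>" "V \<inter> \<Omega>"] by blast

lemma open_mass_upper: "\<phi> \<in> adm U \<Longrightarrow> ennreal (\<Lambda> \<phi>) \<le> open_mass U"
  unfolding open_mass_def by (rule SUP_upper)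

lemma open_mass_mono: "U \<inter> \<Omega> \<subseteq> V \<Longrightarrow> open_mass U \<le> open_mass V"
  unfolding open_mass_def using adm_mono by (intro SUP_subset_mono) auto

lemma adm_empty: "adm {} = {\<lambda>x. 0}"
  by (auto simp: adm_def C2c_def intro!: Ck_on_const)

lemma open_mass_empty: "open_mass {} = 0"
  by (simp add: open_mass_def adm_empty zero)

text \<open>A partition of unity for two sets: the part of the support of \<phi> outside V is
  compact in U, and a cut-off \<eta> equal to 1 near it splits \<phi> into \<phi> \<eta>, supported
  in U, and \<phi> (1 - \<eta>), supported in V.\<close>

lemma open_mass_Un:
  assumes U: "open U" and V: "open V"
  shows "open_mass (U \<union> V) \<le> open_mass U + open_mass V"
  unfolding open_mass_def[of "U \<union> V"]
proof (rule SUP_least)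
  fix \<phi> assume \<phi>: "\<phi> \<in> adm (U \<union> V)"
  then obtain K where K: "compact K" "K \<subseteq> (U \<union> V) \<inter> \<Omega>" "\<forall>x. x \<notin> K \<longrightarrow> \<phi> x = 0"
    and \<phi>2: "Ck_on 2 UNIV \<phi>" and \<phi>b: "\<And>x. 0 \<le> \<phi> x" "\<And>x. \<phi> x \<le> 1"
    unfolding adm_def C2c_def by blast
  have "compact (K - V)" using K(1) V by (simp add: compact_diff)
  moreover have "K - V \<subseteq> U \<inter> \<Omega>" "open (U \<inter> \<Omega>)" using K U open_domain by auto
  ultimately obtain \<eta> W where \<eta>: "\<eta> \<in> C2c (U \<inter> \<Omega>)" "\<And>x. 0 \<le> \<eta> x" "\<And>x. \<eta> x \<le> 1"
    and W: "open W" "K - V \<subseteq> W" "\<And>x. x \<in> W \<Longrightarrow> \<eta> x = 1"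
    using C2c_bump by blast
  have \<eta>2: "Ck_on 2 UNIV \<eta>" using \<eta>(1) by (simp add: C2c_def)
  have b: "0 \<le> \<phi> x * \<eta> x" "\<phi> x * \<eta> x \<le> 1" "0 \<le> \<phi> x * (1 - \<eta> x)" "\<phi> x * (1 - \<eta> x) \<le> 1" for x
    using \<phi>b[of x] \<eta>(2,3)[of x] by (auto intro: mult_le_one)
  have 1: "(\<lambda>x. \<phi> x * \<eta> x) \<in> adm U"
    unfolding adm_def using C2c_mult[OF \<eta>(1) \<phi>2] b by auto
  have "compact (K - W)" "K - W \<subseteq> V \<inter> \<Omega>" using K W by (auto simp: compact_diff)
  then have "(\<lambda>x. \<phi> x * (1 - \<eta> x)) \<in> C2c (V \<inter> \<Omega>)"
    unfolding C2c_def using K(3) W(3) \<phi>2 \<eta>2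
    by (auto intro!: Ck_on_mult Ck_on_diff Ck_on_const exI[of _ "K - W"])
  then have 2: "(\<lambda>x. \<phi> x * (1 - \<eta> x)) \<in> adm V"
    unfolding adm_def using b by auto
  have "\<Lambda> \<phi> = \<Lambda> (\<lambda>x. \<phi> x * \<eta> x) + \<Lambda> (\<lambda>x. \<phi> x * (1 - \<eta> x))"
    using add[OF adm_C2c[OF 1] adm_C2c[OF 2]] by (simp add: algebra_simps)
  moreover have "0 \<le> \<Lambda> (\<lambda>x. \<phi> x * \<eta> x)" "0 \<le> \<Lambda> (\<lambda>x. \<phi> x * (1 - \<eta> x))"
    using b by (auto intro!: nonneg adm_C2c[OF 1] adm_C2c[OF 2])
  ultimately have "ennreal (\<Lambda> \<phi>) = ennreal (\<Lambda> (\<lambda>x. \<phi> x * \<eta> x)) + ennreal (\<Lambda> (\<lambda>x. \<phi> x * (1 - \<eta> x)))"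
    by (simp add: ennreal_plus)
  also have "\<dots> \<le> open_mass U + open_mass V"
    by (intro add_mono open_mass_upper 1 2)
  finally show "ennreal (\<Lambda> \<phi>) \<le> open_mass U + open_mass V" .
qed

lemma open_mass_finite_UN:
  "(\<And>i. open (U i)) \<Longrightarrow> open_mass (\<Union>i<n. U i) \<le> (\<Sum>i<n. open_mass (U i))" for n :: nat
proof (induction n)
  case (Suc n)
  have "open_mass (\<Union>i<Suc n. U i) = open_mass ((\<Union>i<n. U i) \<union> U n)"
    by (simp add: lessThan_Suc Un_commute)
  also have "\<dots> \<le> open_mass (\<Union>i<n. U i) + open_mass (U n)"
    using Suc.prems by (intro open_mass_Un) auto
  also have "\<dots> \<le> (\<Sum>i<Suc n. open_mass (U i))"
    using Suc by (simp add: add_right_mono)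
  finally show ?case .
qed (simp add: open_mass_empty)

text \<open>The compact support of an admissible function is covered by finitely many of the sets,
  which reduces the claim to finite unions.\<close>

lemma open_mass_UN:
  fixes U :: "nat \<Rightarrow> 'a set"
  assumes U: "\<And>i. open (U i)"
  shows "open_mass (\<Union>i. U i) \<le> (\<Sum>i. open_mass (U i))"
  unfolding open_mass_def[of "\<Union>i. U i"]
proof (rule SUP_least)
  fix \<phi> assume \<phi>: "\<phi> \<in> adm (\<Union>i. U i)"
  then obtain K where K: "compact K" "K \<subseteq> (\<Union>i. U i)" "K \<subseteq> \<Omega>" "\<forall>x. x \<notin> K \<longrightarrow> \<phi> x = 0"
    unfolding adm_def C2c_def by blast
  obtain F where F: "finite F" "K \<subseteq> (\<Union>i\<in>F. U i)"
    by (rule compactE_image[OF K(1), of UNIV U]) (use U K(2) in auto)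
  obtain n where "F \<subseteq> {..<n}" using F(1) finite_nat_iff_bounded by blast
  then have "K \<subseteq> (\<Union>i<n. U i)" using F by blast
  then have "K \<subseteq> (\<Union>i<n. U i) \<inter> \<Omega>" using K(3) by simp
  moreover have "Ck_on 2 UNIV \<phi>" "\<forall>x. 0 \<le> \<phi> x \<and> \<phi> x \<le> 1" using \<phi> by (simp_all add: adm_def C2c_def)
  ultimately have "\<phi> \<in> adm (\<Union>i<n. U i)"
    unfolding adm_def C2c_def mem_Collect_eq using K(1,4) by (intro conjI exI[of _ K])
  then have "ennreal (\<Lambda> \<phi>) \<le> (\<Sum>i<n. open_mass (U i))"
    by (rule order_trans[OF open_mass_upper open_mass_finite_UN[OF U]])
  also have "\<dots> \<le> (\<Sum>i. open_mass (U i))" by (intro sum_le_suminf) auto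
  finally show "ennreal (\<Lambda> \<phi>) \<le> (\<Sum>i. open_mass (U i))" .
qed

lemma outer_mass_le: "open U \<Longrightarrow> A \<inter> \<Omega> \<subseteq> U \<Longrightarrow> outer_mass A \<le> open_mass U"
  unfolding outer_mass_def by (rule INF_lower) auto

lemma outer_mass_open: "open U \<Longrightarrow> outer_mass U = open_mass U"
  by (rule antisym[OF outer_mass_le])
    (auto simp: outer_mass_def intro!: INF_greatest open_mass_mono)

lemma outer_mass_mono: "A \<subseteq> B \<Longrightarrow> outer_mass A \<le> outer_mass B"
  unfolding outer_mass_def by (intro INF_superset_mono) auto

lemma outer_mass_empty: "outer_mass {} = 0"
  using outer_mass_open[of "{}"] open_mass_empty by simp

lemma outer_mass_subadditive: "countably_subadditive (Pow UNIV) outer_mass"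
proof (simp add: countably_subadditive_def, safe)
  fix A :: "nat \<Rightarrow> 'a set"
  show "outer_mass (\<Union>i. A i) \<le> (\<Sum>n. outer_mass (A n))"
  proof (rule ennreal_le_epsilon)
    fix e :: real assume e: "0 < e" and fin: "(\<Sum>n. outer_mass (A n)) < top"
    then have *: "outer_mass (A n) < outer_mass (A n) + e * (1/2)^Suc n" for n
      by (auto simp add: less_top dest!: ennreal_suminf_lessD)
    have "\<exists>U. open U \<and> A n \<inter> \<Omega> \<subseteq> U \<and> open_mass U \<le> outer_mass (A n) + e * (1/2)^Suc n" for n
      using *[of n] unfolding outer_mass_def INF_less_iff by (auto intro: less_imp_le)
    then obtain U where U: "\<And>n. open (U n)" "\<And>n. A n \<inter> \<Omega> \<subseteq> U n"
      "\<And>n. open_mass (U n) \<le> outer_mass (A n) + e * (1/2)^Suc n"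
      by metis
    have "outer_mass (\<Union>i. A i) \<le> open_mass (\<Union>i. U i)"
      using U by (intro outer_mass_le) auto
    also have "\<dots> \<le> (\<Sum>n. open_mass (U n))" by (rule open_mass_UN[OF U(1)])
    also have "\<dots> \<le> (\<Sum>n. outer_mass (A n) + e * (1/2) ^ Suc n)"
      by (intro suminf_le allI U(3)) auto
    also have "\<dots> = (\<Sum>n. outer_mass (A n)) + (\<Sum>n. ennreal e * ennreal ((1/2) ^ Suc n))"
      using e by (subst suminf_add[symmetric])
        (auto simp del: ennreal_suminf_cmult simp add: ennreal_mult[symmetric])
    also have "\<dots> = (\<Sum>n. outer_mass (A n)) + e"
      unfolding ennreal_suminf_cmult
      by (subst suminf_ennreal_eq[OF zero_le_power power_half_series]) auto
    finally show "outer_mass (\<Union>i. A i) \<le> (\<Sum>n. outer_mass (A n)) + e" .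
  qed
qed

lemma outer_measure_space_outer_mass: "outer_measure_space (Pow UNIV) outer_mass"
  unfolding outer_measure_space_def positive_def increasing_def
  using outer_mass_subadditive outer_mass_mono outer_mass_empty by auto

lemma outer_mass_Un: "outer_mass (A \<union> B) \<le> outer_mass A + outer_mass B"
proof -
  have "subadditive (Pow UNIV) outer_mass"
    by (rule ring_of_sets.countably_subadditive_subadditive[OF
          algebra.axioms(1)[OF sigma_algebra.axioms(1)[OF sigma_algebra_Pow[of UNIV]]]])
      (use outer_mass_subadditive outer_mass_empty in \<open>auto simp: positive_def\<close>)
  then have "outer_mass (A \<union> (B - A)) \<le> outer_mass A + outer_mass (B - A)"
    by (rule subadditiveD) auto
  also have "outer_mass (B - A) \<le> outer_mass B" by (rule outer_mass_mono) auto
  finally show ?thesis by (simp add: add_left_mono)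
qed

text \<open>If \<phi> is admissible for U \<inter> V and supported in K, and \<psi> is admissible
  for U - K, then the supports are disjoint, so \<phi> + \<psi> stays below 1 and is admissible for
  U. As U - V lies in U - K, suprema over \<psi> and then over \<phi> give the inequality.\<close>

lemma open_mass_split:
  assumes U: "open U" and V: "open V"
  shows "outer_mass (U \<inter> V) + outer_mass (U - V) \<le> open_mass U"
proof -
  have "(\<lambda>x. 0) \<in> adm W" for W by (simp add: adm_def C2c_zero)
  then have ne: "adm W \<noteq> {}" for W by blast
  have main: "ennreal (\<Lambda> \<phi>) + outer_mass (U - V) \<le> open_mass U" if \<phi>: "\<phi> \<in> adm (U \<inter> V)" for \<phi>
  proof -
    obtain K where K: "compact K" "K \<subseteq> U \<inter> V \<inter> \<Omega>" "\<forall>x. x \<notin> K \<longrightarrow> \<phi> x = 0"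
      using \<phi> unfolding adm_def C2c_def by blast
    have o: "open (U - K)" using U K(1) by (simp add: open_Diff compact_imp_closed)
    have "ennreal (\<Lambda> \<phi>) + ennreal (\<Lambda> \<psi>) \<le> open_mass U" if \<psi>: "\<psi> \<in> adm (U - K)" for \<psi>
    proof -
      obtain K' where K': "compact K'" "K' \<subseteq> (U - K) \<inter> \<Omega>" "\<forall>x. x \<notin> K' \<longrightarrow> \<psi> x = 0"
        using \<psi> unfolding adm_def C2c_def by blast
      have "\<phi> \<in> C2c (U \<inter> \<Omega>)" "\<psi> \<in> C2c (U \<inter> \<Omega>)"
        using \<phi> \<psi> C2c_mono[of "U \<inter> V \<inter> \<Omega>" "U \<inter> \<Omega>"] C2c_mono[of "(U - K) \<inter> \<Omega>" "U \<inter> \<Omega>"]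
        unfolding adm_def by blast+
      moreover have "0 \<le> \<phi> x + \<psi> x \<and> \<phi> x + \<psi> x \<le> 1" for x
      proof (cases "x \<in> K")
        case True
        then have "\<psi> x = 0" using K' by blast
        then show ?thesis using \<phi> by (simp add: adm_def)
      next
        case False
        then have "\<phi> x = 0" using K by blast
        then show ?thesis using \<psi> by (simp add: adm_def)
      qed
      ultimately have "(\<lambda>x. \<phi> x + \<psi> x) \<in> adm U"
        unfolding adm_def by (auto intro: C2c_add)
      then have "ennreal (\<Lambda> (\<lambda>x. \<phi> x + \<psi> x)) \<le> open_mass U" by (rule open_mass_upper)
      moreover have "0 \<le> \<Lambda> \<phi>" "0 \<le> \<Lambda> \<psi>"
        using \<phi> \<psi> nonneg adm_C2c unfolding adm_def by auto
      ultimately show ?thesis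
        using add[OF adm_C2c[OF \<phi>] adm_C2c[OF \<psi>]] by (simp add: ennreal_plus)
    qed
    then have "(SUP \<psi>\<in>adm (U - K). ennreal (\<Lambda> \<phi>) + ennreal (\<Lambda> \<psi>)) \<le> open_mass U"
      by (rule SUP_least)
    then have "ennreal (\<Lambda> \<phi>) + open_mass (U - K) \<le> open_mass U"
      unfolding open_mass_def[of "U - K"] using ennreal_SUP_add_right[OF ne] by simp
    moreover have "outer_mass (U - V) \<le> open_mass (U - K)"
      using K o by (intro outer_mass_le) auto
    ultimately show ?thesis by (meson add_left_mono order_trans)
  qed
  have "outer_mass (U \<inter> V) = open_mass (U \<inter> V)" using U V by (simp add: outer_mass_open open_Int)
  then have "outer_mass (U \<inter> V) + outer_mass (U - V) = (SUP \<phi>\<in>adm (U \<inter> V). ennreal (\<Lambda> \<phi>) + outer_mass (U - V))"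
    unfolding open_mass_def using ennreal_SUP_add_left[OF ne] by simp
  also have "\<dots> \<le> open_mass U" by (rule SUP_least) (rule main)
  finally show ?thesis .
qed

text \<open>Caratheodory measurability of open sets. An arbitrary test set X is reduced to the open
  sets containing X \<inter> \<Omega> by the infimum in \<open>outer_mass\<close>.\<close>

lemma open_in_lambda_system:
  assumes V: "open V"
  shows "V \<in> lambda_system UNIV (Pow UNIV) outer_mass"
proof -
  have "outer_mass (V \<inter> X) + outer_mass ((UNIV - V) \<inter> X) = outer_mass X" for X
  proof (rule antisym)
    show "outer_mass (V \<inter> X) + outer_mass ((UNIV - V) \<inter> X) \<le> outer_mass X"
      unfolding outer_mass_def[of X]
    proof (rule INF_greatest)
      fix U assume U: "U \<in> {U. open U \<and> X \<inter> \<Omega> \<subseteq> U}"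
      have *: "outer_mass A \<le> outer_mass B" if "A \<inter> \<Omega> \<subseteq> B" for A B
        using that unfolding outer_mass_def by (intro INF_superset_mono) auto
      have "outer_mass (V \<inter> X) + outer_mass ((UNIV - V) \<inter> X)
          \<le> outer_mass (U \<inter> V) + outer_mass (U - V)"
        using U by (intro add_mono *) auto
      also have "\<dots> \<le> open_mass U" using U V by (intro open_mass_split) auto
      finally show "outer_mass (V \<inter> X) + outer_mass ((UNIV - V) \<inter> X) \<le> open_mass U" .
    qed
    have "X = (V \<inter> X) \<union> ((UNIV - V) \<inter> X)" by auto
    then show "outer_mass X \<le> outer_mass (V \<inter> X) + outer_mass ((UNIV - V) \<inter> X)"
      using outer_mass_Un by metis
  qed
  then show ?thesis by (simp add: lambda_system_def)
qed

definition riesz_measure :: "'a measure" where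
  "riesz_measure = measure_of UNIV (sets borel) outer_mass"

lemma sets_riesz_measure [measurable_cong, simp]: "sets riesz_measure = sets borel"
  by (simp add: riesz_measure_def) (metis sets.sigma_sets_eq space_borel)

text \<open>The Caratheodory measurable sets form a \<sigma>-algebra containing the open sets, hence
  all Borel sets, and the outer measure is countably additive on it.\<close>

lemma emeasure_riesz_measure:
  assumes "A \<in> sets borel"
  shows "emeasure riesz_measure A = outer_mass A"
proof -
  let ?L = "lambda_system UNIV (Pow UNIV) outer_mass"
  have ms: "measure_space UNIV ?L outer_mass"
    by (rule sigma_algebra.caratheodory_lemma[OF sigma_algebra_Pow outer_measure_space_outer_mass])
  then have "sigma_algebra UNIV ?L" by (simp add: measure_space_def)
  then have "sigma_sets UNIV {S. open S} \<subseteq> ?L"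
    by (rule sigma_algebra.sigma_sets_subset) (use open_in_lambda_system in blast)
  then have "sets borel \<subseteq> ?L" by (simp add: borel_def)
  moreover have sa: "sigma_algebra UNIV (sets (borel :: 'a measure))"
    using sets.sigma_algebra_axioms[of "borel :: 'a measure"] by simp
  ultimately have "measure_space UNIV (sets borel) outer_mass"
    using measure_down[OF ms] by blast
  then show ?thesis
    unfolding riesz_measure_def using assms sa
    by (intro emeasure_measure_of_sigma) (auto simp: measure_space_def)
qed

lemma riesz_measure_outside: "emeasure riesz_measure (- \<Omega>) = 0"
proof -
  have "outer_mass (- \<Omega>) \<le> open_mass {}" by (rule outer_mass_le) auto
  then show ?thesis using open_domain by (simp add: emeasure_riesz_measure open_mass_empty)
qed

section \<open>Agreement of the functional with the integral\<close>

lemma functional_le_mass: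
  assumes \<phi>: "\<phi> \<in> C2c \<Omega>" "\<And>x. 0 \<le> \<phi> x" "\<And>x. \<phi> x \<le> 1"
    and K: "compact K" "K \<subseteq> \<Omega>" "\<And>x. x \<notin> K \<Longrightarrow> \<phi> x = 0"
  shows "ennreal (\<Lambda> \<phi>) \<le> emeasure riesz_measure K"
proof -
  have "\<phi> \<in> adm U" if "K \<inter> \<Omega> \<subseteq> U" for U
  proof -
    have "Ck_on 2 UNIV \<phi>" "K \<subseteq> U \<inter> \<Omega>" using that \<phi> K(2) by (auto simp: C2c_def)
    then show ?thesis
      unfolding adm_def C2c_def mem_Collect_eq using \<phi>(2,3) K(1,3) by (intro conjI allI exI[of _ K]) auto
  qed
  then have "ennreal (\<Lambda> \<phi>) \<le> outer_mass K"
    unfolding outer_mass_def by (auto intro!: INF_greatest open_mass_upper)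
  then show ?thesis using K(1) by (simp add: emeasure_riesz_measure borel_compact)
qed

text \<open>For a < 1 the open set where \<phi> > a contains K, and each function admissible for it
  is at most \<phi> / a. So the mass of K is at most \<Lambda> \<phi> / a; let a tend to 1.\<close>

lemma mass_le_functional:
  assumes \<phi>: "\<phi> \<in> C2c \<Omega>" "\<And>x. 0 \<le> \<phi> x"
    and K: "compact K" "\<And>x. x \<in> K \<Longrightarrow> 1 \<le> \<phi> x"
  shows "emeasure riesz_measure K \<le> ennreal (\<Lambda> \<phi>)"
proof -
  have main: "outer_mass K \<le> ennreal (\<Lambda> \<phi> / a)" if a: "0 < a" "a < 1" for a
  proof -
    have U: "open {x. a < \<phi> x}"
      using open_Collect_less[OF continuous_on_const C2c_continuous[OF \<phi>(1)]] by blast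
    have "outer_mass K \<le> open_mass {x. a < \<phi> x}"
      using U K(2) a by (intro outer_mass_le) (fastforce intro: less_le_trans)+
    also have "\<dots> \<le> ennreal (\<Lambda> \<phi> / a)"
      unfolding open_mass_def
    proof (rule SUP_least)
      fix \<psi> assume \<psi>: "\<psi> \<in> adm {x. a < \<phi> x}"
      have "\<psi> x \<le> 1 / a * \<phi> x" for x
      proof (cases "a < \<phi> x")
        case True
        have "\<psi> x \<le> 1" using \<psi> by (simp add: adm_def)
        also have "1 \<le> 1 / a * \<phi> x" using True a by (simp add: field_simps)
        finally show ?thesis .
      next
        case False
        then have "\<psi> x = 0" using \<psi> by (auto simp: adm_def C2c_def)
        then show ?thesis using \<phi>(2)[of x] a by simp
      qed
      then have "\<Lambda> \<psi> \<le> \<Lambda> (\<lambda>x. 1 / a * \<phi> x)"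
        using \<psi> \<phi> by (intro mono adm_C2c[OF \<psi>] C2c_scale) auto
      also have "\<dots> = \<Lambda> \<phi> / a" using scale[OF \<phi>(1), of "1 / a"] by simp
      finally show "ennreal (\<Lambda> \<psi>) \<le> ennreal (\<Lambda> \<phi> / a)" by (rule ennreal_leI)
    qed
    finally show ?thesis .
  qed
  \<comment> \<open>The shift by two keeps 1 - 1 / (n + 2) strictly between 0 and 1 already for n =
    0.\<close>
  have "outer_mass K \<le> ennreal (\<Lambda> \<phi> / (1 - 1 / real (Suc (Suc n))))" for n
    by (rule main) simp_all
  moreover have "(\<lambda>n. ennreal (\<Lambda> \<phi> / (1 - 1 / real (Suc (Suc n))))) \<longlonglongrightarrow> ennreal (\<Lambda> \<phi> / (1 - 0))"
    by (intro tendsto_ennrealI tendsto_intros LIMSEQ_Suc[OF LIMSEQ_Suc[OF lim_1_over_n]]) simp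
  ultimately have "outer_mass K \<le> ennreal (\<Lambda> \<phi>)"
    using LIMSEQ_le_const[of "\<lambda>n. ennreal (\<Lambda> \<phi> / (1 - 1 / real (Suc (Suc n))))"] by simp
  then show ?thesis using K(1) by (simp add: emeasure_riesz_measure borel_compact)
qed

lemma riesz_measure_compact_finite:
  assumes "compact K" "K \<subseteq> \<Omega>" shows "emeasure riesz_measure K < \<infinity>"
proof -
  obtain \<eta> W where \<eta>: "\<eta> \<in> C2c \<Omega>" "\<And>x. 0 \<le> \<eta> x" "\<And>x. \<eta> x \<le> 1" "K \<subseteq> W" "\<And>x. x \<in> W \<Longrightarrow> \<eta> x = 1"
    using C2c_bump[OF assms(1) open_domain assms(2)] by metis
  have "emeasure riesz_measure K \<le> ennreal (\<Lambda> \<eta>)"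
    using \<eta> assms by (intro mass_le_functional) auto
  then show ?thesis by (simp add: order_le_less_trans)
qed

lemma C2c_integrable:
  assumes "\<phi> \<in> C2c \<Omega>" shows "integrable riesz_measure \<phi>"
proof -
  obtain K where K: "compact K" "K \<subseteq> \<Omega>" "\<forall>x. x \<notin> K \<longrightarrow> \<phi> x = 0"
    using assms by (auto simp: C2c_def)
  obtain B where B: "B > 0" "\<And>x. \<bar>\<phi> x\<bar> \<le> B" using C2c_bounded[OF assms] by blast
  have "integrable riesz_measure (\<lambda>x. indicator K x *\<^sub>R \<phi> x)"
  proof (rule integrableI_bounded_set_indicator[where B = B])
    show "\<phi> \<in> borel_measurable riesz_measure"
      using borel_measurable_continuous_onI[OF C2c_continuous[OF assms]]
        measurable_cong_sets[OF sets_riesz_measure refl] by blast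
    show "K \<in> sets riesz_measure" using K(1) by (simp add: borel_compact)
    show "emeasure riesz_measure K < \<infinity>" using K riesz_measure_compact_finite by blast
  qed (use B in simp)
  moreover have "(\<lambda>x. indicator K x *\<^sub>R \<phi> x) = \<phi>" using K(3) by (auto simp: fun_eq_iff split: split_indicator)
  ultimately show ?thesis by simp
qed

text \<open>The functional and the integral of h both lie between the masses of K' and K.\<close>

lemma slice_bounds:
  assumes h: "h \<in> C2c \<Omega>" "\<And>x. 0 \<le> h x" "\<And>x. h x \<le> 1"
    and K: "compact K" "K \<subseteq> \<Omega>" "\<And>x. x \<notin> K \<Longrightarrow> h x = 0"
    and K': "compact K'" "K' \<subseteq> K" "\<And>x. x \<in> K' \<Longrightarrow> h x = 1"
  shows "\<bar>\<Lambda> h - (LINT x|riesz_measure. h x)\<bar> \<le> measure riesz_measure K - measure riesz_measure K'"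
proof -
  let ?M = riesz_measure
  have fin: "emeasure ?M K < \<infinity>" "emeasure ?M K' < \<infinity>"
    using riesz_measure_compact_finite K K' by auto
  have sets: "K \<in> sets ?M" "K' \<in> sets ?M" using K K' by (auto simp: borel_compact)
  have \<Lambda>0: "0 \<le> \<Lambda> h" using nonneg h by auto
  have "ennreal (\<Lambda> h) \<le> emeasure ?M K" by (rule functional_le_mass[OF h K])
  then have 1: "\<Lambda> h \<le> measure ?M K"
    using fin \<Lambda>0 by (simp add: emeasure_eq_ennreal_measure)
  have "emeasure ?M K' \<le> ennreal (\<Lambda> h)"
    using h K' by (intro mass_le_functional) auto
  then have 2: "measure ?M K' \<le> \<Lambda> h"
    using fin \<Lambda>0 by (simp add: emeasure_eq_ennreal_measure)
  have ind: "integrable ?M (indicator K :: 'a \<Rightarrow> real)" "integrable ?M (indicator K' :: 'a \<Rightarrow> real)"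
    using fin sets by (auto intro!: integrable_real_indicator)
  have "(LINT x|?M. h x) \<le> (LINT x|?M. indicator K x)"
    using h K C2c_integrable ind by (intro integral_mono) (auto split: split_indicator)
  then have 3: "(LINT x|?M. h x) \<le> measure ?M K" using sets by simp
  have "(LINT x|?M. indicator K' x) \<le> (LINT x|?M. h x)"
    using h K' C2c_integrable ind by (intro integral_mono) (auto split: split_indicator)
  then have 4: "measure ?M K' \<le> (LINT x|?M. h x)" using sets by simp
  show ?thesis using 1 2 3 4 by linarith
qed

text \<open>The threshold 3 arises because u - 1 must reach 2, where \<open>soft_pos\<close> becomes
  affine.\<close>

lemma soft_step_slice:
  fixes u :: real
  defines "s \<equiv> soft_pos u - soft_pos (u - 1)"
  shows "0 \<le> s" "s \<le> 1" "u \<le> 0 \<Longrightarrow> s = 0" "u \<ge> 3 \<Longrightarrow> s = 1"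
  using soft_pos_mono[of "u - 1" u] soft_pos_slope[of "u - 1" u]
  by (auto simp: s_def soft_pos_0 soft_pos_large)

text \<open>A slice of height one reaches the value 1 only three levels further up, so level-set
  masses are compared with lag three. Such a sum consists of three ordinary telescoping
  sums.\<close>

lemma sum_telescope3:
  fixes a :: "nat \<Rightarrow> real"
  assumes "\<And>j. 0 \<le> a j" "\<And>j. a j \<le> B"
  shows "(\<Sum>j<n. a j - a (j + 3)) \<le> 3 * B"
proof -
  have "(\<Sum>j<n. a j - a (j + 3)) =
      (\<Sum>j<n. a j - a (Suc j)) + (\<Sum>j<n. a (Suc j) - a (Suc (Suc j))) + (\<Sum>j<n. a (Suc (Suc j)) - a (Suc (Suc (Suc j))))"
    by (simp add: sum.distrib[symmetric] numeral_3_eq_3)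
  also have "\<dots> = (a 0 - a n) + (a (Suc 0) - a (Suc n)) + (a (Suc (Suc 0)) - a (Suc (Suc n)))"
    using sum_lessThan_telescope'[of a n] sum_lessThan_telescope'[of "\<lambda>j. a (Suc j)" n]
      sum_lessThan_telescope'[of "\<lambda>j. a (Suc (Suc j))" n] by simp
  also have "\<dots> \<le> 3 * B"
    using assms(1)[of n] assms(1)[of "Suc n"] assms(1)[of "Suc (Suc n)"]
      assms(2)[of 0] assms(2)[of "Suc 0"] assms(2)[of "Suc (Suc 0)"] by linarith
  finally show ?thesis .
qed

text \<open>
  Cut \<open>N * \<phi>\<close> into slices of height one.  On a slice both the functional and the integral lie
  between the masses of two level sets, and these masses telescope.
\<close>

lemma functional_integral_close:
  assumes \<phi>: "\<phi> \<in> C2c \<Omega>" "\<And>x. 0 \<le> \<phi> x"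
    and K: "compact K" "K \<subseteq> \<Omega>" "\<And>x. x \<notin> K \<Longrightarrow> \<phi> x = 0"
    and \<eta>: "\<eta> \<in> C2c \<Omega>" "\<And>x. 0 \<le> \<eta> x" "\<And>x. x \<in> K \<Longrightarrow> \<eta> x = 1"
  shows "real N * \<bar>\<Lambda> \<phi> - (LINT x|riesz_measure. \<phi> x)\<bar>
    \<le> \<Lambda> \<eta> + (LINT x|riesz_measure. \<eta> x) + 3 * measure riesz_measure K"
proof -
  let ?M = riesz_measure
  obtain B where B: "B > 0" "\<And>x. \<bar>\<phi> x\<bar> \<le> B" using C2c_bounded[OF \<phi>(1)] by blast
  \<comment> \<open>No value of N * \<phi> exceeds J, so \<open>soft_pos (N * \<phi> - J)\<close>
    vanishes and the first J slices add up to \<tau>.\<close>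
  obtain J :: nat where J: "real N * B \<le> real J" using real_arch_simple by blast
  define L where "L j = {x. real j \<le> real N * \<phi> x} \<inter> K" for j :: nat
  define s where "s j x = soft_pos (real N * \<phi> x - real j) - soft_pos (real N * \<phi> x - real j - 1)" for j :: nat and x
  define \<tau> where "\<tau> x = soft_pos (real N * \<phi> x)" for x
  have \<phi>2: "Ck_on 2 UNIV \<phi>" using \<phi> by (simp add: C2c_def)
  have L: "compact (L j)" for j
    unfolding L_def using K(1)
    by (intro closed_Int_compact closed_Collect_le continuous_intros C2c_continuous[OF \<phi>(1)])
  have supp: "f \<in> C2c \<Omega>" if "Ck_on 2 UNIV f" "\<And>x. x \<notin> K \<Longrightarrow> f x = 0" for f
    using that K unfolding C2c_def by auto
  have sC: "s j \<in> C2c \<Omega>" for j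
    unfolding s_def using K(3)
    by (intro supp Ck_on_diff C2_soft_pos Ck_on_scale Ck_on_const open_UNIV \<phi>2) (auto simp: soft_pos_0)
  have \<tau>C: "\<tau> \<in> C2c \<Omega>"
    unfolding \<tau>_def using K(3) by (intro supp C2_soft_pos Ck_on_scale open_UNIV \<phi>2) (auto simp: soft_pos_0)
  have slice: "\<bar>\<Lambda> (s j) - (LINT x|?M. s j x)\<bar> \<le> measure ?M (L j) - measure ?M (L (j + 3))" for j
  proof (rule slice_bounds[OF sC])
    fix x
    show "0 \<le> s j x" "s j x \<le> 1"
      unfolding s_def by (rule soft_step_slice)+
    show "s j x = 0" if "x \<notin> L j"
    proof (cases "x \<in> K")
      case True
      then have "real N * \<phi> x \<le> real j" using that by (auto simp: L_def)
      then show ?thesis unfolding s_def by (intro soft_step_slice) simp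
    qed (use K(3) in \<open>simp add: s_def soft_pos_0\<close>)
    show "s j x = 1" if "x \<in> L (j + 3)"
      unfolding s_def using that by (intro soft_step_slice) (simp add: L_def)
    show "compact (L j)" "compact (L (j + 3))" by (rule L)+
  qed (use K in \<open>auto simp: L_def\<close>)
  have \<tau>sum: "(\<Sum>j<J. s j x) = \<tau> x" for x
  proof -
    have "(\<Sum>j<J. s j x) = (\<Sum>j<J. soft_pos (real N * \<phi> x - real j) - soft_pos (real N * \<phi> x - real (Suc j)))"
      by (simp add: s_def algebra_simps)
    also have "\<dots> = soft_pos (real N * \<phi> x) - soft_pos (real N * \<phi> x - real J)"
      by (subst sum_lessThan_telescope') simp
    also have "real N * \<phi> x \<le> real N * B" using B(2)[of x] by (intro mult_left_mono) auto
    then have "soft_pos (real N * \<phi> x - real J) = 0" using J by (intro soft_pos_0) linarith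
    finally show ?thesis by (simp add: \<tau>_def)
  qed
  have "\<Lambda> \<tau> - (LINT x|?M. \<tau> x) = (\<Sum>j<J. \<Lambda> (s j) - (LINT x|?M. s j x))"
  proof -
    have "\<Lambda> \<tau> = (\<Sum>j<J. \<Lambda> (s j))"
      using sum[of "{..<J}" s] sC by (simp add: \<tau>sum)
    moreover have "(LINT x|?M. \<tau> x) = (\<Sum>j<J. (LINT x|?M. s j x))"
      unfolding \<tau>sum[symmetric] using C2c_integrable[OF sC] by (subst Bochner_Integration.integral_sum) auto
    ultimately show ?thesis by (simp add: sum_subtractf)
  qed
  also have "\<bar>\<dots>\<bar> \<le> (\<Sum>j<J. measure ?M (L j) - measure ?M (L (j + 3)))"
    by (intro order_trans[OF sum_abs] sum_mono slice)
  also have "\<dots> \<le> 3 * measure ?M K"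
  proof (rule sum_telescope3)
    show "measure ?M (L j) \<le> measure ?M K" for j
      using riesz_measure_compact_finite[OF K(1,2)] K(1)
      by (intro measure_mono_fmeasurable fmeasurableI) (auto simp: L_def borel_compact fmeasurable_def L[unfolded L_def])
  qed simp
  finally have 1: "\<bar>\<Lambda> \<tau> - (LINT x|?M. \<tau> x)\<bar> \<le> 3 * measure ?M K" .
  \<comment> \<open>On K the truncation error N * \<phi> - \<tau> lies between 0 and 1, and it
    vanishes off K. It is thus bounded by \<eta> and does not grow with N.\<close>
  have b: "real N * \<phi> x - \<tau> x \<le> \<eta> x" "\<tau> x \<le> real N * \<phi> x" for x
  proof -
    have n: "0 \<le> real N * \<phi> x" using \<phi>(2) by simp
    show "\<tau> x \<le> real N * \<phi> x" unfolding \<tau>_def by (rule soft_pos_bounds(2)[OF n])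
    show "real N * \<phi> x - \<tau> x \<le> \<eta> x"
    proof (cases "x \<in> K")
      case True
      then show ?thesis using \<eta>(3) soft_pos_bounds(3)[of "real N * \<phi> x"] by (simp add: \<tau>_def)
    qed (use K(3) \<eta>(2) in \<open>simp add: \<tau>_def soft_pos_0\<close>)
  qed
  have N\<phi>: "(\<lambda>x. real N * \<phi> x) \<in> C2c \<Omega>" by (intro C2c_scale \<phi>)
  have "\<Lambda> (\<lambda>x. real N * \<phi> x - \<tau> x) \<le> \<Lambda> \<eta>" "0 \<le> \<Lambda> (\<lambda>x. real N * \<phi> x - \<tau> x)"
    using b by (auto intro!: mono nonneg C2c_diff N\<phi> \<tau>C \<eta>)
  then have 2: "real N * \<Lambda> \<phi> - \<Lambda> \<tau> \<le> \<Lambda> \<eta>" "0 \<le> real N * \<Lambda> \<phi> - \<Lambda> \<tau>"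
    using diff[OF N\<phi> \<tau>C] scale[OF \<phi>(1)] by auto
  have "(LINT x|?M. real N * \<phi> x - \<tau> x) \<le> (LINT x|?M. \<eta> x)" "0 \<le> (LINT x|?M. real N * \<phi> x - \<tau> x)"
    using b by (auto intro!: integral_mono integral_nonneg C2c_integrable C2c_diff N\<phi> \<tau>C \<eta>)
  then have 3: "real N * (LINT x|?M. \<phi> x) - (LINT x|?M. \<tau> x) \<le> (LINT x|?M. \<eta> x)"
    "0 \<le> real N * (LINT x|?M. \<phi> x) - (LINT x|?M. \<tau> x)"
    using C2c_integrable[OF N\<phi>] C2c_integrable[OF \<tau>C] by auto
  have "real N * \<bar>\<Lambda> \<phi> - (LINT x|?M. \<phi> x)\<bar> = \<bar>real N * \<Lambda> \<phi> - real N * (LINT x|?M. \<phi> x)\<bar>"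
    by (simp add: abs_mult right_diff_distrib[symmetric])
  then show ?thesis using 1 2 3 by linarith
qed

text \<open>The bound of \<open>functional_integral_close\<close> does not depend on N, so every
  multiple of the difference stays below one constant and the difference must be 0.\<close>

lemma functional_eq_integral_nonneg:
  assumes \<phi>: "\<phi> \<in> C2c \<Omega>" "\<And>x. 0 \<le> \<phi> x"
  shows "\<Lambda> \<phi> = (LINT x|riesz_measure. \<phi> x)"
proof -
  obtain K where K: "compact K" "K \<subseteq> \<Omega>" "\<And>x. x \<notin> K \<Longrightarrow> \<phi> x = 0"
    using \<phi> unfolding C2c_def by blast
  obtain \<eta> W where \<eta>: "\<eta> \<in> C2c \<Omega>" "\<And>x. 0 \<le> \<eta> x" "K \<subseteq> W" "\<And>x. x \<in> W \<Longrightarrow> \<eta> x = 1"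
    using C2c_bump[OF K(1) open_domain K(2)] by metis
  let ?d = "\<bar>\<Lambda> \<phi> - (LINT x|riesz_measure. \<phi> x)\<bar>"
  have "real N * ?d \<le> \<Lambda> \<eta> + (LINT x|riesz_measure. \<eta> x) + 3 * measure riesz_measure K" for N
    using \<eta> by (intro functional_integral_close \<phi> K) auto
  then have "\<not> 0 < ?d" using reals_Archimedean3 by (metis linorder_not_less)
  then show ?thesis by simp
qed

text \<open>Adding a multiple of a cut-off makes \<phi> nonnegative, and the added function is
  covered by the nonnegative case as well.\<close>

theorem functional_eq_integral:
  assumes \<phi>: "\<phi> \<in> C2c \<Omega>"
  shows "\<Lambda> \<phi> = (LINT x|riesz_measure. \<phi> x)"
proof -
  obtain K where K: "compact K" "K \<subseteq> \<Omega>" "\<And>x. x \<notin> K \<Longrightarrow> \<phi> x = 0"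
    using \<phi> unfolding C2c_def by blast
  obtain \<eta> W where \<eta>: "\<eta> \<in> C2c \<Omega>" "\<And>x. 0 \<le> \<eta> x" "K \<subseteq> W" "\<And>x. x \<in> W \<Longrightarrow> \<eta> x = 1"
    using C2c_bump[OF K(1) open_domain K(2)] by metis
  obtain B where B: "B > 0" "\<And>x. \<bar>\<phi> x\<bar> \<le> B" using C2c_bounded[OF \<phi>] by blast
  have B\<eta>: "(\<lambda>x. B * \<eta> x) \<in> C2c \<Omega>" by (intro C2c_scale \<eta>)
  have nn: "0 \<le> \<phi> x + B * \<eta> x" for x
  proof (cases "x \<in> K")
    case True
    then have "\<eta> x = 1" using \<eta> by auto
    then show ?thesis using B(2)[of x] by auto
  qed (use K(3) B \<eta> in auto)
  have "\<Lambda> (\<lambda>x. \<phi> x + B * \<eta> x) = (LINT x|riesz_measure. \<phi> x + B * \<eta> x)"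
    using nn by (intro functional_eq_integral_nonneg C2c_add \<phi> B\<eta>)
  moreover have "\<Lambda> (\<lambda>x. B * \<eta> x) = (LINT x|riesz_measure. B * \<eta> x)"
    using B \<eta> by (intro functional_eq_integral_nonneg B\<eta>) auto
  ultimately show ?thesis
    using add[OF \<phi> B\<eta>] Bochner_Integration.integral_add[OF C2c_integrable[OF \<phi>] C2c_integrable[OF B\<eta>]] by simp
qed

end

section \<open>Signed measures with a density\<close>

lemma rc_borel_subset: "A \<in> rc_borel \<Omega> \<Longrightarrow> B \<in> sets borel \<Longrightarrow> B \<subseteq> A \<Longrightarrow> B \<in> rc_borel \<Omega>"
  unfolding rc_borel_def by blast

lemma rc_borelI: "A \<in> sets borel \<Longrightarrow> compact K \<Longrightarrow> K \<subseteq> \<Omega> \<Longrightarrow> A \<subseteq> K \<Longrightarrow> A \<in> rc_borel \<Omega>"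
  unfolding rc_borel_def by blast

lemma rc_borel_sets: "A \<in> rc_borel \<Omega> \<Longrightarrow> A \<in> sets borel"
  unfolding rc_borel_def by blast

lemma compact_exhaustion:
  fixes \<Omega> :: "'a::euclidean_space set"
  assumes "open \<Omega>"
  obtains C :: "nat \<Rightarrow> 'a set" where "\<And>n. compact (C n)" "\<And>n. C n \<subseteq> \<Omega>" "incseq C" "(\<Union>n. C n) = \<Omega>"
proof -
  obtain C :: "nat \<Rightarrow> 'a set" where C: "\<And>n. compact (C n)" "\<And>n. C n \<subseteq> \<Omega>"
    "\<And>n. C n \<subseteq> interior (C (Suc n))" "\<Union>(range C) = \<Omega>"
    using open_Union_compact_subsets[OF assms] by metis
  have "incseq C" using C(3) interior_subset by (intro incseq_SucI) blast
  then show thesis using that[of C] C by blast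
qed

text \<open>The empty set is a disjoint union of infinitely many copies of itself, and a constant
  series converges only if the constant is 0.\<close>

lemma signed_radon_empty:
  assumes "signed_radon \<Omega> \<nu>" shows "\<nu> {} = 0"
proof -
  have "({} :: 'a::euclidean_space set) \<in> rc_borel \<Omega>" by (rule rc_borelI[of _ "{}"]) auto
  then have "(\<lambda>i::nat. \<nu> {}) sums \<nu> {}"
    using assms[unfolded signed_radon_def, rule_format, of "\<lambda>i. {}"] by (auto simp: disjoint_family_on_def)
  then have "summable (\<lambda>i::nat. \<nu> {})" by (rule sums_summable)
  then show ?thesis by (simp add: summable_const_iff)
qed

lemma signed_radon_split:
  assumes \<nu>: "signed_radon \<Omega> \<nu>" and A: "A \<in> rc_borel \<Omega>" and N: "N \<in> sets borel"
  shows "\<nu> A = \<nu> (A \<inter> N) + \<nu> (A - N)"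
proof -
  let ?B = "binaryset (A \<inter> N) (A - N)"
  have A': "A \<inter> N \<in> rc_borel \<Omega>" "A - N \<in> rc_borel \<Omega>" "{} \<in> rc_borel \<Omega>"
    using A N rc_borel_sets[OF A] by (auto intro: rc_borel_subset[OF A])
  have U: "(\<Union>i. ?B i) = A" by (auto simp: UN_binaryset_eq)
  have "range ?B \<subseteq> rc_borel \<Omega>" using A' by (simp add: range_binaryset_eq)
  moreover have "disjoint_family ?B" by (auto simp: disjoint_family_on_def binaryset_def)
  ultimately have "(\<lambda>i. \<nu> (?B i)) sums \<nu> (\<Union>i. ?B i)"
    using \<nu> A U unfolding signed_radon_def by metis
  moreover have "(\<lambda>i. \<nu> (?B i)) sums (\<nu> (A \<inter> N) + \<nu> (A - N))"
    by (rule binaryset_sums[of \<nu>, OF signed_radon_empty[OF \<nu>]])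
  ultimately show ?thesis using sums_unique2 U by metis
qed

text \<open>The Radon-Nikodym derivative of a \<sigma>-finite measure is finite almost everywhere; a
  change on a null set makes it real and nonnegative everywhere.\<close>

lemma real_density_exists:
  assumes M: "sigma_finite_measure M" and N: "sigma_finite_measure N"
    and ac: "absolutely_continuous M N" and sets: "sets N = sets M"
  obtains f :: "'a \<Rightarrow> real" where "f \<in> borel_measurable M" "\<And>x. 0 \<le> f x" "N = density M (\<lambda>x. ennreal (f x))"
proof -
  interpret M: sigma_finite_measure M by fact
  define f where "f x = enn2real (RN_deriv M N x)" for x
  have "AE x in M. RN_deriv M N x \<noteq> \<infinity>" by (rule M.RN_deriv_finite[OF N ac sets])
  then have "AE x in M. RN_deriv M N x = ennreal (f x)"
    by eventually_elim (simp add: f_def ennreal_enn2real_if)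
  moreover have fm: "f \<in> borel_measurable M" unfolding f_def by measurable
  ultimately have "density M (RN_deriv M N) = density M (\<lambda>x. ennreal (f x))"
    by (intro density_cong) simp_all
  then have "N = density M (\<lambda>x. ennreal (f x))" unfolding M.density_RN_deriv[OF ac sets] .
  moreover have "0 \<le> f x" for x by (simp add: f_def)
  ultimately show thesis using that fm by blast
qed

definition sum_measure :: "'a measure \<Rightarrow> 'a measure \<Rightarrow> 'a measure" where
  "sum_measure M N = measure_of (space M) (sets M) (\<lambda>A. emeasure M A + emeasure N A)"

lemma sets_sum_measure [simp]: "sets (sum_measure M N) = sets M"
  by (simp add: sum_measure_def sets.sets_measure_of_eq)

lemma emeasure_sum_measure:
  assumes "sets N = sets M" "A \<in> sets M"
  shows "emeasure (sum_measure M N) A = emeasure M A + emeasure N A"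
  unfolding sum_measure_def
proof (rule emeasure_measure_of_sigma)
  show "sigma_algebra (space M) (sets M)" ..
  show "positive (sets M) (\<lambda>A. emeasure M A + emeasure N A)" by (simp add: positive_def)
  show "countably_additive (sets M) (\<lambda>A. emeasure M A + emeasure N A)"
  proof (rule countably_additiveI)
    fix A :: "nat \<Rightarrow> 'a set" assume A: "range A \<subseteq> sets M" "disjoint_family A"
    then have A': "range A \<subseteq> sets N" using assms(1) by simp
    have "(\<Sum>i. emeasure M (A i) + emeasure N (A i)) = (\<Sum>i. emeasure M (A i)) + (\<Sum>i. emeasure N (A i))"
      by (rule suminf_add[symmetric]) auto
    then show "(\<Sum>i. emeasure M (A i) + emeasure N (A i)) = emeasure M (\<Union>i. A i) + emeasure N (\<Union>i. A i)"
      by (simp only: suminf_emeasure[OF A] suminf_emeasure[OF A' A(2)])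
  qed
qed fact

text \<open>The signed measure h dS for a positive measure S. Its Jordan decomposition is given by
  the sign of h, which makes the suprema in \<open>pos_variation\<close> and
  \<open>neg_variation\<close> computable.\<close>

locale locally_integrable_density =
  fixes \<Omega> :: "'a::euclidean_space set" and S :: "'a measure" and h :: "'a \<Rightarrow> real"
  assumes open_domain: "open \<Omega>" and sets_S [measurable_cong]: "sets S = sets borel"
    and h_measurable [measurable]: "h \<in> borel_measurable borel"
    and h_integrable: "compact K \<Longrightarrow> K \<subseteq> \<Omega> \<Longrightarrow> set_integrable S K h"
begin

definition nu :: "'a set \<Rightarrow> real" where "nu A = (LINT x:A|S. h x)"

lemma space_S: "space S = UNIV"
  using sets_eq_imp_space_eq[OF sets_S] by simp

lemma rc_integrable:
  assumes "A \<in> rc_borel \<Omega>" shows "set_integrable S A h"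
proof -
  obtain K where K: "compact K" "K \<subseteq> \<Omega>" "A \<subseteq> K" "A \<in> sets borel"
    using assms by (auto simp: rc_borel_def)
  show ?thesis by (rule set_integrable_subset[OF h_integrable[OF K(1,2)] _ K(3)]) (simp add: sets_S K(4))
qed

lemma signed_radon_nu: "signed_radon \<Omega> nu"
  unfolding signed_radon_def
proof (intro allI impI)
  fix A :: "nat \<Rightarrow> 'a set"
  assume A: "range A \<subseteq> rc_borel \<Omega>" "disjoint_family A" "(\<Union>i. A i) \<in> rc_borel \<Omega>"
  have s: "A i \<in> sets S" for i using A(1) rc_borel_sets sets_S by blast
  have "set_integrable S (A i) h" for i using A(1) by (intro rc_integrable) auto
  moreover have "disjoint_family_on A {..<n}" for n
    using A(2) by (rule disjoint_family_on_mono[rotated]) simp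
  ultimately have "(\<Sum>i<n. nu (A i)) = nu (\<Union>i<n. A i)" for n
    unfolding nu_def using s by (intro set_integral_finite_Union[symmetric]) simp_all
  moreover have "(\<lambda>n. nu (\<Union>i<n. A i)) \<longlonglongrightarrow> nu (\<Union>n. \<Union>i<n. A i)"
    unfolding nu_def
  proof (rule set_integral_cont_up)
    show "(\<Union>i<n. A i) \<in> sets S" for n using s by auto
    show "incseq (\<lambda>n. \<Union>i<n. A i)" by (force simp: incseq_def)
    have "(\<Union>n. \<Union>i<n. A i) = (\<Union>i. A i)" by auto
    then show "set_integrable S (\<Union>n. \<Union>i<n. A i) h" using rc_integrable[OF A(3)] by simp
  qed
  moreover have "(\<Union>n. \<Union>i<n. A i) = (\<Union>i. A i)" by auto
  ultimately show "(\<lambda>i. nu (A i)) sums nu (\<Union>i. A i)" by (simp add: sums_def)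
qed

lemma nu_le_pos_part:
  assumes B: "B \<in> rc_borel \<Omega>"
  shows "ennreal (nu B) \<le> (\<integral>\<^sup>+x. ennreal (h x) * indicator B x \<partial>S)"
    and "(\<And>x. x \<in> B \<Longrightarrow> 0 \<le> h x) \<Longrightarrow> ennreal (nu B) = (\<integral>\<^sup>+x. ennreal (h x) * indicator B x \<partial>S)"
proof -
  have i: "integrable S (\<lambda>x. indicator B x * h x)"
    using rc_integrable[OF B] by (simp add: set_integrable_def)
  have i': "integrable S (\<lambda>x. max 0 (indicator B x * h x))" using i by (intro integrable_max) auto
  have "nu B \<le> (LINT x|S. max 0 (indicator B x * h x))"
    unfolding nu_def set_lebesgue_integral_def using i i' by (intro integral_mono) auto
  then have "ennreal (nu B) \<le> ennreal (LINT x|S. max 0 (indicator B x * h x))" by (rule ennreal_leI)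
  also have "\<dots> = (\<integral>\<^sup>+x. ennreal (max 0 (indicator B x * h x)) \<partial>S)"
    using i' by (subst nn_integral_eq_integral) auto
  also have eq: "\<dots> = (\<integral>\<^sup>+x. ennreal (h x) * indicator B x \<partial>S)"
    by (intro nn_integral_cong) (auto split: split_indicator simp: max_def ennreal_neg)
  finally show "ennreal (nu B) \<le> (\<integral>\<^sup>+x. ennreal (h x) * indicator B x \<partial>S)" .
  assume nn: "\<And>x. x \<in> B \<Longrightarrow> 0 \<le> h x"
  have "nu B = (LINT x|S. max 0 (indicator B x * h x))"
    unfolding nu_def set_lebesgue_integral_def using nn
    by (intro Bochner_Integration.integral_cong) (auto split: split_indicator)
  then have "ennreal (nu B) = (\<integral>\<^sup>+x. ennreal (max 0 (indicator B x * h x)) \<partial>S)"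
    using i' by (subst nn_integral_eq_integral) auto
  then show "ennreal (nu B) = (\<integral>\<^sup>+x. ennreal (h x) * indicator B x \<partial>S)" unfolding eq .
qed

text \<open>The supremum is approximated on the intersections of \<open>{x. 0 < h x}\<close> with an exhaustion of \<open>\<Omega>\<close>.\<close>

lemma pos_variation_nu:
  "pos_variation \<Omega> nu = density S (\<lambda>x. ennreal (h x) * indicator \<Omega> x)"
proof -
  have \<Omega>[measurable]: "\<Omega> \<in> sets borel" using open_domain by simp
  obtain C :: "nat \<Rightarrow> 'a set" where C: "\<And>n. compact (C n)" "\<And>n. C n \<subseteq> \<Omega>" "incseq C" "(\<Union>n. C n) = \<Omega>"
    using compact_exhaustion[OF open_domain] by blast
  have Cb[measurable]: "C n \<in> sets borel" for n using C(1) by (simp add: borel_compact)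
  let ?D = "density S (\<lambda>x. ennreal (h x) * indicator \<Omega> x)"
  have "(SUP B\<in>{B \<in> rc_borel \<Omega>. B \<subseteq> A}. ennreal (nu B)) = emeasure ?D A" if A[measurable]: "A \<in> sets borel" for A
  proof (rule antisym)
    have em: "emeasure ?D A = (\<integral>\<^sup>+x. ennreal (h x) * indicator \<Omega> x * indicator A x \<partial>S)"
      using A sets_S by (intro emeasure_density) auto
    show "(SUP B\<in>{B \<in> rc_borel \<Omega>. B \<subseteq> A}. ennreal (nu B)) \<le> emeasure ?D A"
    proof (rule SUP_least)
      fix B assume "B \<in> {B \<in> rc_borel \<Omega>. B \<subseteq> A}"
      then have B: "B \<in> rc_borel \<Omega>" "B \<subseteq> A" "B \<subseteq> \<Omega>" by (auto simp: rc_borel_def)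
      have "ennreal (nu B) \<le> (\<integral>\<^sup>+x. ennreal (h x) * indicator B x \<partial>S)" by (rule nu_le_pos_part[OF B(1)])
      also have "\<dots> \<le> emeasure ?D A"
        unfolding em using B by (intro nn_integral_mono) (auto split: split_indicator)
      finally show "ennreal (nu B) \<le> emeasure ?D A" .
    qed
    define B where "B n = A \<inter> C n \<inter> {x. 0 < h x}" for n
    have B[measurable]: "B n \<in> sets borel" for n unfolding B_def by measurable
    have rc: "B n \<in> rc_borel \<Omega>" for n
      using C by (intro rc_borelI[of _ "C n"]) (auto simp: B_def)
    have "emeasure ?D A = (\<integral>\<^sup>+x. (SUP n. ennreal (h x) * indicator (B n) x) \<partial>S)"
      unfolding em
    proof (rule nn_integral_cong)
      fix x
      show "ennreal (h x) * indicator \<Omega> x * indicator A x = (SUP n. ennreal (h x) * indicator (B n) x)"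
      proof (cases "x \<in> \<Omega> \<and> x \<in> A \<and> 0 < h x")
        case True
        then obtain n where "x \<in> C n" using C(4) by blast
        then have "indicator (B n) x = (1 :: ennreal)" using True by (simp add: B_def)
        then have "ennreal (h x) \<le> (SUP n. ennreal (h x) * indicator (B n) x)"
          by (intro SUP_upper2[of n]) auto
        moreover have "(SUP n. ennreal (h x) * indicator (B n) x) \<le> ennreal (h x)"
          by (intro SUP_least) (auto split: split_indicator)
        ultimately show ?thesis using True by (simp add: antisym)
      next
        case False
        then have "ennreal (h x) * indicator (B n) x = 0" for n
          using C(2) by (auto simp: B_def split: split_indicator)
        moreover have "ennreal (h x) * indicator \<Omega> x * indicator A x = 0"
          using False by (auto split: split_indicator simp: ennreal_neg)
        ultimately show ?thesis by (simp only:) simp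
      qed
    qed
    also have "\<dots> = (SUP n. \<integral>\<^sup>+x. ennreal (h x) * indicator (B n) x \<partial>S)"
    proof (rule nn_integral_monotone_convergence_SUP)
      show "incseq (\<lambda>n x. ennreal (h x) * indicator (B n) x)"
        using C(3) by (auto simp: incseq_def le_fun_def B_def subset_iff split: split_indicator)
    qed (auto simp: measurable_cong_sets[OF sets_S refl])
    also have "\<dots> = (SUP n. ennreal (nu (B n)))"
      by (intro SUP_cong refl nu_le_pos_part(2)[OF rc, symmetric]) (auto simp: B_def)
    also have "\<dots> \<le> (SUP B\<in>{B \<in> rc_borel \<Omega>. B \<subseteq> A}. ennreal (nu B))"
      using rc by (intro SUP_least SUP_upper) (auto simp: B_def)
    finally show "emeasure ?D A \<le> (SUP B\<in>{B \<in> rc_borel \<Omega>. B \<subseteq> A}. ennreal (nu B))" .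
  qed
  note main = this
  have sig: "sigma_sets UNIV (sets borel) = sets (borel :: 'a measure)"
    using sets.sigma_sets_eq[of "borel :: 'a measure"] unfolding space_borel .
  have "pos_variation \<Omega> nu = measure_of UNIV (sets borel) (emeasure ?D)"
    unfolding pos_variation_def by (rule measure_of_eq) (simp, rule main, simp only: sig)
  also have "\<dots> = measure_of (space ?D) (sets ?D) (emeasure ?D)"
    by (simp only: space_density sets_density space_S sets_S)
  also have "\<dots> = ?D" using measure_of_of_measure[of ?D] .
  finally show ?thesis .
qed

lemma neg_density: "locally_integrable_density \<Omega> S (\<lambda>x. - h x)"
proof
  show "(\<lambda>x. - h x) \<in> borel_measurable borel" by measurable
  show "set_integrable S K (\<lambda>x. - h x)" if "compact K" "K \<subseteq> \<Omega>" for K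
    using h_integrable[OF that] by (simp add: set_integrable_def)
qed (rule open_domain, rule sets_S)

lemma neg_variation_nu:
  "neg_variation \<Omega> nu = density S (\<lambda>x. ennreal (- h x) * indicator \<Omega> x)"
proof -
  interpret neg: locally_integrable_density \<Omega> S "\<lambda>x. - h x" by (rule neg_density)
  have "(\<lambda>A. - nu A) = neg.nu"
    by (rule ext) (simp add: nu_def neg.nu_def set_lebesgue_integral_def)
  then show ?thesis unfolding neg_variation_def by (simp only: neg.pos_variation_nu)
qed

lemma signed_integral_nu:
  assumes \<phi>: "continuous_on UNIV \<phi>" and K: "compact K" "K \<subseteq> \<Omega>" "\<And>x. x \<notin> K \<Longrightarrow> \<phi> x = 0"
  shows "signed_integral \<Omega> nu \<phi> = (LINT x|S. h x * \<phi> x)" "integrable S (\<lambda>x. h x * \<phi> x)"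
proof -
  have \<Omega>[measurable]: "\<Omega> \<in> sets borel" using open_domain by simp
  have \<phi>m[measurable]: "\<phi> \<in> borel_measurable borel" by (rule borel_measurable_continuous_onI[OF \<phi>])
  have "bounded (\<phi> ` K)"
    using compact_continuous_image[OF continuous_on_subset[OF \<phi>] K(1)] compact_imp_bounded by blast
  then obtain B where B: "\<And>x. x \<in> K \<Longrightarrow> \<bar>\<phi> x\<bar> \<le> B" "0 < B" unfolding bounded_pos by auto
  have iK: "integrable S (\<lambda>x. B * \<bar>indicator K x * h x\<bar>)"
    using h_integrable[OF K(1,2)] by (auto simp: set_integrable_def)
  \<comment> \<open>Stated for every q dominated by h, so that it serves h itself and its positive
    and negative parts on \<Omega>.\<close>
  have dom: "integrable S (\<lambda>x. q x * \<phi> x)"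
    if [measurable]: "q \<in> borel_measurable borel" and q: "\<And>x. \<bar>q x\<bar> \<le> \<bar>h x\<bar>" for q
  proof (rule Bochner_Integration.integrable_bound[OF iK])
    show "(\<lambda>x. q x * \<phi> x) \<in> borel_measurable S" by measurable
    have "\<bar>q x * \<phi> x\<bar> \<le> \<bar>B * \<bar>indicator K x * h x\<bar>\<bar>" for x
    proof (cases "x \<in> K")
      case True
      then have "\<bar>q x\<bar> * \<bar>\<phi> x\<bar> \<le> \<bar>h x\<bar> * B" using q B by (intro mult_mono) auto
      then show ?thesis using True B(2) by (simp add: abs_mult mult.commute)
    qed (simp add: K(3))
    then show "AE x in S. norm (q x * \<phi> x) \<le> norm (B * \<bar>indicator K x * h x\<bar>)" by simp
  qed
  show "integrable S (\<lambda>x. h x * \<phi> x)" by (rule dom) auto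
  have part: "(LINT x|density S (\<lambda>x. ennreal (q x) * indicator \<Omega> x). \<phi> x) = (LINT x|S. (max 0 (q x) * indicator \<Omega> x) * \<phi> x)"
    if [measurable]: "q \<in> borel_measurable borel" for q
  proof -
    have eq: "(\<lambda>x. ennreal (q x) * indicator \<Omega> x) = (\<lambda>x. ennreal (max 0 (q x) * indicator \<Omega> x))"
      by (auto simp: fun_eq_iff max_def ennreal_neg split: split_indicator)
    have "(\<lambda>x. max 0 (q x) * indicator \<Omega> x) \<in> borel_measurable S" "\<phi> \<in> borel_measurable S"
      by measurable
    then show ?thesis
      unfolding eq by (subst integral_density) (auto split: split_indicator)
  qed
  have i1: "integrable S (\<lambda>x. (max 0 (h x) * indicator \<Omega> x) * \<phi> x)"
    by (rule dom) (auto split: split_indicator)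
  have i2: "integrable S (\<lambda>x. (max 0 (- h x) * indicator \<Omega> x) * \<phi> x)"
    by (rule dom) (auto split: split_indicator)
  have "signed_integral \<Omega> nu \<phi> = (LINT x|S. (max 0 (h x) * indicator \<Omega> x) * \<phi> x - (max 0 (- h x) * indicator \<Omega> x) * \<phi> x)"
    unfolding signed_integral_def pos_variation_nu neg_variation_nu
    using i1 i2 by (simp add: part)
  also have "\<dots> = (LINT x|S. h x * \<phi> x)"
    using K(2,3) by (intro Bochner_Integration.integral_cong) (auto split: split_indicator simp: max_def)
  finally show "signed_integral \<Omega> nu \<phi> = (LINT x|S. h x * \<phi> x)" .
qed

lemma restrict_density:
  assumes E: "E \<in> sets borel" shows "locally_integrable_density \<Omega> S (\<lambda>x. indicator E x * h x)"
proof
  show "(\<lambda>x. indicator E x * h x) \<in> borel_measurable borel" using E by measurable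
  show "set_integrable S K (\<lambda>x. indicator E x * h x)" if "compact K" "K \<subseteq> \<Omega>" for K
  proof -
    have "integrable S (\<lambda>x. indicator E x *\<^sub>R (indicator K x *\<^sub>R h x))"
      using h_integrable[OF that] unfolding set_integrable_def
      by (rule integrable_mult_indicator[rotated]) (simp add: E sets_S)
    moreover have "indicator E x *\<^sub>R (indicator K x *\<^sub>R h x) = indicator K x *\<^sub>R (indicator E x * h x)" for x
      by (simp split: split_indicator)
    ultimately show ?thesis unfolding set_integrable_def by (simp only:)
  qed
qed (rule open_domain, rule sets_S)

end

text \<open>Compact sets exhaust \<Omega>. Its complement is exhausted by balls; the measures to
  which this is applied are zero or Lebesgue measure there.\<close>

lemma sigma_finite_if_compact_finite:
  fixes M :: "'a::euclidean_space measure"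
  assumes \<Omega>: "open \<Omega>" and M: "sets M = sets borel"
    and fin: "\<And>K. compact K \<Longrightarrow> K \<subseteq> \<Omega> \<Longrightarrow> emeasure M K < \<infinity>"
    and out: "\<And>n::nat. emeasure M (- \<Omega> \<inter> cball 0 (real n)) < \<infinity>"
  shows "sigma_finite_measure M"
proof
  obtain C :: "nat \<Rightarrow> 'a set" where C: "\<And>n. compact (C n)" "\<And>n. C n \<subseteq> \<Omega>" "(\<Union>n. C n) = \<Omega>"
    using compact_exhaustion[OF \<Omega>] by metis
  let ?A = "range C \<union> range (\<lambda>n::nat. - \<Omega> \<inter> cball 0 (real n))"
  have "x \<in> \<Union>?A" for x
  proof (cases "x \<in> \<Omega>")
    case False
    obtain n :: nat where "norm x \<le> real n" using real_arch_simple by blast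
    then have "x \<in> - \<Omega> \<inter> cball 0 (real n)" using False by simp
    then show ?thesis by blast
  qed (use C(3) in blast)
  then have "\<Union>?A = UNIV" by blast
  moreover have "?A \<subseteq> sets M"
    using C(1) \<Omega> by (auto simp: M borel_compact)
  moreover have "emeasure M a \<noteq> \<infinity>" if "a \<in> ?A" for a
    using that fin[OF C(1,2)] out by (auto simp: less_top[symmetric])
  moreover have "space M = UNIV" using sets_eq_imp_space_eq[OF M] by simp
  ultimately show "\<exists>A. countable A \<and> A \<subseteq> sets M \<and> \<Union> A = space M \<and> (\<forall>a\<in>A. emeasure M a \<noteq> \<infinity>)"
    by (intro exI[of _ ?A] conjI) simp_all
qed

section \<open>The signed measure M - c dx and its Lebesgue decomposition\<close>

lemma set_integral_eq_measure_density:
  fixes f :: "'a \<Rightarrow> real"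
  assumes f: "f \<in> borel_measurable S" "\<And>x. 0 \<le> f x" and A: "A \<in> sets S"
    and fin: "emeasure (density S (\<lambda>x. ennreal (f x))) A < \<infinity>"
  shows "set_integrable S A f" "(LINT x:A|S. f x) = measure (density S (\<lambda>x. ennreal (f x))) A"
proof -
  let ?D = "density S (\<lambda>x. ennreal (f x))"
  have "integrable ?D (indicator A :: 'a \<Rightarrow> real)" using A fin by (simp add: integrable_real_indicator)
  then have "integrable S (\<lambda>x. f x *\<^sub>R (indicator A x :: real))"
    using f A by (subst (asm) integrable_density) auto
  then show "set_integrable S A f" by (simp add: set_integrable_def mult.commute)
  have "measure ?D A = (LINT x|?D. indicator A x)" using A by simp
  also have "\<dots> = (LINT x|S. f x *\<^sub>R indicator A x)" using f A by (intro integral_density) auto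
  finally show "(LINT x:A|S. f x) = measure ?D A" by (simp add: set_lebesgue_integral_def mult.commute)
qed

locale radon_minus_density =
  fixes \<Omega> :: "'a::euclidean_space set" and M :: "'a measure" and c :: "'a \<Rightarrow> real"
  assumes open_domain: "open \<Omega>" and sets_M: "sets M = sets borel"
    and M_compact: "compact K \<Longrightarrow> K \<subseteq> \<Omega> \<Longrightarrow> emeasure M K < \<infinity>"
    and M_outside: "emeasure M (- \<Omega>) = 0"
    and c_measurable: "c \<in> borel_measurable borel"
    and c_bounded: "compact K \<Longrightarrow> K \<subseteq> \<Omega> \<Longrightarrow> \<exists>B. \<forall>x\<in>K. \<bar>c x\<bar> \<le> B"
begin

lemma domain_borel: "\<Omega> \<in> sets borel" using open_domain by simp

lemma sigma_finite_M: "sigma_finite_measure M"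
proof (rule sigma_finite_if_compact_finite[OF open_domain sets_M M_compact])
  fix n :: nat
  have "emeasure M (- \<Omega> \<inter> cball 0 (real n)) \<le> emeasure M (- \<Omega>)"
    using domain_borel sets_M by (intro emeasure_mono) auto
  then show "emeasure M (- \<Omega> \<inter> cball 0 (real n)) < \<infinity>" by (simp add: M_outside)
qed

text \<open>M and Lebesgue measure are both absolutely continuous with respect to their sum, so M -
  c dx has one real density f - c g even if M has a singular part.\<close>

definition S :: "'a measure" where "S = sum_measure M lborel"

lemma sets_S: "sets S = sets borel" by (simp add: S_def sets_M)

lemma emeasure_S: "A \<in> sets borel \<Longrightarrow> emeasure S A = emeasure M A + emeasure lborel A"
  unfolding S_def using emeasure_sum_measure[of lborel M A] sets_M by simp

lemma sigma_finite_S: "sigma_finite_measure S"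
proof (rule sigma_finite_if_compact_finite[OF open_domain sets_S])
  fix K assume K: "compact K" "K \<subseteq> \<Omega>"
  have "emeasure lborel K < \<infinity>" by (rule emeasure_compact_finite[OF K(1)])
  then show "emeasure S K < \<infinity>"
    using M_compact[OF K] by (simp add: emeasure_S borel_compact[OF K(1)] less_top)
next
  fix n :: nat
  let ?B = "- \<Omega> \<inter> cball 0 (real n)"
  have B: "?B \<in> sets borel" using domain_borel by auto
  have "emeasure M ?B \<le> emeasure M (- \<Omega>)" using domain_borel sets_M by (intro emeasure_mono) auto
  then have "emeasure M ?B = 0" by (simp add: M_outside)
  moreover have "emeasure lborel ?B \<le> emeasure lborel (cball (0 :: 'a) (real n))" by (intro emeasure_mono) auto
  ultimately show "emeasure S ?B < \<infinity>"
    unfolding emeasure_S[OF B] using emeasure_compact_finite[OF compact_cball, of "0 :: 'a" "real n"] by simp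
qed

lemma ac_M: "absolutely_continuous S M" and ac_lborel: "absolutely_continuous S lborel"
  unfolding absolutely_continuous_def null_sets_def using emeasure_S sets_S sets_M by auto

text \<open>\<open>f\<close> and \<open>g\<close> are the Radon-Nikodym derivatives of M and of
  Lebesgue measure with respect to S, chosen Borel, real and nonnegative everywhere.\<close>

definition f :: "'a \<Rightarrow> real" where
  "f = (SOME f. f \<in> borel_measurable borel \<and> (\<forall>x. 0 \<le> f x) \<and> M = density S (\<lambda>x. ennreal (f x)))"

definition g :: "'a \<Rightarrow> real" where
  "g = (SOME g. g \<in> borel_measurable borel \<and> (\<forall>x. 0 \<le> g x) \<and> lborel = density S (\<lambda>x. ennreal (g x)))"

lemma f: "f \<in> borel_measurable borel" "0 \<le> f x" "M = density S (\<lambda>x. ennreal (f x))"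
proof -
  obtain q where "q \<in> borel_measurable S" "\<And>x. 0 \<le> q x" "M = density S (\<lambda>x. ennreal (q x))"
    using real_density_exists[OF sigma_finite_S sigma_finite_M ac_M] sets_S sets_M by metis
  then have "\<exists>f. f \<in> borel_measurable borel \<and> (\<forall>x. 0 \<le> f x) \<and> M = density S (\<lambda>x. ennreal (f x))"
    using measurable_cong_sets[OF sets_S refl] by blast
  from someI_ex[OF this] show "f \<in> borel_measurable borel" "0 \<le> f x" "M = density S (\<lambda>x. ennreal (f x))"
    unfolding f_def[symmetric] by blast+
qed

lemma g: "g \<in> borel_measurable borel" "0 \<le> g x" "lborel = density S (\<lambda>x. ennreal (g x))"
proof -
  obtain q where "q \<in> borel_measurable S" "\<And>x. 0 \<le> q x" "(lborel :: 'a measure) = density S (\<lambda>x. ennreal (q x))"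
    using real_density_exists[OF sigma_finite_S lborel.sigma_finite_measure_axioms ac_lborel] sets_S
    by (metis sets_lborel)
  then have "\<exists>g. g \<in> borel_measurable borel \<and> (\<forall>x. 0 \<le> g x) \<and> (lborel :: 'a measure) = density S (\<lambda>x. ennreal (g x))"
    using measurable_cong_sets[OF sets_S refl] by blast
  from someI_ex[OF this] show "g \<in> borel_measurable borel" "0 \<le> g x" "lborel = density S (\<lambda>x. ennreal (g x))"
    unfolding g_def[symmetric] by blast+
qed

lemma rc_finite:
  assumes "A \<in> rc_borel \<Omega>" shows "emeasure M A < \<infinity>" "emeasure lborel A < \<infinity>"
proof -
  obtain K where K: "compact K" "K \<subseteq> \<Omega>" "A \<subseteq> K" "A \<in> sets borel"
    using assms by (auto simp: rc_borel_def)
  have "emeasure M A \<le> emeasure M K" "emeasure lborel A \<le> emeasure lborel K"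
    using K by (auto intro!: emeasure_mono simp: sets_M borel_compact)
  then show "emeasure M A < \<infinity>" "emeasure lborel A < \<infinity>"
    using M_compact[OF K(1,2)] emeasure_compact_finite[OF K(1)] order_le_less_trans by blast+
qed

lemma c_integrable:
  assumes "A \<in> rc_borel \<Omega>" shows "set_integrable lborel A c"
proof -
  obtain K where K: "compact K" "K \<subseteq> \<Omega>" "A \<subseteq> K" "A \<in> sets borel"
    using assms by (auto simp: rc_borel_def)
  obtain B where "\<forall>x\<in>K. \<bar>c x\<bar> \<le> B" using c_bounded[OF K(1,2)] by blast
  then show ?thesis unfolding set_integrable_def
    using K(3,4) c_measurable rc_finite(2)[OF assms]
    by (intro integrableI_bounded_set_indicator[where B = B]) auto
qed

lemma cg_integral:
  assumes A: "A \<in> rc_borel \<Omega>"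
  shows "set_integrable S A (\<lambda>x. c x * g x)" "(LINT x:A|S. c x * g x) = (LINT x:A|lborel. c x)"
proof -
  have Ab: "A \<in> sets borel" using A by (rule rc_borel_sets)
  have m: "(\<lambda>x. indicator A x *\<^sub>R c x) \<in> borel_measurable S" "g \<in> borel_measurable S"
    using Ab c_measurable g(1) unfolding measurable_cong_sets[OF sets_S refl] by auto
  have "integrable (density S (\<lambda>x. ennreal (g x))) (\<lambda>x. indicator A x *\<^sub>R c x)"
    using c_integrable[OF A] unfolding set_integrable_def g(3)[symmetric] .
  then have "integrable S (\<lambda>x. g x *\<^sub>R (indicator A x *\<^sub>R c x))"
    using m g(2) by (subst (asm) integrable_density) auto
  then show "set_integrable S A (\<lambda>x. c x * g x)" by (simp add: set_integrable_def ac_simps)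
  have "(LINT x:A|lborel. c x) = (LINT x|density S (\<lambda>x. ennreal (g x)). indicator A x *\<^sub>R c x)"
    unfolding set_lebesgue_integral_def g(3)[symmetric] ..
  also have "\<dots> = (LINT x|S. g x *\<^sub>R (indicator A x *\<^sub>R c x))"
    using m g(2) by (intro integral_density) auto
  finally show "(LINT x:A|S. c x * g x) = (LINT x:A|lborel. c x)"
    by (simp add: set_lebesgue_integral_def ac_simps)
qed

lemma f_integral:
  assumes A: "A \<in> rc_borel \<Omega>"
  shows "set_integrable S A f" "(LINT x:A|S. f x) = measure M A"
proof -
  have "A \<in> sets S" "f \<in> borel_measurable S"
    using rc_borel_sets[OF A] f(1) unfolding measurable_cong_sets[OF sets_S refl] sets_S by auto
  moreover have "emeasure (density S (\<lambda>x. ennreal (f x))) A < \<infinity>"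
    unfolding f(3)[symmetric] by (rule rc_finite(1)[OF A])
  ultimately show "set_integrable S A f" "(LINT x:A|S. f x) = measure M A"
    using set_integral_eq_measure_density[of f S A] f(2) unfolding f(3)[symmetric] by blast+
qed

sublocale locally_integrable_density \<Omega> S "\<lambda>x. f x - c x * g x"
proof
  show "(\<lambda>x. f x - c x * g x) \<in> borel_measurable borel" using f(1) g(1) c_measurable by measurable
  show "set_integrable S K (\<lambda>x. f x - c x * g x)" if "compact K" "K \<subseteq> \<Omega>" for K
  proof -
    have "K \<in> rc_borel \<Omega>" using that by (intro rc_borelI[of _ K]) (auto simp: borel_compact)
    then show ?thesis by (intro set_integral_diff f_integral cg_integral)
  qed
qed (rule open_domain, rule sets_S)

lemma nu_eq:
  assumes "A \<in> rc_borel \<Omega>" shows "nu A = measure M A - (LINT x:A|lborel. c x)"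
  unfolding nu_def using set_integral_diff(2)[OF f_integral(1) cg_integral(1), OF assms assms]
    f_integral(2)[OF assms] cg_integral(2)[OF assms] by simp

lemma signed_integral_eq:
  assumes \<phi>: "continuous_on UNIV \<phi>" and K: "compact K" "K \<subseteq> \<Omega>" "\<And>x. x \<notin> K \<Longrightarrow> \<phi> x = 0"
  shows "signed_integral \<Omega> nu \<phi> = (LINT x|M. \<phi> x) - (LINT x|lborel. c x * \<phi> x)"
proof -
  have nu_int: "signed_integral \<Omega> nu \<phi> = (LINT x|S. (f x - c x * g x) * \<phi> x)"
    by (rule signed_integral_nu(1)[OF \<phi> K])
  have \<phi>m: "\<phi> \<in> borel_measurable borel" by (rule borel_measurable_continuous_onI[OF \<phi>])
  interpret F: locally_integrable_density \<Omega> S f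
  proof
    show "set_integrable S K f" if "compact K" "K \<subseteq> \<Omega>" for K
      using that by (intro f_integral rc_borelI[of _ K]) (auto simp: borel_compact)
  qed (rule open_domain, rule sets_S, rule f)
  interpret G: locally_integrable_density \<Omega> S "\<lambda>x. c x * g x"
  proof
    show "set_integrable S K (\<lambda>x. c x * g x)" if "compact K" "K \<subseteq> \<Omega>" for K
      using that by (intro cg_integral rc_borelI[of _ K]) (auto simp: borel_compact)
    show "(\<lambda>x. c x * g x) \<in> borel_measurable borel" using g(1) c_measurable by measurable
  qed (rule open_domain, rule sets_S)
  have m: "\<phi> \<in> borel_measurable S" "f \<in> borel_measurable S" "g \<in> borel_measurable S"
    "(\<lambda>x. c x * \<phi> x) \<in> borel_measurable S"
    unfolding measurable_cong_sets[OF sets_S refl] using \<phi>m f(1) g(1) c_measurable by auto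
  have "signed_integral \<Omega> nu \<phi> = (LINT x|S. f x * \<phi> x - (c x * g x) * \<phi> x)"
    unfolding nu_int by (simp only: left_diff_distrib)
  also have "\<dots> = (LINT x|S. f x * \<phi> x) - (LINT x|S. (c x * g x) * \<phi> x)"
    by (intro Bochner_Integration.integral_diff F.signed_integral_nu(2)[OF \<phi> K] G.signed_integral_nu(2)[OF \<phi> K])
  also have "(LINT x|S. f x * \<phi> x) = (LINT x|density S (\<lambda>x. ennreal (f x)). \<phi> x)"
    using m f(2) by (subst integral_density) auto
  also have "(LINT x|S. (c x * g x) * \<phi> x) = (LINT x|density S (\<lambda>x. ennreal (g x)). c x * \<phi> x)"
    using m g(2) by (subst integral_density) (auto simp: ac_simps)
  finally show ?thesis unfolding f(3)[symmetric] g(3)[symmetric] .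
qed

text \<open>The argument covers every decomposition. Let N be a Lebesgue null set carrying \<mu>s.
  On N the part c dx vanishes, so \<mu>s is M restricted to N and is nonnegative. Off N, M is
  absolutely continuous within \<Omega>; if q \<ge> 0 is its density there, that of \<mu>ac is q - c
  \<ge> - c.\<close>

lemma decomposition_density:
  assumes dec: "lebesgue_decomposition \<Omega> nu \<mu>ac \<mu>s"
  shows "signed_nonneg \<Omega> \<mu>s"
    and "\<exists>q. has_lebesgue_density \<Omega> \<mu>ac q \<and> (AE x in lborel. x \<in> \<Omega> \<longrightarrow> - c x \<le> q x)"
proof -
  have rad: "signed_radon \<Omega> \<mu>ac" "signed_radon \<Omega> \<mu>s" and dec': "\<And>A. A \<in> rc_borel \<Omega> \<Longrightarrow> nu A = \<mu>ac A + \<mu>s A"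
    and ac: "\<And>A. A \<in> rc_borel \<Omega> \<Longrightarrow> A \<in> null_sets lborel \<Longrightarrow> \<mu>ac A = 0"
    using dec by (auto simp: lebesgue_decomposition_def signed_abs_cont_def)
  obtain N where N: "N \<in> null_sets lborel" and sing: "\<And>A. A \<in> rc_borel \<Omega> \<Longrightarrow> A \<inter> N = {} \<Longrightarrow> \<mu>s A = 0"
    using dec by (auto simp: lebesgue_decomposition_def signed_singular_def)
  have Nb: "N \<in> sets borel" using N by auto
  have rcN: "A \<inter> N \<in> rc_borel \<Omega>" "A - N \<in> rc_borel \<Omega>" if "A \<in> rc_borel \<Omega>" for A
    using rc_borel_sets[OF that] Nb by (auto intro: rc_borel_subset[OF that])
  have null: "A \<inter> N \<in> null_sets lborel" if "A \<in> rc_borel \<Omega>" for A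
    using rc_borel_sets[OF that] N by (intro null_set_Int1) auto
  have int_null: "(LINT x:A|lborel. c x) = 0" if "A \<in> null_sets lborel" for A
  proof -
    have "AE x in lborel. indicator A x *\<^sub>R c x = 0"
      using AE_not_in[OF that] by eventually_elim simp
    then show ?thesis unfolding set_lebesgue_integral_def by (rule integral_eq_zero_AE)
  qed
  have s: "\<mu>s A = measure M (A \<inter> N)" if A: "A \<in> rc_borel \<Omega>" for A
  proof -
    have "\<mu>s A = \<mu>s (A \<inter> N)"
      using signed_radon_split[OF rad(2) A Nb] sing[OF rcN(2)[OF A]] by auto
    also have "\<dots> = nu (A \<inter> N)"
      using dec'[OF rcN(1)[OF A]] ac[OF rcN(1)[OF A] null[OF A]] by simp
    also have "\<dots> = measure M (A \<inter> N)"
      using nu_eq[OF rcN(1)[OF A]] int_null[OF null[OF A]] by simp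
    finally show ?thesis .
  qed
  then show "signed_nonneg \<Omega> \<mu>s" by (simp add: signed_nonneg_def)
  have a: "\<mu>ac A = measure M (A - N) - (LINT x:A|lborel. c x)" if A: "A \<in> rc_borel \<Omega>" for A
  proof -
    have "nu (A \<inter> N) = measure M (A \<inter> N)"
      using nu_eq[OF rcN(1)[OF A]] int_null[OF null[OF A]] by simp
    then have "\<mu>ac A = nu (A - N)"
      using signed_radon_split[OF signed_radon_nu A Nb] dec'[OF A] s[OF A] by simp
    also have "\<dots> = measure M (A - N) - (LINT x:A - N|lborel. c x)" by (rule nu_eq[OF rcN(2)[OF A]])
    also have "(LINT x:A - N|lborel. c x) = (LINT x:A|lborel. c x)"
    proof (rule set_integral_cong_set)
      show "AE x in lborel. (x \<in> A) = (x \<in> A - N)" using AE_not_in[OF N] by eventually_elim auto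
    qed (use c_integrable[OF A] c_integrable[OF rcN(2)[OF A]] in
        \<open>auto simp: set_borel_measurable_def set_integrable_def dest: borel_measurable_integrable\<close>)
    finally show ?thesis .
  qed
  define M' where "M' = density M (indicator (\<Omega> - N))"
  have M'_sets: "sets M' = sets borel" by (simp add: M'_def sets_M)
  have M': "emeasure M' A = emeasure M (A \<inter> (\<Omega> - N))" if "A \<in> sets borel" for A
  proof -
    have "emeasure M' A = (\<integral>\<^sup>+x. indicator (\<Omega> - N) x * indicator A x \<partial>M)"
      unfolding M'_def using that Nb domain_borel
      by (intro emeasure_density borel_measurable_indicator) (auto simp: sets_M)
    also have "\<dots> = (\<integral>\<^sup>+x. indicator (A \<inter> (\<Omega> - N)) x \<partial>M)"
      by (intro nn_integral_cong) (auto split: split_indicator)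
    also have "\<dots> = emeasure M (A \<inter> (\<Omega> - N))"
      using that Nb domain_borel by (intro nn_integral_indicator) (auto simp: sets_M)
    finally show ?thesis .
  qed
  have M'_le: "emeasure M' A \<le> emeasure M A" if "A \<in> sets borel" for A
    unfolding M'[OF that] using that by (intro emeasure_mono) (auto simp: sets_M)
  have "sigma_finite_measure M'"
  proof (rule sigma_finite_if_compact_finite[OF open_domain M'_sets])
    show "emeasure M' K < \<infinity>" if "compact K" "K \<subseteq> \<Omega>" for K
      using M'_le[OF borel_compact[OF that(1)]] M_compact[OF that] by (rule order_le_less_trans)
    show "emeasure M' (- \<Omega> \<inter> cball 0 (real n)) < \<infinity>" for n
    proof -
      have "- \<Omega> \<inter> cball 0 (real n) \<inter> (\<Omega> - N) = {}" by auto
      moreover have "- \<Omega> \<inter> cball 0 (real n) \<in> sets borel" using domain_borel by auto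
      ultimately show ?thesis using M' by simp
    qed
  qed
  moreover have "absolutely_continuous lborel M'"
    unfolding absolutely_continuous_def
  proof
    fix A :: "'a set" assume A: "A \<in> null_sets lborel"
    obtain C :: "nat \<Rightarrow> 'a set" where C: "\<And>n. compact (C n)" "\<And>n. C n \<subseteq> \<Omega>" "(\<Union>n. C n) = \<Omega>"
      using compact_exhaustion[OF open_domain] by metis
    have Ab: "A \<in> sets borel" using A by auto
    have "(A \<inter> C n) - N \<in> null_sets M" for n
    proof -
      have rc: "A \<inter> C n \<in> rc_borel \<Omega>"
        using C(1,2) Ab by (intro rc_borelI[of _ "C n"]) (auto simp: borel_compact)
      have An: "A \<inter> C n \<in> null_sets lborel"
        using A C(1) by (intro null_set_Int2) (auto simp: borel_compact)
      \<comment> \<open>Both \<mu>ac and c dx vanish on the null set A \<inter> C n, so the formula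
        for \<mu>ac leaves no mass of M outside N.\<close>
      have "measure M ((A \<inter> C n) - N) = 0"
        using a[OF rc] ac[OF rc An] int_null[OF An] by simp
      then show ?thesis
        using rc_finite(1)[OF rcN(2)[OF rc]] rc_borel_sets[OF rcN(2)[OF rc]]
        by (auto simp: null_sets_def sets_M emeasure_eq_ennreal_measure less_top)
    qed
    then have "(\<Union>n. (A \<inter> C n) - N) \<in> null_sets M" by (rule null_sets_UN)
    moreover have "(\<Union>n. (A \<inter> C n) - N) = A \<inter> (\<Omega> - N)" using C(3) by auto
    ultimately show "A \<in> null_sets M'"
      using Ab by (auto simp: null_sets_def M' M'_sets)
  qed
  ultimately obtain q :: "'a \<Rightarrow> real" where q: "q \<in> borel_measurable lborel" "\<And>x. 0 \<le> q x"
    "M' = density lborel (\<lambda>x. ennreal (q x))"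
    using real_density_exists[OF lborel.sigma_finite_measure_axioms, of M'] M'_sets by auto
  have dens: "set_integrable lborel A q" "(LINT x:A|lborel. q x) = measure M (A - N)" if A: "A \<in> rc_borel \<Omega>" for A
  proof -
    have Ab: "A \<in> sets borel" by (rule rc_borel_sets[OF A])
    have "A \<inter> (\<Omega> - N) = A - N" using A by (auto simp: rc_borel_def)
    then have "measure M' A = measure M (A - N)" using M'[OF Ab] by (simp add: measure_def)
    moreover have "emeasure M' A < \<infinity>" using M'_le[OF Ab] rc_finite(1)[OF A] by (rule order_le_less_trans)
    ultimately show "set_integrable lborel A q" "(LINT x:A|lborel. q x) = measure M (A - N)"
      using set_integral_eq_measure_density[of q lborel A] q Ab by auto
  qed
  have "has_lebesgue_density \<Omega> \<mu>ac (\<lambda>x. q x - c x)"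
    unfolding has_lebesgue_density_def
  proof (intro conjI ballI)
    show "(\<lambda>x. q x - c x) \<in> borel_measurable lborel" using q(1) c_measurable by simp
    fix A assume A: "A \<in> rc_borel \<Omega>"
    show "set_integrable lborel A (\<lambda>x. q x - c x)" by (rule set_integral_diff(1)[OF dens(1)[OF A] c_integrable[OF A]])
    show "\<mu>ac A = (LINT x:A|lborel. q x - c x)"
      using set_integral_diff(2)[OF dens(1)[OF A] c_integrable[OF A]] dens(2)[OF A] a[OF A] by simp
  qed
  moreover have "AE x in lborel. x \<in> \<Omega> \<longrightarrow> - c x \<le> q x - c x" using q(2) by simp
  ultimately show "\<exists>q. has_lebesgue_density \<Omega> \<mu>ac q \<and> (AE x in lborel. x \<in> \<Omega> \<longrightarrow> - c x \<le> q x)"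
    by blast
qed

lemma lebesgue_decomposition_exists: "\<exists>\<mu>ac \<mu>s. lebesgue_decomposition \<Omega> nu \<mu>ac \<mu>s"
proof -
  let ?h = "\<lambda>x. f x - c x * g x"
  \<comment> \<open>N is Lebesgue null, since its Lebesgue measure is the integral of g over N. Off
    N, g > 0, so Lebesgue null sets are S-null there. Splitting the density along N thus separates
    the singular part from the absolutely continuous one.\<close>
  define N where "N = {x. g x = 0}"
  have N: "N \<in> sets borel" using g(1) unfolding N_def by measurable
  have null: "N \<in> null_sets lborel"
  proof -
    have "N \<in> null_sets (density S (\<lambda>x. ennreal (g x)))"
      using g(1) N by (subst null_sets_density_iff) (auto simp: N_def sets_S measurable_cong_sets[OF sets_S refl])
    then show ?thesis unfolding g(3)[symmetric] .
  qed
  interpret E: locally_integrable_density \<Omega> S "\<lambda>x. indicator (- N) x * ?h x"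
    by (rule restrict_density) (use N in auto)
  interpret E': locally_integrable_density \<Omega> S "\<lambda>x. indicator N x * ?h x"
    by (rule restrict_density) (use N in auto)
  have "nu A = E.nu A + E'.nu A" if A: "A \<in> rc_borel \<Omega>" for A
  proof -
    have "E.nu A + E'.nu A = (LINT x:A|S. indicator (- N) x * ?h x + indicator N x * ?h x)"
      unfolding E.nu_def E'.nu_def
      by (rule set_integral_add(2)[symmetric, OF E.rc_integrable[OF A] E'.rc_integrable[OF A]])
    also have "\<dots> = nu A"
      unfolding nu_def set_lebesgue_integral_def
      by (intro Bochner_Integration.integral_cong) (auto split: split_indicator)
    finally show ?thesis by simp
  qed
  moreover have "signed_abs_cont \<Omega> E.nu"
    unfolding signed_abs_cont_def
  proof (intro ballI impI)
    fix A assume A: "A \<in> rc_borel \<Omega>" "A \<in> null_sets lborel"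
    then have "A \<in> null_sets (density S (\<lambda>x. ennreal (g x)))" unfolding g(3)[symmetric] by simp
    then have "AE x in S. x \<in> A \<longrightarrow> ennreal (g x) = 0"
      using g(1) by (subst (asm) null_sets_density_iff) (auto simp: measurable_cong_sets[OF sets_S refl])
    then have "AE x in S. indicator A x *\<^sub>R (indicator (- N) x * ?h x) = 0"
    proof eventually_elim
      case (elim x)
      then have "x \<in> A \<Longrightarrow> g x = 0" using g(2)[of x] by simp
      then show ?case by (auto simp: N_def split: split_indicator)
    qed
    then show "E.nu A = 0"
      unfolding E.nu_def set_lebesgue_integral_def by (rule integral_eq_zero_AE)
  qed
  moreover have "signed_singular \<Omega> E'.nu"
    unfolding signed_singular_def
  proof (intro bexI[OF _ null] ballI impI)
    fix A assume "A \<inter> N = {}"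
    then have "indicator A x *\<^sub>R (indicator N x * ?h x) = 0" for x by (auto split: split_indicator)
    then show "E'.nu A = 0" unfolding E'.nu_def set_lebesgue_integral_def by (simp only: integral_zero)
  qed
  ultimately have "lebesgue_decomposition \<Omega> nu E.nu E'.nu"
    unfolding lebesgue_decomposition_def using E.signed_radon_nu E'.signed_radon_nu by blast
  then show ?thesis by blast
qed

end

section \<open>Uniqueness of the mean curvature\<close>

lemma linear_hyp_proj: "linear (hyp_proj e)"
  by (rule linearI) (simp_all add: hyp_proj_def inner_simps algebra_simps)

lemma hyp_proj_self: "norm e = 1 \<Longrightarrow> hyp_proj e e = 0"
  by (simp add: hyp_proj_def norm_eq_1)

lemma hyp_proj_orthogonal: "w \<bullet> e = 0 \<Longrightarrow> hyp_proj e w = w"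
  by (simp add: hyp_proj_def)

lemma hyp_proj_inner: "norm e = 1 \<Longrightarrow> hyp_proj e x \<bullet> e = 0"
  by (simp add: hyp_proj_def inner_simps norm_eq_1)

lemma hyp_proj_add_scale: "norm e = 1 \<Longrightarrow> hyp_proj e (x + t *\<^sub>R e) = hyp_proj e x"
  by (simp add: linear_add[OF linear_hyp_proj] linear_scale[OF linear_hyp_proj] hyp_proj_self)

text \<open>The vectors \<open>v i\<close> together with e are as many orthonormal vectors as the
  dimension, hence a basis of the space.\<close>

lemma frame_expand:
  fixes e :: "'a::euclidean_space"
  assumes e: "norm e = 1" and ve: "\<And>i. i < DIM('a) - 1 \<Longrightarrow> v i \<bullet> e = 0"
    and vv: "\<And>i j. i < DIM('a) - 1 \<Longrightarrow> j < DIM('a) - 1 \<Longrightarrow> v i \<bullet> v j = (if i = j then 1 else 0)"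
  shows "hyp_proj e x = (\<Sum>i < DIM('a) - 1. (x \<bullet> v i) *\<^sub>R v i)"
proof -
  let ?I = "{..< DIM('a) - 1}"
  define B where "B = insert e (v ` ?I)"
  have inj: "inj_on v ?I"
  proof (rule inj_onI)
    fix i j assume "i \<in> ?I" "j \<in> ?I" "v i = v j"
    then show "i = j" using vv[of i j] vv[of i i] by (auto split: if_splits)
  qed
  have n1: "norm b = 1" if "b \<in> B" for b
    using that e vv by (auto simp: B_def norm_eq_1)
  have eB: "e \<notin> v ` ?I" using ve e by (auto simp: norm_eq_1)
  have orth: "pairwise orthogonal B"
    unfolding B_def pairwise_insert
    using ve vv by (auto simp: pairwise_def orthogonal_def inner_commute[of e] split: if_splits)
  have "0 \<notin> B" using n1 by force
  then have ind: "independent B" using orth pairwise_orthogonal_independent by blast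
  have "card B = DIM('a)" using inj eB by (simp add: B_def card_image)
  then have "UNIV \<subseteq> span B"
    using ind by (intro card_ge_dim_independent) auto
  then have "(\<Sum>b\<in>B. (x \<bullet> b) *\<^sub>R b) = x"
    using orth n1 by (intro orthonormal_basis_expand) (auto simp: B_def)
  moreover have "(\<Sum>b\<in>B. (x \<bullet> b) *\<^sub>R b) = (x \<bullet> e) *\<^sub>R e + (\<Sum>i\<in>?I. (x \<bullet> v i) *\<^sub>R v i)"
    using eB inj by (simp add: B_def sum.reindex)
  ultimately show ?thesis by (simp add: hyp_proj_def algebra_simps)
qed

text \<open>The clauses of \<open>principal_curvatures\<close> about principal directions, at a
  general point p, so that such directions can be found without reference to \<Omega>.\<close>

definition principal_frame ::
  "'a::euclidean_space \<Rightarrow> 'a \<Rightarrow> ('a \<Rightarrow> real) \<Rightarrow> (nat \<Rightarrow> 'a) \<Rightarrow> (nat \<Rightarrow> real) \<Rightarrow> bool" where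
  "principal_frame p e \<gamma> v \<kappa> \<longleftrightarrow>
     (\<forall>i < DIM('a) - 1. v i \<bullet> e = 0) \<and>
     (\<forall>i < DIM('a) - 1. \<forall>j < DIM('a) - 1. v i \<bullet> v j = (if i = j then 1 else 0)) \<and>
     (\<forall>i < DIM('a) - 1. \<forall>w. w \<bullet> e = 0 \<longrightarrow> dir_deriv w (dir_deriv (v i) \<gamma>) p = \<kappa> i * (v i \<bullet> w))"

definition tangent_chart ::
  "'a::euclidean_space set \<Rightarrow> 'a \<Rightarrow> 'a \<Rightarrow> ('a \<Rightarrow> real) \<Rightarrow> bool" where
  "tangent_chart \<Omega> y e \<gamma> \<longleftrightarrow>
     epigraph_chart \<Omega> y e \<gamma> \<and> (\<forall>w. w \<bullet> e = 0 \<longrightarrow> dir_deriv w \<gamma> (hyp_proj e y) = 0)"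

lemma principal_curvatures_iff:
  "principal_curvatures \<Omega> y \<kappa> \<longleftrightarrow>
     (\<exists>e \<gamma> v. tangent_chart \<Omega> y e \<gamma> \<and> principal_frame (hyp_proj e y) e \<gamma> v \<kappa>)"
  unfolding principal_curvatures_def tangent_chart_def principal_frame_def by (simp only: conj_assoc)

text \<open>The trace of the Hessian on the hyperplane, written with projected coordinate vectors
  because the Laplacian differentiates along coordinates. Each \<kappa> i receives the total weight
  of the squares of the coordinates of \<open>v i\<close>, which is 1.\<close>

lemma hessian_trace:
  fixes e :: "'a::euclidean_space"
  assumes e: "norm e = 1" and \<gamma>: "Ck_on 2 UNIV \<gamma>" and frame: "principal_frame p e \<gamma> v \<kappa>"
  shows "(\<Sum>b\<in>Basis. dir_deriv (hyp_proj e b) (dir_deriv (hyp_proj e b) \<gamma>) p) = (\<Sum>i < DIM('a) - 1. \<kappa> i)"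
proof -
  let ?I = "{..< DIM('a) - 1}"
  have ve: "\<And>i. i < DIM('a) - 1 \<Longrightarrow> v i \<bullet> e = 0"
    and vv: "\<And>i j. i < DIM('a) - 1 \<Longrightarrow> j < DIM('a) - 1 \<Longrightarrow> v i \<bullet> v j = (if i = j then 1 else 0)"
    and eig: "\<And>i w. i < DIM('a) - 1 \<Longrightarrow> w \<bullet> e = 0 \<Longrightarrow> dir_deriv w (dir_deriv (v i) \<gamma>) p = \<kappa> i * (v i \<bullet> w)"
    using frame unfolding principal_frame_def by blast+
  have \<gamma>2: "Ck_on (Suc (Suc 0)) UNIV \<gamma>" using \<gamma> by (simp only: numeral_2_eq_2)
  have d1: "\<gamma> differentiable (at x)" for x using \<gamma>2 by simp
  have d2: "dir_deriv w \<gamma> differentiable (at x)" for w x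
    using Ck_on_dir_deriv[OF open_UNIV \<gamma>2, of w] by simp
  have expand: "dir_deriv (hyp_proj e b) \<gamma> = (\<lambda>x. \<Sum>i\<in>?I. (b \<bullet> v i) * dir_deriv (v i) \<gamma> x)" for b
    using linear_sum[OF linear_dir_deriv[OF d1], of "\<lambda>i. (b \<bullet> v i) *\<^sub>R v i" ?I]
      linear_scale[OF linear_dir_deriv[OF d1]] by (simp add: frame_expand[OF e ve vv] fun_eq_iff)
  have "dir_deriv (hyp_proj e b) (dir_deriv (hyp_proj e b) \<gamma>) p = (\<Sum>i\<in>?I. \<kappa> i * (b \<bullet> v i)\<^sup>2)" for b
  proof -
    have "((\<lambda>x. \<Sum>i\<in>?I. (b \<bullet> v i) * dir_deriv (v i) \<gamma> x) has_derivative
        (\<lambda>w. \<Sum>i\<in>?I. (b \<bullet> v i) * dir_deriv w (dir_deriv (v i) \<gamma>) p)) (at p)"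
      by (intro has_derivative_sum has_derivative_mult_right dir_deriv_has_derivative d2)
    then have "dir_deriv (hyp_proj e b) (dir_deriv (hyp_proj e b) \<gamma>) p
        = (\<Sum>i\<in>?I. (b \<bullet> v i) * dir_deriv (hyp_proj e b) (dir_deriv (v i) \<gamma>) p)"
      unfolding expand by (rule dir_deriv_eq)
    also have "\<dots> = (\<Sum>i\<in>?I. \<kappa> i * (b \<bullet> v i)\<^sup>2)"
    proof (rule sum.cong)
      fix i assume "i \<in> ?I"
      then have i: "i < DIM('a) - 1" by simp
      have "v i \<bullet> hyp_proj e b = b \<bullet> v i"
        using ve[OF i] by (simp add: hyp_proj_def inner_simps inner_commute)
      then show "(b \<bullet> v i) * dir_deriv (hyp_proj e b) (dir_deriv (v i) \<gamma>) p = \<kappa> i * (b \<bullet> v i)\<^sup>2"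
        using eig[OF i hyp_proj_inner[OF e]] by (simp add: power2_eq_square)
    qed simp
    finally show ?thesis .
  qed
  then have "(\<Sum>b\<in>Basis. dir_deriv (hyp_proj e b) (dir_deriv (hyp_proj e b) \<gamma>) p)
      = (\<Sum>b\<in>Basis. \<Sum>i\<in>?I. \<kappa> i * (b \<bullet> v i)\<^sup>2)" by simp
  also have "\<dots> = (\<Sum>i\<in>?I. \<kappa> i * (\<Sum>b\<in>Basis. (b \<bullet> v i)\<^sup>2))"
    by (subst sum.swap) (simp add: sum_distrib_left)
  also have "\<dots> = (\<Sum>i\<in>?I. \<kappa> i)"
  proof (rule sum.cong)
    fix i assume "i \<in> ?I"
    then have "v i \<bullet> v i = 1" using vv by simp
    then have "(\<Sum>b\<in>Basis. (b \<bullet> v i)\<^sup>2) = 1"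
      by (subst (asm) euclidean_inner) (simp add: power2_eq_square inner_commute)
    then show "\<kappa> i * (\<Sum>b\<in>Basis. (b \<bullet> v i)\<^sup>2) = \<kappa> i" by simp
  qed simp
  finally show ?thesis .
qed

text \<open>For p in the hyperplane the left-hand side uses values of \<gamma> on the hyperplane
  only. It can be compared between charts, and with second differences of the distance.\<close>

lemma hessian_trace_limit:
  fixes e :: "'a::euclidean_space"
  assumes e: "norm e = 1" and \<gamma>: "Ck_on 2 UNIV \<gamma>" and frame: "principal_frame p e \<gamma> v \<kappa>"
  shows "((\<lambda>t. \<Sum>b\<in>Basis. second_diff \<gamma> p (hyp_proj e b) t) \<longlongrightarrow> (\<Sum>i < DIM('a) - 1. \<kappa> i)) (at_right 0)"
  unfolding hessian_trace[OF assms, symmetric] by (intro tendsto_sum second_diff_tendsto \<gamma>)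

section \<open>Charts at a boundary point and the inner normal\<close>

lemma epigraph_chartE:
  assumes "epigraph_chart \<Omega> y e \<gamma>"
  obtains r where "r > 0" "\<And>x. x \<in> ball y r \<Longrightarrow> x \<in> \<Omega> \<longleftrightarrow> \<gamma> (hyp_proj e x) < x \<bullet> e"
    "Ck_on 2 UNIV \<gamma>" "norm e = 1"
proof -
  obtain r where r: "r > 0" "\<Omega> \<inter> ball y r = {x \<in> ball y r. \<gamma> (hyp_proj e x) < x \<bullet> e}"
    and "Ck_on 2 UNIV \<gamma>" "norm e = 1" using assms by (auto simp: epigraph_chart_def)
  moreover have "x \<in> \<Omega> \<longleftrightarrow> \<gamma> (hyp_proj e x) < x \<bullet> e" if "x \<in> ball y r" for x
    using that r(2)[THEN eqset_imp_iff, of x] by simp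
  ultimately show thesis using that by blast
qed

text \<open>If y lay strictly below the graph, so would a whole neighbourhood, which would miss
  \<Omega>. It is not strictly above because an open set contains none of its boundary
  points.\<close>

lemma epigraph_chart_boundary:
  assumes \<Omega>: "open \<Omega>" and y: "y \<in> frontier \<Omega>" and chart: "epigraph_chart \<Omega> y e \<gamma>"
  shows "\<gamma> (hyp_proj e y) = y \<bullet> e"
proof -
  obtain r where r: "r > 0" "\<And>x. x \<in> ball y r \<Longrightarrow> x \<in> \<Omega> \<longleftrightarrow> \<gamma> (hyp_proj e x) < x \<bullet> e"
    and \<gamma>: "Ck_on 2 UNIV \<gamma>" using epigraph_chartE[OF chart] by metis
  have "y \<notin> \<Omega>" using y \<Omega> by (simp add: frontier_def interior_open)
  then have ge: "y \<bullet> e \<le> \<gamma> (hyp_proj e y)" using r(1) r(2)[of y] by simp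
  have "continuous_on UNIV (\<lambda>x. \<gamma> (hyp_proj e x))"
    using Ck_on_continuous[OF \<gamma>] linear_continuous_on[OF linear_conv_bounded_linear[THEN iffD1, OF linear_hyp_proj]]
    by (rule continuous_on_compose2) auto
  then have "open {x. x \<bullet> e < \<gamma> (hyp_proj e x)}"
    by (intro open_Collect_less continuous_intros)
  then have o: "open ({x. x \<bullet> e < \<gamma> (hyp_proj e x)} \<inter> ball y r)" by auto
  have "({x. x \<bullet> e < \<gamma> (hyp_proj e x)} \<inter> ball y r) \<inter> \<Omega> = {}" using r(2) by (auto simp: disjoint_iff dest: order.asym)
  then have "y \<notin> {x. x \<bullet> e < \<gamma> (hyp_proj e x)} \<inter> ball y r"
    using y open_Int_closure_eq_empty[OF o, of \<Omega>] unfolding frontier_def by blast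
  then show ?thesis using ge r(1) by simp
qed

lemma eventually_ray_in_open:
  fixes y :: "'a::real_normed_vector"
  shows "open S \<Longrightarrow> y \<in> S \<Longrightarrow> \<forall>\<^sub>F t in at_right 0. y + t *\<^sub>R u \<in> S"
proof -
  assume S: "open S" "y \<in> S"
  have "((\<lambda>t. y + t *\<^sub>R u) \<longlongrightarrow> y + 0 *\<^sub>R u) (at_right 0)" by (intro tendsto_intros)
  then show ?thesis using S by (intro topological_tendstoD[of "\<lambda>t. y + t *\<^sub>R u" y]) auto
qed

text \<open>The height above the graph has derivative \<open>u \<bullet> e\<close> along the ray from \<open>y\<close> in direction \<open>u\<close>.\<close>

lemma tangent_chart_ray:
  assumes \<Omega>: "open \<Omega>" and y: "y \<in> frontier \<Omega>" and chart: "tangent_chart \<Omega> y e \<gamma>"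
  shows "0 < u \<bullet> e \<Longrightarrow> \<forall>\<^sub>F t in at_right 0. y + t *\<^sub>R u \<in> \<Omega>"
    and "u \<bullet> e < 0 \<Longrightarrow> \<forall>\<^sub>F t in at_right 0. y + t *\<^sub>R u \<notin> \<Omega>"
proof -
  have chart': "epigraph_chart \<Omega> y e \<gamma>" and grad: "\<And>w. w \<bullet> e = 0 \<Longrightarrow> dir_deriv w \<gamma> (hyp_proj e y) = 0"
    using chart by (auto simp: tangent_chart_def)
  obtain r where r: "r > 0" "\<And>x. x \<in> ball y r \<Longrightarrow> x \<in> \<Omega> \<longleftrightarrow> \<gamma> (hyp_proj e x) < x \<bullet> e"
    and \<gamma>: "Ck_on 2 UNIV \<gamma>" and e: "norm e = 1" using epigraph_chartE[OF chart'] by metis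
  define g where "g t = (y + t *\<^sub>R u) \<bullet> e - \<gamma> (hyp_proj e y + t *\<^sub>R hyp_proj e u)" for t
  have d: "\<gamma> differentiable (at x)" for x using \<gamma> by (simp add: numeral_2_eq_2)
  have g0: "g 0 = 0" using epigraph_chart_boundary[OF \<Omega> y chart'] by (simp add: g_def)
  have "(g has_real_derivative (u \<bullet> e - 0)) (at 0)"
    unfolding g_def
  proof (rule DERIV_diff)
    show "((\<lambda>t. (y + t *\<^sub>R u) \<bullet> e) has_real_derivative u \<bullet> e) (at 0)"
      by (auto intro!: derivative_eq_intros simp: inner_simps)
    show "((\<lambda>t. \<gamma> (hyp_proj e y + t *\<^sub>R hyp_proj e u)) has_real_derivative 0) (at 0)"
      using line_has_real_derivative[of \<gamma> "hyp_proj e y" 0 "hyp_proj e u"] d grad[OF hyp_proj_inner[OF e]]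
      by simp
  qed
  then have der: "(g has_real_derivative u \<bullet> e) (at 0)" by simp
  have iff: "\<forall>\<^sub>F t in at_right 0. (y + t *\<^sub>R u \<in> \<Omega> \<longleftrightarrow> 0 < g t)"
    using eventually_ray_in_open[OF open_ball centre_in_ball[THEN iffD2, OF r(1)], of y u]
  proof eventually_elim
    case (elim t)
    show ?case using r(2)[OF elim]
      by (simp add: g_def linear_add[OF linear_hyp_proj] linear_scale[OF linear_hyp_proj])
  qed
  show "\<forall>\<^sub>F t in at_right 0. y + t *\<^sub>R u \<in> \<Omega>" if "0 < u \<bullet> e"
  proof -
    have "\<forall>\<^sub>F t in at_right 0. 0 < g t"
      using DERIV_pos_inc_right[OF der that] g0 by (auto simp: eventually_at_right_field)
    with iff show ?thesis by eventually_elim blast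
  qed
  show "\<forall>\<^sub>F t in at_right 0. y + t *\<^sub>R u \<notin> \<Omega>" if "u \<bullet> e < 0"
  proof -
    have "\<forall>\<^sub>F t in at_right 0. g t < 0"
      using DERIV_neg_dec_right[OF der that] g0 by (auto simp: eventually_at_right_field)
    with iff show ?thesis by eventually_elim auto
  qed
qed

text \<open>If \<nu> and e differed, the direction \<nu> - e would make an acute angle with \<nu>
  and an obtuse one with e, so the points of its ray near y would lie both in \<Omega> and
  outside.\<close>

lemma normal_unique:
  assumes \<Omega>: "open \<Omega>" "y \<in> frontier \<Omega>" "tangent_chart \<Omega> y e \<gamma>"
    and \<nu>: "norm \<nu> = 1" "\<And>u. 0 < u \<bullet> \<nu> \<Longrightarrow> \<forall>\<^sub>F t in at_right 0. y + t *\<^sub>R u \<in> \<Omega>"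
  shows "\<nu> = e"
proof (rule ccontr)
  assume ne: "\<nu> \<noteq> e"
  have e: "norm e = 1" using \<Omega>(3) by (simp add: tangent_chart_def epigraph_chart_def)
  have "0 < (norm (\<nu> - e))\<^sup>2" using ne by simp
  also have "(norm (\<nu> - e))\<^sup>2 = 2 - 2 * (e \<bullet> \<nu>)"
    using \<nu>(1) e by (simp add: power2_norm_eq_inner inner_simps norm_eq_1 inner_commute)
  finally have lt: "e \<bullet> \<nu> < 1" by simp
  have "0 < (\<nu> - e) \<bullet> \<nu>" "(\<nu> - e) \<bullet> e < 0"
    using lt \<nu>(1) e by (simp_all add: inner_simps norm_eq_1 inner_commute)
  then have "\<forall>\<^sub>F t in at_right (0::real). y + t *\<^sub>R (\<nu> - e) \<in> \<Omega> \<and> y + t *\<^sub>R (\<nu> - e) \<notin> \<Omega>"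
    using \<nu>(2) tangent_chart_ray(2)[OF \<Omega>] by (intro eventually_conj) auto
  then have "\<forall>\<^sub>F t in at_right (0::real). False" by eventually_elim blast
  then show False by simp
qed

text \<open>The ball around x touches the boundary at y, and rays from y at an acute angle to x - y
  start inside it. Hence the unit vector along x - y has the property that characterises the inner
  normal.\<close>

lemma nearest_point_normal:
  assumes \<Omega>: "open \<Omega>" "y \<in> frontier \<Omega>" "tangent_chart \<Omega> y e \<gamma>"
    and x: "x \<noteq> y" "ball x (dist x y) \<subseteq> \<Omega>"
  shows "x = y + dist x y *\<^sub>R e"
proof -
  define s where "s = dist x y"
  have s: "s > 0" using x by (simp add: s_def)
  have "(1 / s) *\<^sub>R (x - y) = e"
  proof (rule normal_unique[OF \<Omega>])
    show "norm ((1 / s) *\<^sub>R (x - y)) = 1" using s by (simp add: s_def dist_norm)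
    fix u assume "0 < u \<bullet> ((1 / s) *\<^sub>R (x - y))"
    then have u: "0 < u \<bullet> (x - y)" using s by (simp add: zero_less_divide_iff)
    have "\<forall>\<^sub>F t in at_right (0::real). t * (u \<bullet> u) < 2 * (u \<bullet> (x - y))"
      by (rule order_tendstoD(2)[of _ 0]) (use u in \<open>auto intro!: tendsto_eq_intros\<close>)
    then show "\<forall>\<^sub>F t in at_right 0. y + t *\<^sub>R u \<in> \<Omega>"
      using eventually_at_right_less
    proof eventually_elim
      case (elim t)
      \<comment> \<open>The bracket is positive by the choice of t, so y + t u is closer to x than y
        is.\<close>
      have "(dist x (y + t *\<^sub>R u))\<^sup>2 = s\<^sup>2 - t * (2 * (u \<bullet> (x - y)) - t * (u \<bullet> u))"
        unfolding s_def dist_norm power2_norm_eq_inner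
        by (simp add: inner_simps inner_commute algebra_simps)
      also have "\<dots> < s\<^sup>2" using elim by simp
      finally have "dist x (y + t *\<^sub>R u) < s" using s by (simp add: power_less_imp_less_base)
      then show ?case using x(2) by (auto simp: s_def)
    qed
  qed
  then have "s *\<^sub>R e = x - y" using s by auto
  then show ?thesis by (simp add: s_def)
qed

text \<open>
  If \<open>\<gamma>\<close> were larger than \<open>\<gamma>'\<close> at \<open>q\<close>, the point of the first graph over \<open>q\<close> would lie
  in the second epigraph but not in the first one.
\<close>

lemma chart_le_chart:
  assumes e: "norm e = 1" and q: "q \<bullet> e = 0"
    and r: "\<And>x. x \<in> ball y r \<Longrightarrow> x \<in> \<Omega> \<longleftrightarrow> \<gamma> (hyp_proj e x) < x \<bullet> e"
    and r': "\<And>x. x \<in> ball y r' \<Longrightarrow> x \<in> \<Omega> \<longleftrightarrow> \<gamma>' (hyp_proj e x) < x \<bullet> e"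
    and z: "q + \<gamma> q *\<^sub>R e \<in> ball y r" "q + \<gamma> q *\<^sub>R e \<in> ball y r'"
  shows "\<gamma> q \<le> \<gamma>' q"
proof (rule ccontr)
  let ?z = "q + \<gamma> q *\<^sub>R e"
  assume "\<not> \<gamma> q \<le> \<gamma>' q"
  moreover have ze: "?z \<bullet> e = \<gamma> q" and zP: "hyp_proj e ?z = q"
    using e q by (simp_all add: inner_simps norm_eq_1 hyp_proj_add_scale hyp_proj_orthogonal)
  ultimately show False using r[OF z(1)] r'[OF z(2)] by simp
qed

text \<open>For small t both graph points over the ray lie in both balls, so
  \<open>chart_le_chart\<close> applies in either order. Only rays inside the hyperplane occur,
  since a chart says nothing about \<gamma> elsewhere.\<close>

lemma chart_germ_unique:
  assumes \<Omega>: "open \<Omega>" "y \<in> frontier \<Omega>"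
    and c: "epigraph_chart \<Omega> y e \<gamma>" and c': "epigraph_chart \<Omega> y e \<gamma>'"
    and w: "w \<bullet> e = 0"
  shows "\<forall>\<^sub>F t in at_right 0. \<gamma> (hyp_proj e y + t *\<^sub>R w) = \<gamma>' (hyp_proj e y + t *\<^sub>R w)"
proof -
  let ?q = "\<lambda>t. hyp_proj e y + t *\<^sub>R w"
  obtain r where r: "r > 0" "\<And>x. x \<in> ball y r \<Longrightarrow> x \<in> \<Omega> \<longleftrightarrow> \<gamma> (hyp_proj e x) < x \<bullet> e"
    and \<gamma>: "Ck_on 2 UNIV \<gamma>" and e: "norm e = 1" using epigraph_chartE[OF c] by metis
  obtain r' where r': "r' > 0" "\<And>x. x \<in> ball y r' \<Longrightarrow> x \<in> \<Omega> \<longleftrightarrow> \<gamma>' (hyp_proj e x) < x \<bullet> e"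
    and \<gamma>': "Ck_on 2 UNIV \<gamma>'" using epigraph_chartE[OF c'] by metis
  have near: "\<forall>\<^sub>F t in at_right 0. ?q t + \<delta> (?q t) *\<^sub>R e \<in> ball y \<rho>"
    if "\<rho> > 0" and \<delta>: "Ck_on 2 UNIV \<delta>" "\<delta> (hyp_proj e y) = y \<bullet> e" for \<rho> \<delta>
  proof (rule topological_tendstoD)
    have "isCont \<delta> (hyp_proj e y)"
      using Ck_on_continuous[OF \<delta>(1)] by (simp add: continuous_on_eq_continuous_at)
    then have "((\<lambda>t. \<delta> (?q t)) \<longlongrightarrow> \<delta> (hyp_proj e y)) (at_right 0)"
      by (rule isCont_tendsto_compose) (auto intro!: tendsto_eq_intros)
    then have "((\<lambda>t. ?q t + \<delta> (?q t) *\<^sub>R e) \<longlongrightarrow> hyp_proj e y + 0 *\<^sub>R w + \<delta> (hyp_proj e y) *\<^sub>R e) (at_right 0)"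
      by (intro tendsto_intros)
    moreover have "hyp_proj e y + 0 *\<^sub>R w + \<delta> (hyp_proj e y) *\<^sub>R e = y"
      unfolding \<delta>(2) by (simp add: hyp_proj_def)
    ultimately show "((\<lambda>t. ?q t + \<delta> (?q t) *\<^sub>R e) \<longlongrightarrow> y) (at_right 0)" by simp
  qed (use that in auto)
  note b = epigraph_chart_boundary[OF \<Omega> c] epigraph_chart_boundary[OF \<Omega> c']
  have q: "?q t \<bullet> e = 0" for t using w e by (simp add: inner_simps hyp_proj_inner)
  show ?thesis
    using near[OF r(1) \<gamma> b(1)] near[OF r'(1) \<gamma> b(1)] near[OF r(1) \<gamma>' b(2)] near[OF r'(1) \<gamma>' b(2)]
  proof eventually_elim
    case (elim t)
    show ?case
      using chart_le_chart[OF e q r(2) r'(2) elim(1,2)] chart_le_chart[OF e q r'(2) r(2) elim(4,3)]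
      by simp
  qed
qed

text \<open>Both charts have the same normal, and their graphs agree along rays from the projection
  of y. So their second difference quotients agree for small t, and the sums of curvatures are the
  limits of these.\<close>

lemma principal_curvatures_sum_unique:
  fixes \<Omega> :: "'a::euclidean_space set"
  assumes \<Omega>: "open \<Omega>" "y \<in> frontier \<Omega>"
    and \<kappa>: "principal_curvatures \<Omega> y \<kappa>" and \<kappa>': "principal_curvatures \<Omega> y \<kappa>'"
  shows "(\<Sum>i < DIM('a) - 1. \<kappa> i) = (\<Sum>i < DIM('a) - 1. \<kappa>' i)"
proof -
  obtain e \<gamma> v where c: "tangent_chart \<Omega> y e \<gamma>" "principal_frame (hyp_proj e y) e \<gamma> v \<kappa>"
    using \<kappa> by (auto simp: principal_curvatures_iff)
  obtain e' \<gamma>' v' where c': "tangent_chart \<Omega> y e' \<gamma>'" "principal_frame (hyp_proj e' y) e' \<gamma>' v' \<kappa>'"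
    using \<kappa>' by (auto simp: principal_curvatures_iff)
  have n: "norm e = 1" "norm e' = 1" and \<gamma>: "Ck_on 2 UNIV \<gamma>" "Ck_on 2 UNIV \<gamma>'"
    using c(1) c'(1) by (auto simp: tangent_chart_def epigraph_chart_def)
  have ee: "e' = e"
    by (rule normal_unique[OF \<Omega> c(1) n(2) tangent_chart_ray(1)[OF \<Omega> c'(1)]])
  let ?S = "\<lambda>\<gamma> t. \<Sum>b\<in>Basis. second_diff \<gamma> (hyp_proj e y) (hyp_proj e b) t"
  have lim: "(?S \<gamma> \<longlongrightarrow> (\<Sum>i < DIM('a) - 1. \<kappa> i)) (at_right 0)"
    by (rule hessian_trace_limit[OF n(1) \<gamma>(1) c(2)])
  have lim': "(?S \<gamma>' \<longlongrightarrow> (\<Sum>i < DIM('a) - 1. \<kappa>' i)) (at_right 0)"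
    using hessian_trace_limit[OF n(2) \<gamma>(2) c'(2)] by (simp add: ee)
  have ch: "epigraph_chart \<Omega> y e \<gamma>" "epigraph_chart \<Omega> y e \<gamma>'"
    using c c' by (auto simp: tangent_chart_def ee)
  have 0: "\<gamma> (hyp_proj e y) = \<gamma>' (hyp_proj e y)"
    using epigraph_chart_boundary[OF \<Omega> ch(1)] epigraph_chart_boundary[OF \<Omega> ch(2)] by simp
  have "\<forall>\<^sub>F t in at_right 0. second_diff \<gamma> (hyp_proj e y) (hyp_proj e b) t = second_diff \<gamma>' (hyp_proj e y) (hyp_proj e b) t" for b
  proof -
    \<comment> \<open>Agreement of germs is one-sided in t, while a second difference looks both
      ways; hence the opposite direction as well.\<close>
    have w: "hyp_proj e b \<bullet> e = 0" "(- hyp_proj e b) \<bullet> e = 0"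
      using hyp_proj_inner[OF n(1), of b] by simp_all
    show ?thesis
      using chart_germ_unique[OF \<Omega> ch w(1)] chart_germ_unique[OF \<Omega> ch w(2)]
      by eventually_elim (simp add: second_diff_def 0)
  qed
  then have "\<forall>\<^sub>F t in at_right 0. \<forall>b\<in>Basis. second_diff \<gamma> (hyp_proj e y) (hyp_proj e b) t = second_diff \<gamma>' (hyp_proj e y) (hyp_proj e b) t"
    by (intro eventually_ball_finite) auto
  then have "\<forall>\<^sub>F t in at_right 0. ?S \<gamma> t = ?S \<gamma>' t"
    by eventually_elim simp
  then have "(?S \<gamma>' \<longlongrightarrow> (\<Sum>i < DIM('a) - 1. \<kappa> i)) (at_right 0)"
    using lim by (rule Lim_transform_eventually[rotated])
  then show ?thesis using lim' tendsto_unique trivial_limit_at_right_real by blast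
qed

text \<open>Uniqueness of the sum makes the definite description in \<open>mean_curvature\<close>
  denote.\<close>

lemma mean_curvature_eq:
  fixes \<Omega> :: "'a::euclidean_space set"
  assumes "open \<Omega>" "y \<in> frontier \<Omega>" "principal_curvatures \<Omega> y \<kappa>"
  shows "mean_curvature \<Omega> y = (\<Sum>i < DIM('a) - 1. \<kappa> i) / (real DIM('a) - 1)"
  unfolding mean_curvature_def
  using assms principal_curvatures_sum_unique[OF assms(1,2)]
  by (intro the_equality) (blast, metis)

section \<open>Existence of principal curvatures\<close>

text \<open>By the mean value theorem used twice, the mixed second difference over the parallelogram
  spanned by t a and t b is t^2 times a mixed derivative at an intermediate point. It is unchanged
  when a and b are exchanged; small t then compares the two mixed derivatives at p.\<close>

lemma hessian_symmetric:
  assumes f: "Ck_on 2 UNIV f"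
  shows "dir_deriv w (dir_deriv u f) p = dir_deriv u (dir_deriv w f) p"
proof -
  have f2: "Ck_on (Suc (Suc 0)) UNIV f" using f by (simp only: numeral_2_eq_2)
  have d1: "f differentiable (at x)" for x using f2 by simp
  have d2: "dir_deriv v f differentiable (at x)" for v x
    using Ck_on_dir_deriv[OF open_UNIV f2, of v] by simp
  have mixed: "\<exists>s1 s2. 0 < s1 \<and> s1 < t \<and> 0 < s2 \<and> s2 < t \<and>
      f (p + t *\<^sub>R a + t *\<^sub>R b) - f (p + t *\<^sub>R a) - f (p + t *\<^sub>R b) + f p
        = t * (t * dir_deriv b (dir_deriv a f) (p + s1 *\<^sub>R a + s2 *\<^sub>R b))"
    if t: "0 < t" for t a b
  proof -
    define g where "g s = f (p + t *\<^sub>R b + s *\<^sub>R a) - f (p + s *\<^sub>R a)" for s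
    have "(g has_real_derivative dir_deriv a f (p + t *\<^sub>R b + s *\<^sub>R a) - dir_deriv a f (p + s *\<^sub>R a)) (at s)" for s
      unfolding g_def by (intro DERIV_diff line_has_real_derivative d1)
    then obtain s1 where s1: "0 < s1" "s1 < t"
      "g t - g 0 = (t - 0) * (dir_deriv a f (p + t *\<^sub>R b + s1 *\<^sub>R a) - dir_deriv a f (p + s1 *\<^sub>R a))"
      using MVT2[OF t, of g "\<lambda>s. dir_deriv a f (p + t *\<^sub>R b + s *\<^sub>R a) - dir_deriv a f (p + s *\<^sub>R a)"] by blast
    define h where "h s = dir_deriv a f (p + s1 *\<^sub>R a + s *\<^sub>R b)" for s
    have "(h has_real_derivative dir_deriv b (dir_deriv a f) (p + s1 *\<^sub>R a + s *\<^sub>R b)) (at s)" for s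
      unfolding h_def by (intro line_has_real_derivative d2)
    then obtain s2 where s2: "0 < s2" "s2 < t"
      "h t - h 0 = (t - 0) * dir_deriv b (dir_deriv a f) (p + s1 *\<^sub>R a + s2 *\<^sub>R b)"
      using MVT2[OF t, of h "\<lambda>s. dir_deriv b (dir_deriv a f) (p + s1 *\<^sub>R a + s *\<^sub>R b)"] by blast
    have "g t - g 0 = t * (h t - h 0)" using s1(3) by (simp add: h_def add.commute add.left_commute)
    moreover have "g t - g 0 = f (p + t *\<^sub>R a + t *\<^sub>R b) - f (p + t *\<^sub>R a) - f (p + t *\<^sub>R b) + f p"
      by (simp add: g_def add.commute add.left_commute)
    ultimately show ?thesis using s1 s2 by (intro exI[of _ s1] exI[of _ s2]) simp
  qed
  have cont: "continuous_on UNIV (dir_deriv b (dir_deriv a f))" for a b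
    using Ck_on_continuous[OF Ck_on_dir_deriv[OF open_UNIV Ck_on_dir_deriv[OF open_UNIV f2]]] .
  have near: "\<exists>\<delta>>0. \<forall>s1 s2. 0 < s1 \<longrightarrow> s1 < \<delta> \<longrightarrow> 0 < s2 \<longrightarrow> s2 < \<delta> \<longrightarrow>
      \<bar>dir_deriv b (dir_deriv a f) (p + s1 *\<^sub>R a + s2 *\<^sub>R b) - dir_deriv b (dir_deriv a f) p\<bar> < \<epsilon>"
    if \<epsilon>: "\<epsilon> > 0" for \<epsilon> a b
  proof -
    have "isCont (dir_deriv b (dir_deriv a f)) p" using cont by (simp add: continuous_on_eq_continuous_at)
    then obtain \<delta> where \<delta>: "\<delta> > 0"
      "\<And>x. dist x p < \<delta> \<Longrightarrow> dist (dir_deriv b (dir_deriv a f) x) (dir_deriv b (dir_deriv a f) p) < \<epsilon>"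
      using \<epsilon> unfolding continuous_at_eps_delta by blast
    define N where "N = norm a + norm b + 1"
    have N: "N > 0" by (simp add: N_def add_nonneg_pos)
    show ?thesis
    proof (intro exI[of _ "\<delta> / N"] conjI allI impI)
      show "\<delta> / N > 0" using \<delta> N by simp
      fix s1 s2 :: real assume s: "0 < s1" "s1 < \<delta> / N" "0 < s2" "s2 < \<delta> / N"
      have "norm (s1 *\<^sub>R a + s2 *\<^sub>R b) \<le> s1 * norm a + s2 * norm b"
        using s norm_triangle_ineq[of "s1 *\<^sub>R a" "s2 *\<^sub>R b"] by simp
      also have "\<dots> \<le> \<delta> / N * norm a + \<delta> / N * norm b"
        using s by (intro add_mono mult_right_mono) auto
      also have "\<dots> = \<delta> / N * (norm a + norm b)" by (simp only: distrib_left)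
      also have "\<dots> < \<delta> / N * N"
        using \<delta> N by (intro mult_strict_left_mono) (simp_all add: N_def)
      finally have "dist (p + s1 *\<^sub>R a + s2 *\<^sub>R b) p < \<delta>"
        using N by (simp add: dist_norm add.assoc)
      then show "\<bar>dir_deriv b (dir_deriv a f) (p + s1 *\<^sub>R a + s2 *\<^sub>R b) - dir_deriv b (dir_deriv a f) p\<bar> < \<epsilon>"
        using \<delta>(2) by (simp add: dist_real_def)
    qed
  qed
  have "\<bar>dir_deriv w (dir_deriv u f) p - dir_deriv u (dir_deriv w f) p\<bar> \<le> 0 + \<epsilon>" if \<epsilon>: "\<epsilon> > 0" for \<epsilon>
  proof -
    obtain \<delta> where \<delta>: "\<delta> > 0" "\<And>s1 s2. 0 < s1 \<Longrightarrow> s1 < \<delta> \<Longrightarrow> 0 < s2 \<Longrightarrow> s2 < \<delta> \<Longrightarrow>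
      \<bar>dir_deriv w (dir_deriv u f) (p + s1 *\<^sub>R u + s2 *\<^sub>R w) - dir_deriv w (dir_deriv u f) p\<bar> < \<epsilon> / 2"
      using near[of "\<epsilon> / 2" w u] \<epsilon> by auto
    obtain \<delta>' where \<delta>': "\<delta>' > 0" "\<And>s1 s2. 0 < s1 \<Longrightarrow> s1 < \<delta>' \<Longrightarrow> 0 < s2 \<Longrightarrow> s2 < \<delta>' \<Longrightarrow>
      \<bar>dir_deriv u (dir_deriv w f) (p + s1 *\<^sub>R w + s2 *\<^sub>R u) - dir_deriv u (dir_deriv w f) p\<bar> < \<epsilon> / 2"
      using near[of "\<epsilon> / 2" u w] \<epsilon> by auto
    define t where "t = min \<delta> \<delta>'"
    have t: "0 < t" "t \<le> \<delta>" "t \<le> \<delta>'" using \<delta> \<delta>' by (auto simp: t_def)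
    obtain s1 s2 where s: "0 < s1" "s1 < t" "0 < s2" "s2 < t"
      "f (p + t *\<^sub>R u + t *\<^sub>R w) - f (p + t *\<^sub>R u) - f (p + t *\<^sub>R w) + f p
        = t * (t * dir_deriv w (dir_deriv u f) (p + s1 *\<^sub>R u + s2 *\<^sub>R w))"
      using mixed[OF t(1), of u w] by blast
    obtain s1' s2' where s': "0 < s1'" "s1' < t" "0 < s2'" "s2' < t"
      "f (p + t *\<^sub>R w + t *\<^sub>R u) - f (p + t *\<^sub>R w) - f (p + t *\<^sub>R u) + f p
        = t * (t * dir_deriv u (dir_deriv w f) (p + s1' *\<^sub>R w + s2' *\<^sub>R u))"
      using mixed[OF t(1), of w u] by blast
    have sw: "p + t *\<^sub>R w + t *\<^sub>R u = p + t *\<^sub>R u + t *\<^sub>R w" by (simp add: algebra_simps)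
    have "t * (t * dir_deriv w (dir_deriv u f) (p + s1 *\<^sub>R u + s2 *\<^sub>R w))
        = t * (t * dir_deriv u (dir_deriv w f) (p + s1' *\<^sub>R w + s2' *\<^sub>R u))"
      using s(5) s'(5)[unfolded sw] by linarith
    then have "dir_deriv w (dir_deriv u f) (p + s1 *\<^sub>R u + s2 *\<^sub>R w)
        = dir_deriv u (dir_deriv w f) (p + s1' *\<^sub>R w + s2' *\<^sub>R u)"
      using t by simp
    then show ?thesis
      using \<delta>(2)[of s1 s2] \<delta>'(2)[of s1' s2'] s s' t by linarith
  qed
  then have "\<bar>dir_deriv w (dir_deriv u f) p - dir_deriv u (dir_deriv w f) p\<bar> \<le> 0"
    by (rule field_le_epsilon)
  then show ?thesis by simp
qed

section \<open>Spectral theorem for the Hessian\<close>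

lemma bilinear_hessian:
  assumes f: "Ck_on 2 UNIV f"
  shows "bilinear (\<lambda>u w. dir_deriv w (dir_deriv u f) p)"
proof -
  have f2: "Ck_on (Suc (Suc 0)) UNIV f" using f by (simp only: numeral_2_eq_2)
  have d2: "dir_deriv v f differentiable (at x)" for v x
    using Ck_on_dir_deriv[OF open_UNIV f2, of v] by simp
  have "linear (\<lambda>w. dir_deriv w (dir_deriv u f) p)" for u
    by (rule linear_dir_deriv[OF d2])
  \<comment> \<open>Linearity in the inner direction follows from linearity in the outer one by
    symmetry.\<close>
  then show ?thesis unfolding bilinear_def using hessian_symmetric[OF f] by auto
qed

text \<open>Maximise the quadratic form over the unit sphere of S. With \<kappa> the maximum,
  \<kappa> times the inner product minus B is positive semidefinite on S and vanishes at the
  maximiser u, which forces it to vanish when only one argument is u.\<close>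

lemma quadratic_form_max_eigenvector:
  fixes B :: "'a::euclidean_space \<Rightarrow> 'a \<Rightarrow> real"
  assumes B: "bilinear B" and sym: "\<And>u w. B u w = B w u"
    and S: "subspace S" and ne: "S \<noteq> {0}"
  obtains u \<kappa> where "u \<in> S" "norm u = 1" "\<And>w. w \<in> S \<Longrightarrow> B u w = \<kappa> * (u \<bullet> w)"
proof -
  let ?C = "S \<inter> sphere 0 1"
  have "compact ?C" using S by (intro closed_Int_compact closed_subspace) auto
  moreover obtain a where a: "a \<in> S" "a \<noteq> 0" using ne S subspace_0 by blast
  then have "(1 / norm a) *\<^sub>R a \<in> ?C" using S by (simp add: subspace_scale)
  then have "?C \<noteq> {}" by blast
  moreover have "continuous_on ?C (\<lambda>x. B x x)"
    by (rule bilinear_continuous_on_compose[OF continuous_on_id continuous_on_id B])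
  ultimately obtain u where u: "u \<in> ?C" "\<And>x. x \<in> ?C \<Longrightarrow> B x x \<le> B u u"
    using continuous_attains_sup[of ?C "\<lambda>x. B x x"] by blast
  have un: "norm u = 1" "u \<in> S" using u by auto
  define \<kappa> where "\<kappa> = B u u"
  define C where "C x y = \<kappa> * (x \<bullet> y) - B x y" for x y
  have Cadd: "C (x + t *\<^sub>R z) (x + t *\<^sub>R z) = C x x + 2 * t * C x z + t * t * C z z" for x z t
  proof -
    have "B (x + t *\<^sub>R z) (x + t *\<^sub>R z) = B x x + t * B x z + t * B z x + t * (t * B z z)"
      by (simp add: bilinear_ladd[OF B] bilinear_radd[OF B] bilinear_lmul[OF B] bilinear_rmul[OF B] algebra_simps)
    moreover have "(x + t *\<^sub>R z) \<bullet> (x + t *\<^sub>R z) = x \<bullet> x + t * (x \<bullet> z) + t * (x \<bullet> z) + t * (t * (z \<bullet> z))"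
      by (simp add: inner_simps inner_commute[of z x] algebra_simps)
    ultimately show ?thesis
      unfolding C_def sym[of z x] by (simp add: algebra_simps)
  qed
  have Cnn: "0 \<le> C x x" if "x \<in> S" for x
  proof (cases "x = 0")
    case True
    then show ?thesis using bilinear_lzero[OF B] by (simp add: C_def)
  next
    case False
    have "(1 / norm x) *\<^sub>R x \<in> ?C" using S that False by (simp add: subspace_scale)
    then have "B ((1 / norm x) *\<^sub>R x) ((1 / norm x) *\<^sub>R x) \<le> \<kappa>" using u(2) unfolding \<kappa>_def by blast
    then have "B x x \<le> \<kappa> * (norm x * norm x)"
      using False by (simp add: bilinear_lmul[OF B] bilinear_rmul[OF B] field_simps)
    then show ?thesis by (simp add: C_def power2_norm_eq_inner[symmetric] power2_eq_square)
  qed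
  have Cu: "C u u = 0" using un by (simp add: C_def \<kappa>_def norm_eq_1)
  have "C u w = 0" if w: "w \<in> S" for w
  proof -
    define c d where "c = C u w" and "d = C w w"
    have d: "0 \<le> d" using Cnn[OF w] by (simp add: d_def)
    \<comment> \<open>Up to the summand 1, which avoids a vanishing denominator, this minimises 2 t
      c + t^2 d. The value becomes - t^2 (d + 2), which is nonnegative only for t = 0.\<close>
    define t where "t = - c / (d + 1)"
    have "d + 1 \<noteq> 0" using d by linarith
    then have ct: "c = - (t * (d + 1))" by (simp add: t_def)
    have "u + t *\<^sub>R w \<in> S" using S un w by (simp add: subspace_add subspace_scale)
    then have "0 \<le> 2 * t * c + t * t * d"
      using Cnn[of "u + t *\<^sub>R w"] Cadd[of u t w] Cu by (simp add: c_def d_def)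
    also have "\<dots> = - (t\<^sup>2 * (d + 2))"
      unfolding ct by (simp add: power2_eq_square algebra_simps)
    finally have "t\<^sup>2 * (d + 2) \<le> 0" by simp
    moreover have "0 < d + 2" using d by simp
    ultimately have "t\<^sup>2 \<le> 0" by (simp add: mult_le_0_iff not_le)
    then have "c = 0" using ct by simp
    then show ?thesis by (simp add: c_def)
  qed
  then show thesis using that[of u \<kappa>] un by (simp add: C_def)
qed

text \<open>Induction on the dimension: split off an eigenvector u and continue on its orthogonal
  complement in S. The eigenvalue equations found there extend to S because B (v i) u = B u (v i) is
  a multiple of the inner product of u and \<open>v i\<close>, which is 0.\<close>

lemma symmetric_bilinear_diagonalization:
  fixes B :: "'a::euclidean_space \<Rightarrow> 'a \<Rightarrow> real"
  assumes B: "bilinear B" and sym: "\<And>u w. B u w = B w u"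
  shows "subspace S \<Longrightarrow> dim S = k \<Longrightarrow> \<exists>v \<kappa>. (\<forall>i<k. v i \<in> S) \<and>
    (\<forall>i<k. \<forall>j<k. v i \<bullet> v j = (if i = j then 1 else 0)) \<and>
    (\<forall>i<k. \<forall>w\<in>S. B (v i) w = \<kappa> i * (v i \<bullet> w))"
proof (induction k arbitrary: S)
  case (Suc k)
  have "S \<noteq> {0}" using Suc.prems(2) by auto
  then obtain u l where u: "u \<in> S" "norm u = 1" and eig: "\<And>w. w \<in> S \<Longrightarrow> B u w = l * (u \<bullet> w)"
    using quadratic_form_max_eigenvector[OF B sym Suc.prems(1)] by blast
  define T where "T = {w \<in> S. u \<bullet> w = 0}"
  have T: "subspace T" using Suc.prems(1) unfolding T_def subspace_def by (auto simp: inner_simps)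
  have uu: "u \<bullet> u = 1" using u by (simp add: norm_eq_1)
  have "span {u} \<subseteq> S" using u Suc.prems(1) by (simp add: span_minimal)
  then have "dim {y \<in> S. \<forall>x\<in>span {u}. orthogonal x y} + dim (span {u}) = dim S"
    using Suc.prems(1) by (intro dim_subspace_orthogonal_to_vectors) auto
  moreover have "{y \<in> S. \<forall>x\<in>span {u}. orthogonal x y} = T"
    unfolding T_def by (auto simp: span_singleton orthogonal_def)
  moreover have "dim (span {u}) = 1" using u(2) by (auto simp: dim_span)
  ultimately have "dim T = k" using Suc.prems(2) by simp
  then obtain v \<kappa> where v: "\<And>i. i < k \<Longrightarrow> v i \<in> T"
    "\<And>i j. i < k \<Longrightarrow> j < k \<Longrightarrow> v i \<bullet> v j = (if i = j then 1 else 0)"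
    "\<And>i w. i < k \<Longrightarrow> w \<in> T \<Longrightarrow> B (v i) w = \<kappa> i * (v i \<bullet> w)"
    using Suc.IH[OF T] by blast
  have uv: "u \<bullet> v i = 0" "v i \<bullet> u = 0" "v i \<in> S" if "i < k" for i
    using v(1)[OF that] by (auto simp: T_def inner_commute)
  have ext: "B (v i) w = \<kappa> i * (v i \<bullet> w)" if i: "i < k" and w: "w \<in> S" for i w
  proof -
    define w' where "w' = w - (u \<bullet> w) *\<^sub>R u"
    have "w' \<in> T" using w u uu Suc.prems(1)
      by (simp add: T_def w'_def inner_simps subspace_diff subspace_scale)
    then have 1: "B (v i) w' = \<kappa> i * (v i \<bullet> w')" using v(3) i by blast
    have "B (v i) u = 0" using eig[OF uv(3)[OF i]] uv(1)[OF i] sym[of u] by simp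
    then have "B (v i) (w' + (u \<bullet> w) *\<^sub>R u) = B (v i) w'"
      by (simp add: bilinear_radd[OF B] bilinear_rmul[OF B])
    moreover have "v i \<bullet> w' = v i \<bullet> w" using uv(2)[OF i] by (simp add: w'_def inner_simps)
    ultimately show ?thesis using 1 by (simp add: w'_def)
  qed
  show ?case
    by (rule exI[of _ "v(k := u)"], rule exI[of _ "\<kappa>(k := l)"])
      (use u uu uv v ext eig in \<open>auto simp: less_Suc_eq\<close>)
qed auto

lemma principal_frame_exists:
  fixes e :: "'a::euclidean_space"
  assumes \<gamma>: "Ck_on 2 UNIV \<gamma>" and e: "norm e = 1"
  obtains v \<kappa> where "principal_frame p e \<gamma> v \<kappa>"
proof -
  let ?S = "{w. e \<bullet> w = 0}"
  have "e \<noteq> 0" using e by auto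
  then have "dim ?S = DIM('a) - 1" by (rule dim_hyperplane)
  then obtain v \<kappa> where "(\<forall>i < DIM('a) - 1. v i \<in> ?S) \<and>
    (\<forall>i < DIM('a) - 1. \<forall>j < DIM('a) - 1. v i \<bullet> v j = (if i = j then 1 else 0)) \<and>
    (\<forall>i < DIM('a) - 1. \<forall>w\<in>?S. dir_deriv w (dir_deriv (v i) \<gamma>) p = \<kappa> i * (v i \<bullet> w))"
    using symmetric_bilinear_diagonalization[OF bilinear_hessian[OF \<gamma>, of p] hessian_symmetric[OF \<gamma>] subspace_hyperplane]
    by blast
  then show thesis by (intro that) (auto simp: principal_frame_def inner_commute)
qed

section \<open>The boundary as a graph over its tangent hyperplane\<close>

lemma Ck_on_compose_linear:
  "linear L \<Longrightarrow> Ck_on k UNIV f \<Longrightarrow> Ck_on k UNIV (\<lambda>x. f (L x))"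
proof (induction k arbitrary: f)
  case 0
  then show ?case
    using linear_continuous_on[OF linear_conv_bounded_linear[THEN iffD1, OF \<open>linear L\<close>]]
    by (auto intro: continuous_on_compose2)
next
  case (Suc k)
  show ?case
  proof (rule Ck_on_SucI[where f' = "\<lambda>v x. dir_deriv (L v) f (L x)"])
    show "((\<lambda>x. f (L x)) has_derivative (\<lambda>v. dir_deriv (L v) f (L x))) (at x)" for x
      by (rule has_derivative_compose[OF linear_imp_has_derivative[OF \<open>linear L\<close>]
            Ck_on_has_derivative[OF Suc.prems(2)]]) simp
    show "Ck_on k UNIV (\<lambda>x. dir_deriv (L b) f (L x))" for b
      using Suc by (intro Suc.IH Ck_on_dir_deriv) auto
  qed simp
qed

lemma graph_has_derivative:
  assumes f: "f differentiable (at (hyp_proj e x + \<gamma> x *\<^sub>R e))" and \<gamma>: "\<gamma> differentiable (at x)"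
  shows "((\<lambda>x. f (hyp_proj e x + \<gamma> x *\<^sub>R e)) has_derivative
    (\<lambda>v. dir_deriv (hyp_proj e v) f (hyp_proj e x + \<gamma> x *\<^sub>R e)
       + dir_deriv v \<gamma> x * dir_deriv e f (hyp_proj e x + \<gamma> x *\<^sub>R e))) (at x)"
proof -
  let ?z = "hyp_proj e x + \<gamma> x *\<^sub>R e"
  have "((\<lambda>x. hyp_proj e x + \<gamma> x *\<^sub>R e) has_derivative (\<lambda>v. hyp_proj e v + dir_deriv v \<gamma> x *\<^sub>R e)) (at x)"
    by (intro has_derivative_add linear_imp_has_derivative linear_hyp_proj has_derivative_scaleR_left
        dir_deriv_has_derivative \<gamma>)
  then have "((\<lambda>x. f (hyp_proj e x + \<gamma> x *\<^sub>R e)) has_derivative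
      (\<lambda>v. dir_deriv (hyp_proj e v + dir_deriv v \<gamma> x *\<^sub>R e) f ?z)) (at x)"
    by (rule has_derivative_compose) (rule dir_deriv_has_derivative[OF f])
  then show ?thesis
    by (simp add: linear_add[OF linear_dir_deriv[OF f]] linear_scale[OF linear_dir_deriv[OF f]])
qed

lemma Ck_on_graph_compose:
  "open S \<Longrightarrow> Ck_on k UNIV f \<Longrightarrow> Ck_on k S \<gamma> \<Longrightarrow> Ck_on k S (\<lambda>x. f (hyp_proj e x + \<gamma> x *\<^sub>R e))"
proof (induction k arbitrary: f)
  case 0
  have "continuous_on S (hyp_proj e)"
    by (intro linear_continuous_on linear_conv_bounded_linear[THEN iffD1] linear_hyp_proj)
  with 0 have "continuous_on S (\<lambda>x. hyp_proj e x + \<gamma> x *\<^sub>R e)" by (auto intro!: continuous_intros)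
  with 0 show ?case by (auto intro: continuous_on_compose2)
next
  case (Suc k)
  have \<gamma>: "Ck_on k S \<gamma>" using Suc.prems(3) Ck_on_SucD by blast
  show ?case
  proof (rule Ck_on_SucI[where f' = "\<lambda>v x. dir_deriv (hyp_proj e v) f (hyp_proj e x + \<gamma> x *\<^sub>R e)
       + dir_deriv v \<gamma> x * dir_deriv e f (hyp_proj e x + \<gamma> x *\<^sub>R e)"])
    fix b :: 'a assume b: "b \<in> Basis"
    have "Ck_on k S (dir_deriv b \<gamma>)" using Suc.prems b by simp
    then show "Ck_on k S (\<lambda>x. dir_deriv (hyp_proj e b) f (hyp_proj e x + \<gamma> x *\<^sub>R e)
       + dir_deriv b \<gamma> x * dir_deriv e f (hyp_proj e x + \<gamma> x *\<^sub>R e))"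
      using Suc.prems \<gamma> by (intro Ck_on_add Ck_on_mult Suc.IH Ck_on_dir_deriv) auto
  qed (use Suc.prems in \<open>auto intro!: graph_has_derivative\<close>)
qed

text \<open>The inverse function theorem for x -> P x + F x e, with P the projection along e: the
  preimage of a point of the hyperplane near P y is a zero of F on the line above it. \<gamma> is
  made constant along e, so that it is defined on an open subset of the whole space.\<close>

lemma implicit_graph:
  fixes F :: "'a::euclidean_space \<Rightarrow> real"
  assumes F: "Ck_on 2 UNIV F" and e: "norm e = 1" and Fy: "F y = 0"
    and De: "0 < dir_deriv e F y" and Dw: "\<And>w. w \<bullet> e = 0 \<Longrightarrow> dir_deriv w F y = 0"
  obtains S \<gamma> where "open S" "hyp_proj e y \<in> S" "y \<in> S" "Ck_on 2 S \<gamma>"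
    "\<And>x. \<gamma> x = \<gamma> (hyp_proj e x)" "\<And>x. x \<in> S \<longleftrightarrow> hyp_proj e x \<in> S"
    "\<And>x. x \<in> S \<Longrightarrow> F (hyp_proj e x + \<gamma> x *\<^sub>R e) = 0" "\<gamma> y = y \<bullet> e"
    "\<And>w. w \<bullet> e = 0 \<Longrightarrow> dir_deriv w \<gamma> (hyp_proj e y) = 0"
proof -
  have F2: "Ck_on (Suc (Suc 0)) UNIV F" using F by (simp only: numeral_2_eq_2)
  have d: "F differentiable (at x)" for x using F2 by simp
  let ?P = "hyp_proj e" and ?c = "dir_deriv e F y"
  have bP: "bounded_linear ?P" using linear_hyp_proj linear_conv_bounded_linear by blast
  have ee: "e \<bullet> e = 1" using e by (simp add: norm_eq_1)
  have Pe: "?P x \<bullet> e = 0" "?P (?P x) = ?P x" "?P e = 0" for x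
    using hyp_proj_inner[OF e] hyp_proj_orthogonal hyp_proj_self[OF e] by auto
  have Padd: "?P (a + b) = ?P a + ?P b" "?P (t *\<^sub>R a) = t *\<^sub>R ?P a" for a b t
    using linear_add[OF linear_hyp_proj] linear_scale[OF linear_hyp_proj] by auto
  have split: "x = ?P x + (x \<bullet> e) *\<^sub>R e" for x by (simp add: hyp_proj_def)
  define f where "f x = ?P x + F x *\<^sub>R e" for x
  define f' where "f' x = Blinfun (\<lambda>h. ?P h + dir_deriv h F x *\<^sub>R e)" for x
  have bl: "bounded_linear (\<lambda>h. ?P h + dir_deriv h F x *\<^sub>R e)" for x
    using has_derivative_bounded_linear[OF dir_deriv_has_derivative[OF d[of x]]]
    by (intro bounded_linear_add bP bounded_linear_scaleR_const)
  have f': "blinfun_apply (f' x) = (\<lambda>h. ?P h + dir_deriv h F x *\<^sub>R e)" for x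
    by (simp add: f'_def bounded_linear_Blinfun_apply[OF bl])
  have derf: "(f has_derivative blinfun_apply (f' x)) (at x)" for x
    unfolding f' unfolding f_def
    by (intro has_derivative_add bounded_linear_imp_has_derivative bP has_derivative_scaleR_left
        dir_deriv_has_derivative d)
  have contf: "continuous_on UNIV f'"
    unfolding continuous_on_eq_continuous_at[OF open_UNIV]
  proof
    fix x
    have "isCont (dir_deriv i F) x" for i
      using Ck_on_continuous[OF Ck_on_dir_deriv[OF open_UNIV F2]]
      by (simp add: continuous_on_eq_continuous_at)
    then show "isCont f' x"
      by (intro continuous_blinfun_componentwiseI1) (auto simp: f' intro!: continuous_intros)
  qed
  \<comment> \<open>Tangential derivatives of F vanish at y, so the derivative of f there is the
    identity on the hyperplane and multiplication by \<open>?c\<close> along e.\<close>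
  define inv where "inv = Blinfun (\<lambda>k. ?P k + ((k \<bullet> e) / ?c) *\<^sub>R e)"
  have bl': "bounded_linear (\<lambda>k. ?P k + ((k \<bullet> e) / ?c) *\<^sub>R e)"
    unfolding linear_conv_bounded_linear[symmetric]
    by (rule linearI) (simp_all add: Padd inner_simps add_divide_distrib scaleR_add_left algebra_simps)
  have inv: "blinfun_apply inv k = ?P k + ((k \<bullet> e) / ?c) *\<^sub>R e" for k
    by (simp add: inv_def bounded_linear_Blinfun_apply[OF bl'])
  have invf: "inv o\<^sub>L f' y = id_blinfun"
  proof (rule blinfun_eqI)
    fix h
    have "dir_deriv h F y = dir_deriv (?P h + (h \<bullet> e) *\<^sub>R e) F y" using split[of h] by simp
    also have "\<dots> = (h \<bullet> e) * ?c"
      using Dw[OF Pe(1)] linear_add[OF linear_dir_deriv[OF d]] linear_scale[OF linear_dir_deriv[OF d]] by simp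
    finally have "dir_deriv h F y = (h \<bullet> e) * ?c" .
    then have "blinfun_apply (inv o\<^sub>L f' y) h = ?P h + (h \<bullet> e) *\<^sub>R e"
      using De by (simp add: inv f' Padd Pe inner_simps ee)
    then show "blinfun_apply (inv o\<^sub>L f' y) h = blinfun_apply id_blinfun h"
      using split[of h] by simp
  qed
  obtain U V g g' where "open U" "y \<in> U" and V: "open V" "f y \<in> V" and hom: "homeomorphism U V f g"
    and derg: "\<And>x. x \<in> V \<Longrightarrow> (g has_derivative (g' x)) (at x)"
    and bij: "\<And>x. x \<in> V \<Longrightarrow> bij (blinfun_apply (f' (g x)))"
    using inverse_function_theorem[OF open_UNIV derf contf UNIV_I invf] by metis
  have fy: "f y = ?P y" using Fy by (simp add: f_def)
  have gy: "g (?P y) = y" using homeomorphism_apply1[OF hom \<open>y \<in> U\<close>] fy by simp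
  define S where "S = {x. ?P x \<in> V}"
  have S: "open S"
    using open_vimage[OF V(1) linear_continuous_on[OF bP]] by (simp add: S_def vimage_def)
  define \<gamma> where "\<gamma> x = g (?P x) \<bullet> e" for x
  have gz: "g (?P x) = ?P x + \<gamma> x *\<^sub>R e" "F (?P x + \<gamma> x *\<^sub>R e) = 0" if "x \<in> S" for x
  proof -
    have "f (g (?P x)) = ?P x" using homeomorphism_apply2[OF hom, of "?P x"] that by (simp add: S_def)
    then have *: "?P (g (?P x)) + F (g (?P x)) *\<^sub>R e = ?P x" by (simp add: f_def)
    then have "(?P (g (?P x)) + F (g (?P x)) *\<^sub>R e) \<bullet> e = ?P x \<bullet> e" by simp
    then have "F (g (?P x)) = 0" by (simp add: inner_simps Pe ee)
    moreover from this * have "?P (g (?P x)) = ?P x" by simp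
    then show "g (?P x) = ?P x + \<gamma> x *\<^sub>R e" using split[of "g (?P x)"] by (simp add: \<gamma>_def)
    ultimately show "F (?P x + \<gamma> x *\<^sub>R e) = 0" by simp
  qed
  \<comment> \<open>The derivative of f maps e to this number times e. Bijectivity on all of V
    therefore carries its nonvanishing from y to the whole graph.\<close>
  have ne: "dir_deriv e F (?P x + \<gamma> x *\<^sub>R e) \<noteq> 0" if "x \<in> S" for x
  proof
    assume 0: "dir_deriv e F (?P x + \<gamma> x *\<^sub>R e) = 0"
    have inj: "inj (blinfun_apply (f' (g (?P x))))" using bij[of "?P x"] that by (simp add: S_def bij_def)
    have "blinfun_apply (f' (g (?P x))) e = blinfun_apply (f' (g (?P x))) 0"
      using 0 gz(1)[OF that] by (simp add: f' Pe linear_0[OF linear_hyp_proj] linear_0[OF linear_dir_deriv[OF d]])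
    from injD[OF inj this] have "e = 0" .
    then show False using e by simp
  qed
  have d\<gamma>: "\<gamma> differentiable (at x)" if "x \<in> S" for x
  proof -
    have "(g has_derivative g' (?P x)) (at (?P x))" using derg that by (simp add: S_def)
    then have "((\<lambda>x. g (?P x)) has_derivative (\<lambda>h. g' (?P x) (?P h))) (at x)"
      by (rule has_derivative_compose[OF bounded_linear_imp_has_derivative[OF bP]])
    then have "(\<gamma> has_derivative (\<lambda>h. g' (?P x) (?P h) \<bullet> e)) (at x)"
      unfolding \<gamma>_def by (rule has_derivative_inner_left)
    then show ?thesis by (auto simp: differentiable_def)
  qed
  let ?\<gamma>' = "\<lambda>v x. (-1) * (dir_deriv (?P v) F (?P x + \<gamma> x *\<^sub>R e) * inverse (dir_deriv e F (?P x + \<gamma> x *\<^sub>R e)))"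
  have formula: "dir_deriv v \<gamma> x = ?\<gamma>' v x" if x: "x \<in> S" for v x
  proof -
    have "((\<lambda>x. 0) has_derivative (\<lambda>v. dir_deriv (?P v) F (?P x + \<gamma> x *\<^sub>R e)
        + dir_deriv v \<gamma> x * dir_deriv e F (?P x + \<gamma> x *\<^sub>R e))) (at x)"
      by (rule has_derivative_transform_within_open[OF graph_has_derivative[OF d d\<gamma>[OF x]] S x])
        (use gz in auto)
    then have "(\<lambda>v. dir_deriv (?P v) F (?P x + \<gamma> x *\<^sub>R e)
        + dir_deriv v \<gamma> x * dir_deriv e F (?P x + \<gamma> x *\<^sub>R e)) = (\<lambda>v. 0)"
      using has_derivative_unique has_derivative_const by blast
    then have "dir_deriv (?P v) F (?P x + \<gamma> x *\<^sub>R e)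
        + dir_deriv v \<gamma> x * dir_deriv e F (?P x + \<gamma> x *\<^sub>R e) = 0" by meson
    then show ?thesis using ne[OF x] by (simp add: field_simps)
  qed
  \<comment> \<open>Bootstrap: the formula expresses the derivative of \<gamma> through first
    derivatives of F along the graph and hence through \<gamma> itself, so each round gains one
    derivative. The bound on k reflects that F is C^2.\<close>
  have step: "Ck_on (Suc k) S \<gamma>" if "Ck_on k S \<gamma>" "k \<le> 1" for k
  proof (rule Ck_on_SucI[where f' = ?\<gamma>'])
    show "(\<gamma> has_derivative (\<lambda>v. ?\<gamma>' v x)) (at x)" if "x \<in> S" for x
      using dir_deriv_has_derivative[OF d\<gamma>[OF that]] formula[OF that] by simp
    have "Ck_on (Suc k) UNIV F" using F by (rule Ck_on_mono) (use \<open>k \<le> 1\<close> in simp)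
    then have "Ck_on k UNIV (dir_deriv v F)" for v by (intro Ck_on_dir_deriv) auto
    then show "Ck_on k S (\<lambda>x. ?\<gamma>' b x)" for b
      using ne that S by (intro Ck_on_scale Ck_on_mult Ck_on_inverse Ck_on_graph_compose) auto
  qed fact
  have "Ck_on 0 S \<gamma>"
    using d\<gamma> by (auto intro!: continuous_at_imp_continuous_on differentiable_imp_continuous_within)
  then have C2: "Ck_on 2 S \<gamma>" using step[OF step] by (simp add: numeral_2_eq_2 del: Ck_on.simps)
  have yS: "?P y \<in> S" "y \<in> S" using V(2) by (auto simp: S_def fy Pe)
  have g1: "\<gamma> y = y \<bullet> e" by (simp add: \<gamma>_def gy)
  show thesis
  proof (rule that[OF S yS C2])
    show "\<gamma> x = \<gamma> (?P x)" for x by (simp add: \<gamma>_def Pe)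
    show "x \<in> S \<longleftrightarrow> ?P x \<in> S" for x by (simp add: S_def Pe)
    show "F (?P x + \<gamma> x *\<^sub>R e) = 0" if "x \<in> S" for x by (rule gz(2)[OF that])
    show "\<gamma> y = y \<bullet> e" by (rule g1)
    show "dir_deriv w \<gamma> (?P y) = 0" if w: "w \<bullet> e = 0" for w
    proof -
      have "?P (?P y) + \<gamma> (?P y) *\<^sub>R e = y"
        using gz(1)[OF yS(1)] by (simp add: Pe gy)
      then show ?thesis using formula[OF yS(1), of w] Dw[OF w] w by (simp add: hyp_proj_orthogonal)
    qed
  qed
qed

text \<open>Near y the function F increases strictly along e, so its sign tells the side of the zero
  graph. The implicit function is only local and is multiplied by a cut-off, because a chart asks
  for a function that is C^2 on the whole space.\<close>

lemma sublevel_is_epigraph: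
  fixes F :: "'a::euclidean_space \<Rightarrow> real"
  assumes F: "Ck_on 2 UNIV F" and e: "norm e = 1" and Fy: "F y = 0"
    and De: "0 < dir_deriv e F y" and Dw: "\<And>w. w \<bullet> e = 0 \<Longrightarrow> dir_deriv w F y = 0"
  obtains \<gamma> r where "Ck_on 2 UNIV \<gamma>" "0 < r" "\<And>x. x \<in> ball y r \<Longrightarrow> 0 < F x \<longleftrightarrow> \<gamma> (hyp_proj e x) < x \<bullet> e"
    "\<And>w. w \<bullet> e = 0 \<Longrightarrow> dir_deriv w \<gamma> (hyp_proj e y) = 0"
proof -
  let ?P = "hyp_proj e"
  obtain S \<delta> where S: "open S" "?P y \<in> S" "y \<in> S" and \<delta>: "Ck_on 2 S \<delta>"
    and \<delta>P: "\<And>x. \<delta> x = \<delta> (?P x)" and SP: "\<And>x. x \<in> S \<longleftrightarrow> ?P x \<in> S"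
    and root: "\<And>x. x \<in> S \<Longrightarrow> F (?P x + \<delta> x *\<^sub>R e) = 0" and \<delta>y: "\<delta> y = y \<bullet> e"
    and grad: "\<And>w. w \<bullet> e = 0 \<Longrightarrow> dir_deriv w \<delta> (?P y) = 0"
    using implicit_graph[OF F e Fy De Dw] by (metis (no_types, lifting))
  obtain \<eta> W where \<eta>: "\<eta> \<in> C2c S" "open W" "{?P y} \<subseteq> W" "\<And>x. x \<in> W \<Longrightarrow> \<eta> x = 1"
    using C2c_bump[of "{?P y}" S] S by (metis (no_types, lifting) compact_sing empty_subsetI insert_subset)
  define \<gamma> where "\<gamma> x = \<eta> x * \<delta> x" for x
  obtain K where K: "compact K" "K \<subseteq> S" "\<forall>x. x \<notin> K \<longrightarrow> \<eta> x = 0" and \<eta>2: "Ck_on 2 UNIV \<eta>"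
    using \<eta>(1) by (auto simp: C2c_def)
  have "Ck_on 2 S \<gamma>"
    unfolding \<gamma>_def using S(1) Ck_on_subset[OF \<eta>2, of S] \<delta> by (intro Ck_on_mult) auto
  moreover have oK: "open (- K)" using K(1) by (simp add: compact_imp_closed open_Compl)
  moreover have "Ck_on 2 (- K) \<gamma>"
    by (rule Ck_on_cong[OF Ck_on_const[OF oK, of 2 0] oK]) (use K(3) in \<open>auto simp: \<gamma>_def\<close>)
  ultimately have "Ck_on 2 (S \<union> - K) \<gamma>" using S(1) by (intro Ck_on_Un)
  moreover have "S \<union> - K = UNIV" using K(2) by auto
  ultimately have C2: "Ck_on 2 UNIV \<gamma>" by simp
  have F2: "Ck_on (Suc (Suc 0)) UNIV F" using F by (simp only: numeral_2_eq_2)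
  have dF: "F differentiable (at x)" for x using F2 by simp
  have "continuous_on UNIV (dir_deriv e F)" by (rule Ck_on_continuous[OF Ck_on_dir_deriv[OF open_UNIV F2]])
  then have "open {x. 0 < dir_deriv e F x}" using open_Collect_less[OF continuous_on_const] by blast
  then obtain r1 where r1: "0 < r1" "\<And>x. x \<in> ball y r1 \<Longrightarrow> 0 < dir_deriv e F x"
    using De unfolding open_contains_ball by (auto simp: subset_iff)
  have cP: "continuous_on UNIV ?P"
    by (intro linear_continuous_on linear_conv_bounded_linear[THEN iffD1] linear_hyp_proj)
  have "continuous_on S (\<lambda>x. ?P x + \<delta> x *\<^sub>R e)"
    by (intro continuous_intros continuous_on_subset[OF cP] Ck_on_continuous[OF \<delta>]) auto
  then have o1: "open (S \<inter> (\<lambda>x. ?P x + \<delta> x *\<^sub>R e) -` ball y r1)"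
    using S(1) by (simp add: continuous_on_open_vimage Int_commute)
  have "open (?P -` W)" using open_vimage[OF \<eta>(2) cP] .
  then have "open ((S \<inter> (\<lambda>x. ?P x + \<delta> x *\<^sub>R e) -` ball y r1) \<inter> ?P -` W \<inter> ball y r1)"
    by (rule open_Int[OF open_Int[OF o1] open_ball])
  moreover have "?P y + \<delta> y *\<^sub>R e = y" unfolding \<delta>y by (simp add: hyp_proj_def)
  then have "y \<in> (S \<inter> (\<lambda>x. ?P x + \<delta> x *\<^sub>R e) -` ball y r1) \<inter> ?P -` W \<inter> ball y r1"
    using S \<eta>(3) r1(1) by simp
  ultimately obtain r where r: "0 < r"
    "ball y r \<subseteq> (S \<inter> (\<lambda>x. ?P x + \<delta> x *\<^sub>R e) -` ball y r1) \<inter> ?P -` W \<inter> ball y r1"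
    unfolding open_contains_ball by blast
  have inc: "F (z + s *\<^sub>R e) < F (z + t *\<^sub>R e)"
    if "s < t" "z + s *\<^sub>R e \<in> ball y r1" "z + t *\<^sub>R e \<in> ball y r1" for z s t
  proof (rule DERIV_pos_imp_increasing[OF \<open>s < t\<close>, of "\<lambda>s. F (z + s *\<^sub>R e)"])
    fix u assume u: "s \<le> u" "u \<le> t"
    define l where "l = (u - s) / (t - s)"
    have "l * (t - s) = u - s" using \<open>s < t\<close> by (simp add: l_def)
    then have "u = (1 - l) * s + l * t" by (simp add: algebra_simps)
    moreover have "0 \<le> l" "l \<le> 1" using u \<open>s < t\<close> by (auto simp: l_def)
    ultimately have l: "0 \<le> l" "l \<le> 1" "u = (1 - l) * s + l * t" by auto
    have "z + u *\<^sub>R e = (1 - l) *\<^sub>R (z + s *\<^sub>R e) + l *\<^sub>R (z + t *\<^sub>R e)"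
      unfolding l(3) by (simp add: algebra_simps)
    also have "\<dots> \<in> ball y r1"
      using convexD_alt[OF convex_ball that(2,3) l(1,2)] .
    finally show "\<exists>y. ((\<lambda>s. F (z + s *\<^sub>R e)) has_real_derivative y) (at u) \<and> 0 < y"
      using r1(2) line_has_real_derivative[OF dF] by blast
  qed
  show thesis
  proof (rule that[OF C2 r(1)])
    fix x assume "x \<in> ball y r"
    then have x: "x \<in> S" "?P x + \<delta> x *\<^sub>R e \<in> ball y r1" "?P x \<in> W" "x \<in> ball y r1" using r(2) by auto
    have \<gamma>\<delta>: "\<gamma> (?P x) = \<delta> x" using \<eta>(4)[OF x(3)] \<delta>P[of x] by (simp add: \<gamma>_def)
    have xs: "x = ?P x + (x \<bullet> e) *\<^sub>R e" by (simp add: hyp_proj_def)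
    then have xb: "?P x + (x \<bullet> e) *\<^sub>R e \<in> ball y r1" using x(4) by simp
    have Fx: "F (?P x + (x \<bullet> e) *\<^sub>R e) = F x" using xs by simp
    show "0 < F x \<longleftrightarrow> \<gamma> (?P x) < x \<bullet> e"
      using inc[OF _ x(2) xb] inc[OF _ xb x(2)] root[OF x(1)] Fx unfolding \<gamma>\<delta>
      by (cases "\<delta> x" "x \<bullet> e" rule: linorder_cases) auto
  next
    fix w assume w: "w \<bullet> e = 0"
    have "dir_deriv w \<gamma> (?P y) = dir_deriv w \<delta> (?P y)"
    proof (rule dir_deriv_transform(1)[where S = "S \<inter> W"])
      show "\<delta> differentiable (at (?P y))" using \<delta> S(2) by (simp add: numeral_2_eq_2)
    qed (use S \<eta> in \<open>auto simp: \<gamma>_def\<close>)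
    then show "dir_deriv w \<gamma> (?P y) = 0" using grad[OF w] by simp
  qed
qed

text \<open>A given chart may be tilted against the boundary. Its height function F is positive
  exactly on \<Omega> near y and has nonzero gradient, since its derivative along the axis a is 1.
  The normalised gradient is the new axis e, over whose hyperplane the boundary is again a graph,
  now with vanishing gradient.\<close>

lemma principal_curvatures_exist:
  fixes \<Omega> :: "'a::euclidean_space set"
  assumes \<Omega>: "open \<Omega>" "C2_boundary \<Omega>" "y \<in> frontier \<Omega>"
  obtains \<kappa> where "principal_curvatures \<Omega> y \<kappa>"
proof -
  obtain a \<alpha> where c: "epigraph_chart \<Omega> y a \<alpha>" using \<Omega> unfolding C2_boundary_def by blast
  obtain r where r: "r > 0" "\<And>x. x \<in> ball y r \<Longrightarrow> x \<in> \<Omega> \<longleftrightarrow> \<alpha> (hyp_proj a x) < x \<bullet> a"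
    and \<alpha>: "Ck_on 2 UNIV \<alpha>" and a: "norm a = 1" using epigraph_chartE[OF c] by metis
  define F where "F x = x \<bullet> a - \<alpha> (hyp_proj a x)" for x
  have F: "Ck_on 2 UNIV F"
    unfolding F_def by (rule Ck_on_diff[OF open_UNIV Ck_on_inner Ck_on_compose_linear[OF linear_hyp_proj \<alpha>]])
  have dF: "F differentiable (at x)" for x using F by (simp add: numeral_2_eq_2)
  have Fy: "F y = 0" using epigraph_chart_boundary[OF \<Omega>(1,3) c] by (simp add: F_def)
  define \<nu> where "\<nu> = (\<Sum>b\<in>Basis. dir_deriv b F y *\<^sub>R b)"
  have \<nu>: "dir_deriv w F y = w \<bullet> \<nu>" for w
    using dir_deriv_expand[OF dF[of y], where v = w] by (simp add: \<nu>_def inner_sum_right mult.commute)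
  have "F (y + t *\<^sub>R a) = t" for t
    using Fy a unfolding F_def by (simp add: hyp_proj_add_scale inner_simps norm_eq_1)
  then have "((\<lambda>t. t) has_real_derivative dir_deriv a F (y + 0 *\<^sub>R a)) (at 0)"
    using line_has_real_derivative[OF dF, where x = y and s = 0 and b = a] by simp
  from DERIV_unique[OF this DERIV_ident] have "dir_deriv a F y = 1" by simp
  then have \<nu>0: "\<nu> \<noteq> 0" using \<nu>[of a] by auto
  define e where "e = (1 / norm \<nu>) *\<^sub>R \<nu>"
  have e: "norm e = 1" using \<nu>0 by (simp add: e_def)
  have De: "0 < dir_deriv e F y" using \<nu>0 by (simp add: \<nu> e_def)
  have Dw: "dir_deriv w F y = 0" if "w \<bullet> e = 0" for w using that \<nu>0 by (simp add: \<nu> e_def)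
  obtain \<gamma> s where \<gamma>: "Ck_on 2 UNIV \<gamma>" and s: "0 < s"
    "\<And>x. x \<in> ball y s \<Longrightarrow> 0 < F x \<longleftrightarrow> \<gamma> (hyp_proj e x) < x \<bullet> e"
    and grad: "\<And>w. w \<bullet> e = 0 \<Longrightarrow> dir_deriv w \<gamma> (hyp_proj e y) = 0"
    using sublevel_is_epigraph[OF F e Fy De Dw] by blast
  have "\<Omega> \<inter> ball y (min r s) = {x \<in> ball y (min r s). \<gamma> (hyp_proj e x) < x \<bullet> e}"
    using r(2) s(2) by (auto simp: F_def)
  then have "tangent_chart \<Omega> y e \<gamma>"
    unfolding tangent_chart_def epigraph_chart_def using e \<gamma> grad r(1) s(1)
    by (auto intro!: exI[of _ "min r s"])
  moreover obtain v \<kappa> where "principal_frame (hyp_proj e y) e \<gamma> v \<kappa>"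
    using principal_frame_exists[OF \<gamma> e] by blast
  ultimately show thesis using that by (auto simp: principal_curvatures_iff)
qed

section \<open>The Laplacian of the distance function\<close>

lemma continuous_bdist: "continuous_on S (bdist \<Omega>)"
  unfolding bdist_def by (intro continuous_intros)

lemma bdist_le: "y \<notin> \<Omega> \<Longrightarrow> bdist \<Omega> x \<le> dist x y"
  by (simp add: bdist_def infdist_le)

lemma bdist_outside: "x \<notin> \<Omega> \<Longrightarrow> bdist \<Omega> x = 0"
  by (simp add: bdist_def)

lemma nearest_boundary_point:
  fixes \<Omega> :: "'a::euclidean_space set"
  assumes \<Omega>: "open \<Omega>" "\<Omega> \<noteq> UNIV" and x: "x \<in> \<Omega>"
  obtains y where "y \<in> frontier \<Omega>" "y \<notin> \<Omega>" "bdist \<Omega> x = dist x y" "x \<noteq> y" "ball x (dist x y) \<subseteq> \<Omega>"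
proof -
  have "closed (- \<Omega>)" "- \<Omega> \<noteq> {}" using \<Omega> by auto
  then obtain y where y: "y \<in> - \<Omega>" "infdist x (- \<Omega>) = dist x y"
    using infdist_attains_inf by blast
  have ne: "x \<noteq> y" using x y by auto
  have ball: "ball x (dist x y) \<subseteq> \<Omega>"
  proof
    fix z assume "z \<in> ball x (dist x y)"
    then have "dist x z < infdist x (- \<Omega>)" using y by simp
    then show "z \<in> \<Omega>" using infdist_le[of z "- \<Omega>" x] by force
  qed
  have "y \<in> closure (ball x (dist x y))" using ne by simp
  then have "y \<in> closure \<Omega>" using closure_mono[OF ball] by blast
  then have "y \<in> frontier \<Omega>" using y(1) \<Omega>(1) by (simp add: frontier_def interior_open)
  then show thesis using that y ne ball by (simp add: bdist_def)
qed

lemma bdist_pos: "open \<Omega> \<Longrightarrow> \<Omega> \<noteq> UNIV \<Longrightarrow> x \<in> \<Omega> \<Longrightarrow> 0 < bdist \<Omega> x"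
  using nearest_boundary_point by (metis zero_less_dist_iff)

text \<open>The function \<open>dist y\<close>, which touches the distance function from above at \<open>x\<close>, is semiconcave.\<close>

lemma second_diff_bdist_le:
  fixes \<Omega> :: "'a::euclidean_space set"
  assumes \<Omega>: "open \<Omega>" "\<Omega> \<noteq> UNIV" and x: "x \<in> \<Omega>" and t: "0 < t" and b: "norm b = 1"
  shows "second_diff (bdist \<Omega>) x b t \<le> 1 / bdist \<Omega> x"
proof -
  obtain y where y: "y \<notin> \<Omega>" "bdist \<Omega> x = dist x y" "x \<noteq> y"
    using nearest_boundary_point[OF \<Omega> x] by metis
  define s a where "s = dist x y" and "a = x - y"
  have s: "0 < s" "norm a = s" using y by (auto simp: s_def a_def dist_norm)
  \<comment> \<open>Passes from norms to squared norms, to which the parallelogram law applies.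
    Equality holds at norm s, so nothing is lost at t = 0.\<close>
  have amgm: "norm z \<le> ((norm z)\<^sup>2 + s\<^sup>2) / (2 * s)" for z :: 'a
  proof -
    have "0 \<le> (norm z - s)\<^sup>2" by simp
    then show ?thesis using s by (simp add: field_simps power2_eq_square)
  qed
  have "bdist \<Omega> (x + t *\<^sub>R b) + bdist \<Omega> (x - t *\<^sub>R b) \<le> norm (a + t *\<^sub>R b) + norm (a - t *\<^sub>R b)"
    using bdist_le[OF y(1), of "x + t *\<^sub>R b"] bdist_le[OF y(1), of "x - t *\<^sub>R b"]
    by (simp add: a_def dist_norm algebra_simps)
  also have "\<dots> \<le> ((norm (a + t *\<^sub>R b))\<^sup>2 + s\<^sup>2) / (2 * s) + ((norm (a - t *\<^sub>R b))\<^sup>2 + s\<^sup>2) / (2 * s)"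
    by (intro add_mono amgm)
  also have "\<dots> = ((norm (a + t *\<^sub>R b))\<^sup>2 + (norm (a - t *\<^sub>R b))\<^sup>2 + 2 * s\<^sup>2) / (2 * s)"
    by (simp add: add_divide_distrib)
  also have "(norm (a + t *\<^sub>R b))\<^sup>2 + (norm (a - t *\<^sub>R b))\<^sup>2 = 2 * s\<^sup>2 + 2 * t\<^sup>2"
  proof -
    have "a \<bullet> a = s\<^sup>2" "b \<bullet> b = 1" using s b by (simp_all add: power2_norm_eq_inner[symmetric])
    then show ?thesis unfolding power2_norm_eq_inner
      by (simp add: inner_simps inner_commute power2_eq_square algebra_simps)
  qed
  also have "(2 * s\<^sup>2 + 2 * t\<^sup>2 + 2 * s\<^sup>2) / (2 * s) = 2 * s + t\<^sup>2 / s"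
    using s by (simp add: field_simps power2_eq_square)
  finally have "bdist \<Omega> (x + t *\<^sub>R b) + bdist \<Omega> (x - t *\<^sub>R b) - 2 * bdist \<Omega> x \<le> t\<^sup>2 / s"
    using y by (simp add: s_def)
  then have "second_diff (bdist \<Omega>) x b t \<le> t\<^sup>2 / s / t\<^sup>2"
    unfolding second_diff_def by (rule divide_right_mono) simp
  then show ?thesis using t y by (simp add: s_def)
qed

text \<open>
  Near \<open>x\<close> the distance function is bounded by the height above the boundary graph at the nearest
  point, with equality at \<open>x\<close>; no curvature of parallel surfaces is needed.
\<close>

lemma second_diff_bdist_chart:
  fixes \<Omega> :: "'a::euclidean_space set"
  assumes \<Omega>: "open \<Omega>" and y: "y \<in> frontier \<Omega>" and chart: "tangent_chart \<Omega> y e \<gamma>"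
    and x: "bdist \<Omega> x = dist x y" "x \<noteq> y" "ball x (dist x y) \<subseteq> \<Omega>"
  shows "\<forall>\<^sub>F t in at_right 0. second_diff (bdist \<Omega>) x b t \<le> - second_diff \<gamma> (hyp_proj e y) (hyp_proj e b) t"
proof -
  let ?P = "hyp_proj e"
  have ch: "epigraph_chart \<Omega> y e \<gamma>" using chart by (simp add: tangent_chart_def)
  obtain r where r: "r > 0" "\<And>x. x \<in> ball y r \<Longrightarrow> x \<in> \<Omega> \<longleftrightarrow> \<gamma> (?P x) < x \<bullet> e"
    and \<gamma>: "Ck_on 2 UNIV \<gamma>" and e: "norm e = 1" using epigraph_chartE[OF ch] by metis
  have ee: "e \<bullet> e = 1" using e by (simp add: norm_eq_1)
  define s where "s = dist x y"
  have s: "0 < s" using x by (simp add: s_def)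
  \<comment> \<open>The point y lies straight below x, so both have the same projection and the
    height of x above the graph is exactly its distance.\<close>
  have xy: "x = y + s *\<^sub>R e" unfolding s_def by (rule nearest_point_normal[OF \<Omega> y chart x(2,3)])
  have Px: "?P x = ?P y" unfolding xy by (rule hyp_proj_add_scale[OF e])
  have \<gamma>y: "\<gamma> (?P y) = y \<bullet> e" by (rule epigraph_chart_boundary[OF \<Omega> y ch])
  define w where "w z = z \<bullet> e - \<gamma> (?P z)" for z
  have wx: "w x = s" unfolding w_def Px \<gamma>y by (simp add: xy inner_simps ee)
  have cP: "continuous_on UNIV ?P"
    by (intro linear_continuous_on linear_conv_bounded_linear[THEN iffD1] linear_hyp_proj)
  have c\<gamma>: "continuous_on UNIV (\<lambda>z. \<gamma> (?P z))"
    by (rule continuous_on_compose2[OF Ck_on_continuous[OF \<gamma>] cP]) simp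
  have "open {z. 0 < w z}" unfolding w_def
    by (intro open_Collect_less continuous_intros c\<gamma>)
  moreover have "open ((\<lambda>z. ?P z + \<gamma> (?P z) *\<^sub>R e) -` ball y r)"
    by (rule open_vimage[OF open_ball]) (intro continuous_intros cP c\<gamma>)
  ultimately have "open ({z. 0 < w z} \<inter> ((\<lambda>z. ?P z + \<gamma> (?P z) *\<^sub>R e) -` ball y r))" (is "open ?U") by (rule open_Int)
  moreover have "?P x + \<gamma> (?P x) *\<^sub>R e = y" unfolding Px \<gamma>y by (simp add: hyp_proj_def)
  then have "x \<in> ?U" using wx s r(1) by simp
  ultimately have "\<forall>\<^sub>F t in at_right 0. x + t *\<^sub>R b \<in> ?U" "\<forall>\<^sub>F t in at_right 0. x + t *\<^sub>R (- b) \<in> ?U"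
    using eventually_ray_in_open by blast+
  then show ?thesis
  proof eventually_elim
    case (elim t)
    \<comment> \<open>The graph point vertically below z is not in \<Omega>, and its distance from z
      is the height w z. The set \<open>?U\<close> keeps that point inside the ball where the chart
      is valid.\<close>
    have le: "bdist \<Omega> z \<le> w z" if "z \<in> ?U" for z
    proof -
      let ?p = "?P z + \<gamma> (?P z) *\<^sub>R e"
      have "?P ?p = ?P z" using hyp_proj_add_scale[OF e] hyp_proj_orthogonal[OF hyp_proj_inner[OF e]] by simp
      moreover have "?p \<bullet> e = \<gamma> (?P z)" using hyp_proj_inner[OF e] by (simp add: inner_simps ee)
      ultimately have "?p \<notin> \<Omega>" using r(2)[of ?p] that by simp
      then have "bdist \<Omega> z \<le> dist z ?p" by (rule bdist_le)
      also have "z - ?p = w z *\<^sub>R e" by (simp add: w_def hyp_proj_def algebra_simps)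
      then have "dist z ?p = w z" using that e by (simp add: dist_norm)
      finally show ?thesis .
    qed
    have "bdist \<Omega> (x + t *\<^sub>R b) + bdist \<Omega> (x - t *\<^sub>R b) - 2 * bdist \<Omega> x
        \<le> w (x + t *\<^sub>R b) + w (x - t *\<^sub>R b) - 2 * w x"
      using le[OF elim(1)] le[OF elim(2)] wx x(1) by (simp add: s_def)
    also have "\<dots> = - (\<gamma> (?P y + t *\<^sub>R ?P b) + \<gamma> (?P y - t *\<^sub>R ?P b) - 2 * \<gamma> (?P y))"
      unfolding w_def linear_add[OF linear_hyp_proj] linear_diff[OF linear_hyp_proj] linear_scale[OF linear_hyp_proj] Px
      by (simp add: inner_simps)
    finally show ?case unfolding second_diff_def minus_divide_left by (rule divide_right_mono) simp
  qed
qed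

text \<open>Adding the chart bounds over the coordinate directions gives minus the approximate
  Hessian trace at y, whose limit is minus n - 1 times the mean curvature there. How small t must be
  depends on x.\<close>

lemma second_diff_bdist_curvature:
  fixes \<Omega> :: "'a::euclidean_space set"
  assumes \<Omega>: "open \<Omega>" "\<Omega> \<noteq> UNIV" "C2_boundary \<Omega>" and dim: "2 \<le> DIM('a)"
    and H: "\<And>y. y \<in> frontier \<Omega> \<Longrightarrow> H \<le> mean_curvature \<Omega> y" and x: "x \<in> \<Omega>" and \<epsilon>: "0 < \<epsilon>"
  shows "\<forall>\<^sub>F t in at_right 0. (\<Sum>b\<in>Basis. second_diff (bdist \<Omega>) x b t) < - ((real DIM('a) - 1) * H) + \<epsilon>"
proof -
  obtain y where y: "y \<in> frontier \<Omega>" "bdist \<Omega> x = dist x y" "x \<noteq> y" "ball x (dist x y) \<subseteq> \<Omega>"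
    using nearest_boundary_point[OF \<Omega>(1,2) x] by metis
  obtain \<kappa> where \<kappa>: "principal_curvatures \<Omega> y \<kappa>" using principal_curvatures_exist[OF \<Omega>(1,3) y(1)] .
  then obtain e \<gamma> v where c: "tangent_chart \<Omega> y e \<gamma>" and fr: "principal_frame (hyp_proj e y) e \<gamma> v \<kappa>"
    by (auto simp: principal_curvatures_iff)
  have e: "norm e = 1" and \<gamma>: "Ck_on 2 UNIV \<gamma>" using c by (auto simp: tangent_chart_def epigraph_chart_def)
  have "(\<Sum>i < DIM('a) - 1. \<kappa> i) = (real DIM('a) - 1) * mean_curvature \<Omega> y"
    using dim by (simp add: mean_curvature_eq[OF \<Omega>(1) y(1) \<kappa>])
  moreover have "(real DIM('a) - 1) * H \<le> (real DIM('a) - 1) * mean_curvature \<Omega> y"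
    using dim H[OF y(1)] by (intro mult_left_mono) auto
  ultimately have "(real DIM('a) - 1) * H - \<epsilon> < (\<Sum>i < DIM('a) - 1. \<kappa> i)" using \<epsilon> by simp
  then have "\<forall>\<^sub>F t in at_right 0. (real DIM('a) - 1) * H - \<epsilon> < (\<Sum>b\<in>Basis. second_diff \<gamma> (hyp_proj e y) (hyp_proj e b) t)"
    using order_tendstoD(1)[OF hessian_trace_limit[OF e \<gamma> fr]] by blast
  moreover have "\<forall>\<^sub>F t in at_right 0. \<forall>b\<in>Basis. second_diff (bdist \<Omega>) x b t \<le> - second_diff \<gamma> (hyp_proj e y) (hyp_proj e b) t"
    using second_diff_bdist_chart[OF \<Omega>(1) y(1) c y(2-4)] by (intro eventually_ball_finite) auto
  ultimately show ?thesis
  proof eventually_elim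
    case (elim t)
    have "(\<Sum>b\<in>Basis. second_diff (bdist \<Omega>) x b t) \<le> (\<Sum>b\<in>Basis. - second_diff \<gamma> (hyp_proj e y) (hyp_proj e b) t)"
      using elim(2) by (intro sum_mono) auto
    then show ?case using elim(1) by (simp add: sum_negf)
  qed
qed

section \<open>From difference quotients to the distributional Laplacian\<close>

lemma integrable_continuous_compact_support:
  fixes f :: "'a::euclidean_space \<Rightarrow> real"
  assumes "continuous_on UNIV f" "compact K" "\<And>x. x \<notin> K \<Longrightarrow> f x = 0"
  shows "integrable lborel f"
proof -
  have "integrable lborel (\<lambda>x. indicator K x *\<^sub>R f x)"
    using assms by (intro borel_integrable_compact) (auto intro: continuous_on_subset)
  moreover have "(\<lambda>x. indicator K x *\<^sub>R f x) = f"
    using assms(3) by (auto simp: fun_eq_iff split: split_indicator)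
  ultimately show ?thesis by simp
qed

lemma lborel_integral_shift:
  fixes f :: "'a::euclidean_space \<Rightarrow> real"
  assumes "continuous_on UNIV f"
  shows "(LINT x|lborel. f (x + a)) = (LINT x|lborel. f x)"
proof -
  have "(LINT x|lborel. f x) = (LINT x|distr lborel borel ((+) a). f x)"
    by (simp only: lborel_distr_plus)
  also have "\<dots> = (LINT x|lborel. f (a + x))"
    by (rule integral_distr) (auto intro: borel_measurable_continuous_onI assms)
  finally show ?thesis by (simp add: add.commute)
qed

text \<open>Discrete integration by parts: translation invariance of Lebesgue measure moves each
  shift from u to \<phi> with opposite sign, and the symmetric quotient contains both signs.\<close>

lemma second_diff_by_parts:
  fixes u \<phi> :: "'a::euclidean_space \<Rightarrow> real"
  assumes u: "continuous_on UNIV u" and \<phi>: "continuous_on UNIV \<phi>"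
    and K: "compact K" "\<And>x. x \<notin> K \<Longrightarrow> \<phi> x = 0"
  shows "(LINT x|lborel. second_diff u x b t * \<phi> x) = (LINT x|lborel. u x * second_diff \<phi> x b t)"
proof -
  have cu: "continuous_on UNIV (\<lambda>x. u (x + a))" and c\<phi>: "continuous_on UNIV (\<lambda>x. \<phi> (x + a))" for a
    by (rule continuous_on_compose2[OF u] continuous_on_compose2[OF \<phi>]; auto intro!: continuous_intros)+
  have i: "integrable lborel (\<lambda>x. u (x + a) * \<phi> x)" for a
    by (rule integrable_continuous_compact_support[OF continuous_on_mult[OF cu \<phi>] K(1)]) (simp add: K(2))
  have i': "integrable lborel (\<lambda>x. u x * \<phi> (x + a))" for a
  proof (rule integrable_continuous_compact_support[OF continuous_on_mult[OF u c\<phi>]])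
    show "compact ((\<lambda>x. x + - a) ` K)" using K(1) by (intro compact_continuous_image continuous_intros)
    show "u x * \<phi> (x + a) = 0" if "x \<notin> (\<lambda>x. x + - a) ` K" for x
    proof -
      have "x + a \<notin> K" using that by (force simp: image_iff)
      then show ?thesis using K(2) by simp
    qed
  qed
  have sh: "(LINT x|lborel. u (x + a) * \<phi> x) = (LINT x|lborel. u x * \<phi> (x + - a))" for a
    using lborel_integral_shift[OF continuous_on_mult[OF cu[of a] \<phi>], of "- a"] by simp
  have "(LINT x|lborel. second_diff u x b t * \<phi> x)
      = (LINT x|lborel. (u (x + t *\<^sub>R b) * \<phi> x + u (x + - (t *\<^sub>R b)) * \<phi> x - 2 * (u (x + 0) * \<phi> x)) / t\<^sup>2)"
    by (simp add: second_diff_def algebra_simps)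
  also have "\<dots> = ((LINT x|lborel. u (x + t *\<^sub>R b) * \<phi> x) + (LINT x|lborel. u (x + - (t *\<^sub>R b)) * \<phi> x)
      - 2 * (LINT x|lborel. u (x + 0) * \<phi> x)) / t\<^sup>2"
    using i[of "t *\<^sub>R b"] i[of "- (t *\<^sub>R b)"] i[of 0] by simp
  also have "\<dots> = ((LINT x|lborel. u x * \<phi> (x + - (t *\<^sub>R b))) + (LINT x|lborel. u x * \<phi> (x + t *\<^sub>R b))
      - 2 * (LINT x|lborel. u x * \<phi> (x + 0))) / t\<^sup>2"
    by (simp only: sh minus_minus minus_zero)
  also have "\<dots> = (LINT x|lborel. (u x * \<phi> (x + - (t *\<^sub>R b)) + u x * \<phi> (x + t *\<^sub>R b) - 2 * (u x * \<phi> (x + 0))) / t\<^sup>2)"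
    using i'[of "t *\<^sub>R b"] i'[of "- (t *\<^sub>R b)"] i'[of 0] by simp
  also have "\<dots> = (LINT x|lborel. u x * second_diff \<phi> x b t)"
    by (simp add: second_diff_def algebra_simps)
  finally show ?thesis .
qed

lemma C2_second_derivative_continuous:
  assumes "Ck_on 2 UNIV \<phi>" shows "continuous_on UNIV (dir_deriv v (dir_deriv w \<phi>))"
  using assms Ck_on_continuous[OF Ck_on_dir_deriv[OF open_UNIV Ck_on_dir_deriv[OF open_UNIV, of "Suc 0" \<phi> w], of v]]
  by (simp only: numeral_2_eq_2)

lemma laplacian_continuous: "Ck_on 2 UNIV \<phi> \<Longrightarrow> continuous_on UNIV (laplacian \<phi>)"
  unfolding laplacian_def by (intro continuous_on_sum C2_second_derivative_continuous)

lemma laplacian_outside: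
  assumes K: "compact K" "\<And>x. x \<notin> K \<Longrightarrow> \<phi> x = 0" and x: "x \<notin> K"
  shows "laplacian \<phi> x = 0"
proof -
  have o: "open (- K)" using K(1) by (simp add: compact_imp_closed open_Compl)
  have 1: "dir_deriv b \<phi> z = 0" if "z \<in> - K" for b z
    using dir_deriv_transform(1)[of "\<lambda>x. 0" z "- K" \<phi> b] o that K(2) by (simp add: dir_deriv_def)
  have "dir_deriv b (dir_deriv b \<phi>) x = 0" for b
    using dir_deriv_transform(1)[of "\<lambda>x. 0" x "- K" "dir_deriv b \<phi>" b] o x 1 by (simp add: dir_deriv_def)
  then show ?thesis by (simp add: laplacian_def)
qed

lemma laplacian_add:
  assumes "Ck_on 2 UNIV \<phi>" "Ck_on 2 UNIV \<psi>"
  shows "laplacian (\<lambda>x. \<phi> x + \<psi> x) x = laplacian \<phi> x + laplacian \<psi> x"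
proof -
  have d: "\<phi> differentiable (at x)" "\<psi> differentiable (at x)" "dir_deriv b \<phi> differentiable (at x)"
    "dir_deriv b \<psi> differentiable (at x)" for x b
    using assms Ck_on_dir_deriv[of UNIV "Suc 0" \<phi> b] Ck_on_dir_deriv[of UNIV "Suc 0" \<psi> b] by (simp_all add: numeral_2_eq_2)
  have "dir_deriv b (\<lambda>x. \<phi> x + \<psi> x) = (\<lambda>x. dir_deriv b \<phi> x + dir_deriv b \<psi> x)" for b
    by (rule ext, rule dir_deriv_eq[OF has_derivative_add]; intro dir_deriv_has_derivative d)
  moreover have "dir_deriv b (\<lambda>x. dir_deriv b \<phi> x + dir_deriv b \<psi> x) x = dir_deriv b (dir_deriv b \<phi>) x + dir_deriv b (dir_deriv b \<psi>) x" for b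
    by (rule dir_deriv_eq[OF has_derivative_add]; intro dir_deriv_has_derivative d)
  ultimately show ?thesis by (simp add: laplacian_def sum.distrib)
qed

lemma laplacian_scale:
  assumes "Ck_on 2 UNIV \<phi>"
  shows "laplacian (\<lambda>x. a * \<phi> x) x = a * laplacian \<phi> x"
proof -
  have d: "\<phi> differentiable (at x)" "dir_deriv b \<phi> differentiable (at x)" for x b
    using assms Ck_on_dir_deriv[of UNIV "Suc 0" \<phi> b] by (simp_all add: numeral_2_eq_2)
  have "dir_deriv b (\<lambda>x. a * \<phi> x) = (\<lambda>x. a * dir_deriv b \<phi> x)" for b
    by (rule ext, rule dir_deriv_eq[OF has_derivative_mult_right]; intro dir_deriv_has_derivative d)
  moreover have "dir_deriv b (\<lambda>x. a * dir_deriv b \<phi> x) x = a * dir_deriv b (dir_deriv b \<phi>) x" for b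
    by (rule dir_deriv_eq[OF has_derivative_mult_right]; intro dir_deriv_has_derivative d)
  ultimately show ?thesis by (simp add: laplacian_def sum_distrib_left)
qed

text \<open>A sequence, as dominated convergence requires. Its values are at most 1, which keeps the
  supports of all quotients in one compact set.\<close>

definition step :: "nat \<Rightarrow> real" where "step k = 1 / real (Suc k)"

lemma step_pos: "0 < step k" and step_le_1: "step k \<le> 1"
  by (auto simp: step_def)

lemma filterlim_step: "filterlim step (at_right 0) sequentially"
  unfolding filterlim_at step_def using LIMSEQ_Suc[OF lim_1_over_n] by auto

text \<open>Once moved to \<phi>, the quotients are bounded by its second derivatives and converge
  to its Laplacian, so that u may be merely continuous.\<close>

lemma laplacian_integral_limit:
  fixes u \<phi> :: "'a::euclidean_space \<Rightarrow> real"
  assumes u: "continuous_on UNIV u" and \<phi>: "Ck_on 2 UNIV \<phi>"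
    and K: "compact K" "\<And>x. x \<notin> K \<Longrightarrow> \<phi> x = 0"
  shows "(\<lambda>k. LINT x|lborel. (\<Sum>b\<in>Basis. second_diff u x b (step k)) * \<phi> x)
    \<longlonglongrightarrow> (LINT x|lborel. u x * laplacian \<phi> x)"
proof -
  have c\<phi>: "continuous_on UNIV \<phi>" by (rule Ck_on_continuous[OF \<phi>])
  \<comment> \<open>The closed R-neighbourhood of K. \<open>E 1\<close> contains the supports of the
    quotients, and \<open>E 2\<close> the intermediate points at which second derivatives are
    evaluated.\<close>
  define E where "E R = {x + y | x y. x \<in> K \<and> y \<in> cball (0::'a) R}" for R :: real
  have E: "compact (E R)" for R unfolding E_def by (rule compact_sums[OF K(1) compact_cball])
  have EK: "z \<in> E R" if "x \<in> K" "norm (z - x) \<le> R" for x z R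
    unfolding E_def mem_Collect_eq by (rule exI[of _ x], rule exI[of _ "z - x"]) (use that in simp)
  have EE: "z \<in> E 2" if x: "x \<in> E 1" and z: "norm (z - x) \<le> 1" for x z
  proof -
    obtain a y where a: "x = a + y" "a \<in> K" "norm y \<le> 1" using x by (auto simp: E_def)
    have "norm (z - a) \<le> norm (z - x) + norm y"
      using norm_triangle_ineq[of "z - x" y] a(1) by (simp add: algebra_simps)
    then show ?thesis using EK[OF a(2), of z 2] a(3) z by simp
  qed
  have cs: "continuous_on UNIV (\<lambda>x. second_diff f x b t)" if "continuous_on UNIV f" for f :: "'a \<Rightarrow> real" and b t
  proof -
    have "continuous_on UNIV (\<lambda>x. f (x + t *\<^sub>R b))" "continuous_on UNIV (\<lambda>x. f (x - t *\<^sub>R b))"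
      by (rule continuous_on_compose2[OF that]; auto intro!: continuous_intros)+
    then show ?thesis unfolding second_diff_def using that by (auto intro!: continuous_intros simp: divide_inverse)
  qed
  have out: "second_diff \<phi> x b t = 0" if x: "x \<notin> E 1" and b: "norm b = 1" and t: "0 < t" "t \<le> 1" for x b t
  proof -
    have "x + t *\<^sub>R b \<notin> K" "x - t *\<^sub>R b \<notin> K" "x \<notin> K"
      using x EK[of _ x 1] b t by (force simp: algebra_simps)+
    then show ?thesis using K(2) by (simp add: second_diff_def)
  qed
  have "\<exists>C. \<forall>x\<in>E 2. \<bar>dir_deriv b (dir_deriv b \<phi>) x\<bar> \<le> C" for b
  proof -
    have "bounded (dir_deriv b (dir_deriv b \<phi>) ` E 2)"
      by (intro compact_imp_bounded compact_continuous_image E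
          continuous_on_subset[OF C2_second_derivative_continuous[OF \<phi>]]) auto
    then show ?thesis by (auto simp: bounded_iff)
  qed
  then obtain C where C: "\<And>b x. x \<in> E 2 \<Longrightarrow> \<bar>dir_deriv b (dir_deriv b \<phi>) x\<bar> \<le> C b" by metis
  have "bounded (u ` E 1)"
    by (intro compact_imp_bounded compact_continuous_image E continuous_on_subset[OF u]) auto
  then obtain B where B: "\<And>x. x \<in> E 1 \<Longrightarrow> \<bar>u x\<bar> \<le> B" by (auto simp: bounded_iff)
  have bound: "\<bar>second_diff \<phi> x b t\<bar> \<le> C b" if x: "x \<in> E 1" and b: "norm b = 1" and t: "0 < t" "t \<le> 1" for x b t
  proof -
    obtain s where s: "0 < s" "s < t" "second_diff \<phi> x b t =
       (dir_deriv b (dir_deriv b \<phi>) (x + s *\<^sub>R b) + dir_deriv b (dir_deriv b \<phi>) (x - s *\<^sub>R b)) / 2"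
      using second_diff_mean[OF \<phi> t(1)] by metis
    have "x + s *\<^sub>R b \<in> E 2" "x - s *\<^sub>R b \<in> E 2" using s t b by (auto intro!: EE[OF x])
    from C[OF this(1), of b] C[OF this(2), of b] show ?thesis unfolding s(3) by (simp add: abs_le_iff)
  qed
  let ?s = "\<lambda>k x. u x * (\<Sum>b\<in>Basis. second_diff \<phi> x b (step k))"
  have "(\<lambda>k. LINT x|lborel. ?s k x) \<longlonglongrightarrow> (LINT x|lborel. u x * laplacian \<phi> x)"
  proof (rule integral_dominated_convergence[where w = "\<lambda>x. indicator (E 1) x * (B * (\<Sum>b\<in>Basis. C b))"])
    show "(\<lambda>x. u x * laplacian \<phi> x) \<in> borel_measurable lborel"
      using continuous_on_mult[OF u laplacian_continuous[OF \<phi>]]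
      by (simp add: borel_measurable_continuous_onI)
    show "?s k \<in> borel_measurable lborel" for k
    proof -
      have "?s k \<in> borel_measurable borel"
        by (intro borel_measurable_continuous_onI continuous_on_mult u continuous_on_sum cs c\<phi>)
      then show ?thesis by simp
    qed
    show "integrable lborel (\<lambda>x. indicator (E 1) x * (B * (\<Sum>b\<in>Basis. C b)))"
      using E[of 1] emeasure_compact_finite[OF E[of 1]]
      by (intro integrable_mult_left integrable_real_indicator) (auto simp: borel_compact)
    have "((\<lambda>k. ?s k x) \<longlonglongrightarrow> u x * laplacian \<phi> x)" for x
      unfolding laplacian_def
      by (intro tendsto_intros filterlim_compose[OF second_diff_tendsto[OF \<phi>] filterlim_step])
    then show "AE x in lborel. (\<lambda>k. ?s k x) \<longlonglongrightarrow> u x * laplacian \<phi> x" by simp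
    have "\<bar>?s k x\<bar> \<le> indicator (E 1) x * (B * (\<Sum>b\<in>Basis. C b))" for k x
    proof (cases "x \<in> E 1")
      case True
      have "\<bar>\<Sum>b\<in>Basis. second_diff \<phi> x b (step k)\<bar> \<le> (\<Sum>b\<in>Basis. C b)"
        by (rule order_trans[OF sum_abs]) (intro sum_mono bound True step_pos step_le_1, simp)
      then have "\<bar>u x\<bar> * \<bar>\<Sum>b\<in>Basis. second_diff \<phi> x b (step k)\<bar> \<le> B * (\<Sum>b\<in>Basis. C b)"
        using B[OF True] by (intro mult_mono) auto
      then show ?thesis using True by (simp add: abs_mult)
    qed (simp add: out step_pos step_le_1)
    then show "AE x in lborel. norm (?s k x) \<le> indicator (E 1) x * (B * (\<Sum>b\<in>Basis. C b))" for k by simp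
  qed
  moreover have "(LINT x|lborel. (\<Sum>b\<in>Basis. second_diff u x b t) * \<phi> x) = (LINT x|lborel. u x * (\<Sum>b\<in>Basis. second_diff \<phi> x b t))"
    if t: "0 < t" "t \<le> 1" for t
  proof -
    have i1: "integrable lborel (\<lambda>x. second_diff u x b t * \<phi> x)" for b
      by (rule integrable_continuous_compact_support[OF continuous_on_mult[OF cs[OF u] c\<phi>] K(1)]) (simp add: K(2))
    have i2: "integrable lborel (\<lambda>x. u x * second_diff \<phi> x b t)" if "b \<in> Basis" for b
      by (rule integrable_continuous_compact_support[OF continuous_on_mult[OF u cs[OF c\<phi>]] E[of 1]])
        (simp add: out that t)
    have "(LINT x|lborel. (\<Sum>b\<in>Basis. second_diff u x b t) * \<phi> x) = (\<Sum>b\<in>Basis. LINT x|lborel. second_diff u x b t * \<phi> x)"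
      unfolding sum_distrib_right by (rule Bochner_Integration.integral_sum) (rule i1)
    also have "\<dots> = (\<Sum>b\<in>Basis. LINT x|lborel. u x * second_diff \<phi> x b t)"
      by (intro sum.cong refl second_diff_by_parts[OF u c\<phi> K])
    also have "\<dots> = (LINT x|lborel. u x * (\<Sum>b\<in>Basis. second_diff \<phi> x b t))"
      unfolding sum_distrib_left by (rule Bochner_Integration.integral_sum[symmetric]) (rule i2)
    finally show ?thesis .
  qed
  ultimately show ?thesis by (simp add: step_pos step_le_1)
qed

text \<open>
  Dominated convergence for \<open>max\<close> of the difference quotients and \<open>c\<close> replaces Fatou's lemma: the
  quotients are bounded above by a constant on the support of \<open>\<phi>\<close>, but not below.
\<close>

lemma laplacian_bdist_le:
  fixes \<Omega> :: "'a::euclidean_space set"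
  assumes \<Omega>: "open \<Omega>" "\<Omega> \<noteq> UNIV"
    and cm: "c \<in> borel_measurable borel"
    and cb: "\<And>K. compact K \<Longrightarrow> K \<subseteq> \<Omega> \<Longrightarrow> \<exists>B. \<forall>x\<in>K. \<bar>c x\<bar> \<le> B"
    and lim: "\<And>x \<epsilon>. x \<in> \<Omega> \<Longrightarrow> 0 < \<epsilon> \<Longrightarrow>
      \<forall>\<^sub>F t in at_right 0. (\<Sum>b\<in>Basis. second_diff (bdist \<Omega>) x b t) < c x + \<epsilon>"
    and \<phi>: "\<phi> \<in> C2c \<Omega>" "\<And>x. 0 \<le> \<phi> x"
  shows "(LINT x|lborel. bdist \<Omega> x * laplacian \<phi> x) \<le> (LINT x|lborel. c x * \<phi> x)"
proof -
  obtain K where K: "compact K" "K \<subseteq> \<Omega>" "\<And>x. x \<notin> K \<Longrightarrow> \<phi> x = 0" and \<phi>2: "Ck_on 2 UNIV \<phi>"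
    using \<phi>(1) by (auto simp: C2c_def)
  have c\<phi>: "continuous_on UNIV \<phi>" by (rule C2c_continuous[OF \<phi>(1)])
  have \<phi>m: "\<phi> \<in> borel_measurable borel" by (rule borel_measurable_continuous_onI[OF c\<phi>])
  have i\<phi>: "integrable lborel \<phi>" by (rule integrable_continuous_compact_support[OF c\<phi> K(1,3)])
  let ?d = "bdist \<Omega>"
  define q where "q k x = (\<Sum>b\<in>Basis. second_diff ?d x b (step k))" for k x
  have cq: "continuous_on UNIV (q k)" for k
  proof -
    have "continuous_on UNIV (\<lambda>x. ?d (x + t *\<^sub>R b))" "continuous_on UNIV (\<lambda>x. ?d (x - t *\<^sub>R b))" for t b
      by (rule continuous_on_compose2[OF continuous_bdist[of UNIV]]; auto intro!: continuous_intros)+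
    then show ?thesis unfolding q_def second_diff_def
      by (auto intro!: continuous_intros continuous_bdist simp: divide_inverse)
  qed
  have qm: "q k \<in> borel_measurable borel" for k by (rule borel_measurable_continuous_onI[OF cq])
  have cd: "continuous_on K (\<lambda>x. real DIM('a) / ?d x)"
    using bdist_pos[OF \<Omega>] K(2) by (intro continuous_intros continuous_bdist) force
  obtain B1 where B1: "\<And>x. x \<in> K \<Longrightarrow> \<bar>c x\<bar> \<le> B1" using cb[OF K(1,2)] by blast
  have "bounded ((\<lambda>x. real DIM('a) / ?d x) ` K)"
    by (intro compact_imp_bounded compact_continuous_image cd K)
  then obtain B2 where B2: "\<And>x. x \<in> K \<Longrightarrow> \<bar>real DIM('a) / ?d x\<bar> \<le> B2" by (auto simp: bounded_iff)
  define B where "B = max \<bar>B1\<bar> \<bar>B2\<bar>"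
  have qB: "q k x \<le> B" if "x \<in> K" for k x
  proof -
    have x: "x \<in> \<Omega>" using that K(2) by blast
    have "q k x \<le> (\<Sum>b\<in>(Basis :: 'a set). 1 / ?d x)"
      unfolding q_def by (intro sum_mono second_diff_bdist_le \<Omega> x step_pos) simp
    also have "\<dots> = real DIM('a) / ?d x" by simp
    also have "\<dots> \<le> B2" using order_trans[OF abs_ge_self B2[OF that]] .
    finally show ?thesis by (simp add: B_def)
  qed
  have cB: "\<bar>c x\<bar> \<le> B" if "x \<in> K" for x using B1[OF that] by (simp add: B_def)
  have dom: "\<bar>max (q k x) (c x) * \<phi> x\<bar> \<le> B * \<phi> x" "\<bar>c x * \<phi> x\<bar> \<le> B * \<phi> x" for k x
  proof -
    have "\<bar>max (q k x) (c x) * \<phi> x\<bar> \<le> B * \<phi> x \<and> \<bar>c x * \<phi> x\<bar> \<le> B * \<phi> x"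
    proof (cases "x \<in> K")
      case True
      then have "\<bar>max (q k x) (c x)\<bar> \<le> B" "\<bar>c x\<bar> \<le> B" using qB[of x k] cB[of x] by auto
      then show ?thesis using \<phi>(2)[of x] by (simp add: abs_mult mult_right_mono)
    qed (simp add: K(3))
    then show "\<bar>max (q k x) (c x) * \<phi> x\<bar> \<le> B * \<phi> x" "\<bar>c x * \<phi> x\<bar> \<le> B * \<phi> x" by auto
  qed
  have iB: "integrable lborel (\<lambda>x. B * \<phi> x)" using i\<phi> by simp
  have mm: "(\<lambda>x. max (q k x) (c x) * \<phi> x) \<in> borel_measurable lborel" "(\<lambda>x. c x * \<phi> x) \<in> borel_measurable lborel" for k
    using qm cm \<phi>m by auto
  have pw: "(\<lambda>k. max (q k x) (c x) * \<phi> x) \<longlonglongrightarrow> c x * \<phi> x" for x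
  proof (cases "x \<in> K")
    case True
    then have x: "x \<in> \<Omega>" using K(2) by blast
    \<comment> \<open>The maximum never drops below c and is eventually below c + \<epsilon>: a
      bound on the limit superior becomes a limit.\<close>
    have "(\<lambda>k. max (q k x) (c x)) \<longlonglongrightarrow> c x"
    proof (rule tendstoI)
      fix \<epsilon> :: real assume "0 < \<epsilon>"
      then have "\<forall>\<^sub>F k in sequentially. q k x < c x + \<epsilon>"
        unfolding q_def using filterlim_step lim[OF x] filterlim_iff by blast
      then show "\<forall>\<^sub>F k in sequentially. dist (max (q k x) (c x)) (c x) < \<epsilon>"
        by eventually_elim (use \<open>0 < \<epsilon>\<close> in \<open>auto simp: dist_real_def max_def\<close>)
    qed
    then show ?thesis by (intro tendsto_intros)
  qed (simp add: K(3))
  have lim1: "(\<lambda>k. LINT x|lborel. max (q k x) (c x) * \<phi> x) \<longlonglongrightarrow> (LINT x|lborel. c x * \<phi> x)"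
    by (rule integral_dominated_convergence[OF mm(2) mm(1) iB]) (use pw dom in auto)
  have lim2: "(\<lambda>k. LINT x|lborel. q k x * \<phi> x) \<longlonglongrightarrow> (LINT x|lborel. ?d x * laplacian \<phi> x)"
    unfolding q_def by (rule laplacian_integral_limit[OF continuous_bdist \<phi>2 K(1,3)])
  have "(LINT x|lborel. q k x * \<phi> x) \<le> (LINT x|lborel. max (q k x) (c x) * \<phi> x)" for k
  proof (rule integral_mono)
    show "integrable lborel (\<lambda>x. q k x * \<phi> x)"
      by (rule integrable_continuous_compact_support[OF continuous_on_mult[OF cq c\<phi>] K(1)]) (simp add: K(3))
    show "integrable lborel (\<lambda>x. max (q k x) (c x) * \<phi> x)"
      by (rule Bochner_Integration.integrable_bound[OF iB mm(1)]) (use dom in \<open>auto intro: order_trans[OF _ abs_ge_self]\<close>)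
    show "q k x * \<phi> x \<le> max (q k x) (c x) * \<phi> x" for x using \<phi>(2) by (intro mult_right_mono) auto
  qed
  then show ?thesis by (intro LIMSEQ_le[OF lim2 lim1]) auto
qed

section \<open>The measure and its bounds\<close>

lemma bdist_laplacian_functional:
  fixes \<Omega> :: "'a::euclidean_space set"
  assumes \<Omega>: "open \<Omega>" "\<Omega> \<noteq> UNIV"
    and cm: "c \<in> borel_measurable borel"
    and cb: "\<And>K. compact K \<Longrightarrow> K \<subseteq> \<Omega> \<Longrightarrow> \<exists>B. \<forall>x\<in>K. \<bar>c x\<bar> \<le> B"
    and lim: "\<And>x \<epsilon>. x \<in> \<Omega> \<Longrightarrow> 0 < \<epsilon> \<Longrightarrow>
      \<forall>\<^sub>F t in at_right 0. (\<Sum>b\<in>Basis. second_diff (bdist \<Omega>) x b t) < c x + \<epsilon>"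
  shows "positive_C2c_functional \<Omega>
    (\<lambda>\<phi>. (LINT x|lborel. c x * \<phi> x) - (LINT x|lborel. bdist \<Omega> x * laplacian \<phi> x))"
proof
  have ic: "integrable lborel (\<lambda>x. c x * \<phi> x)" if \<phi>: "\<phi> \<in> C2c \<Omega>" for \<phi>
  proof -
    obtain K where K: "compact K" "K \<subseteq> \<Omega>" "\<And>x. x \<notin> K \<Longrightarrow> \<phi> x = 0" using \<phi> by (auto simp: C2c_def)
    have c\<phi>: "continuous_on UNIV \<phi>" by (rule C2c_continuous[OF \<phi>])
    obtain B where B: "\<And>x. x \<in> K \<Longrightarrow> \<bar>c x\<bar> \<le> B" using cb[OF K(1,2)] by blast
    have "integrable lborel (\<lambda>x. B * \<phi> x)"
      using integrable_continuous_compact_support[OF c\<phi> K(1,3)] by simp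
    then show ?thesis
    proof (rule Bochner_Integration.integrable_bound)
      show "(\<lambda>x. c x * \<phi> x) \<in> borel_measurable lborel"
        using cm borel_measurable_continuous_onI[OF c\<phi>] by simp
      have "\<bar>c x * \<phi> x\<bar> \<le> \<bar>B * \<phi> x\<bar>" for x
      proof (cases "x \<in> K")
        case True
        then have "\<bar>c x\<bar> \<le> \<bar>B\<bar>" using B[OF True] by simp
        then show ?thesis by (simp add: abs_mult mult_right_mono)
      qed (simp add: K(3))
      then show "AE x in lborel. norm (c x * \<phi> x) \<le> norm (B * \<phi> x)" by simp
    qed
  qed
  have id: "integrable lborel (\<lambda>x. bdist \<Omega> x * laplacian \<phi> x)" and C2: "Ck_on 2 UNIV \<phi>" if \<phi>: "\<phi> \<in> C2c \<Omega>" for \<phi>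
  proof -
    obtain K where K: "compact K" "\<And>x. x \<notin> K \<Longrightarrow> \<phi> x = 0" using \<phi> by (auto simp: C2c_def)
    show C2: "Ck_on 2 UNIV \<phi>" using \<phi> by (simp add: C2c_def)
    show "integrable lborel (\<lambda>x. bdist \<Omega> x * laplacian \<phi> x)"
      by (rule integrable_continuous_compact_support[OF continuous_on_mult[OF continuous_bdist laplacian_continuous[OF C2]] K(1)])
        (simp add: laplacian_outside[OF K])
  qed
  let ?\<Lambda> = "\<lambda>\<phi>. (LINT x|lborel. c x * \<phi> x) - (LINT x|lborel. bdist \<Omega> x * laplacian \<phi> x)"
  show "?\<Lambda> (\<lambda>x. \<phi> x + \<psi> x) = ?\<Lambda> \<phi> + ?\<Lambda> \<psi>" if \<phi>: "\<phi> \<in> C2c \<Omega>" "\<psi> \<in> C2c \<Omega>" for \<phi> \<psi>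
    unfolding laplacian_add[OF C2[OF \<phi>(1)] C2[OF \<phi>(2)]] distrib_left
    using ic[OF \<phi>(1)] ic[OF \<phi>(2)] id[OF \<phi>(1)] id[OF \<phi>(2)] by simp
  show "?\<Lambda> (\<lambda>x. a * \<phi> x) = a * ?\<Lambda> \<phi>" if \<phi>: "\<phi> \<in> C2c \<Omega>" for \<phi> a
    unfolding laplacian_scale[OF C2[OF \<phi>]] mult.left_commute[of _ a] by (simp add: right_diff_distrib)
  show "0 \<le> ?\<Lambda> \<phi>" if "\<phi> \<in> C2c \<Omega>" "\<And>x. 0 \<le> \<phi> x" for \<phi>
    using laplacian_bdist_le[OF \<Omega> cm cb lim that] by simp
qed fact

text \<open>The bound c stays abstract, so that one construction serves both the curvature constant
  and n / d. Local boundedness makes c dx a signed Radon measure.\<close>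

lemma neg_laplacian_measure:
  fixes \<Omega> :: "'a::euclidean_space set"
  assumes \<Omega>: "open \<Omega>" "\<Omega> \<noteq> UNIV"
    and cm: "c \<in> borel_measurable borel"
    and cb: "\<And>K. compact K \<Longrightarrow> K \<subseteq> \<Omega> \<Longrightarrow> \<exists>B. \<forall>x\<in>K. \<bar>c x\<bar> \<le> B"
    and lim: "\<And>x \<epsilon>. x \<in> \<Omega> \<Longrightarrow> 0 < \<epsilon> \<Longrightarrow>
      \<forall>\<^sub>F t in at_right 0. (\<Sum>b\<in>Basis. second_diff (bdist \<Omega>) x b t) < c x + \<epsilon>"
  shows "\<exists>\<mu>. signed_radon \<Omega> \<mu> \<and> represents_neg_laplacian \<Omega> (bdist \<Omega>) \<mu> \<and>
    (\<exists>\<mu>ac \<mu>s. lebesgue_decomposition \<Omega> \<mu> \<mu>ac \<mu>s) \<and>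
    (\<forall>\<mu>ac \<mu>s. lebesgue_decomposition \<Omega> \<mu> \<mu>ac \<mu>s \<longrightarrow>
       signed_nonneg \<Omega> \<mu>s \<and>
       (\<exists>g. has_lebesgue_density \<Omega> \<mu>ac g \<and> (AE x in lborel. x \<in> \<Omega> \<longrightarrow> - c x \<le> g x)))"
proof -
  interpret F: positive_C2c_functional \<Omega>
    "\<lambda>\<phi>. (LINT x|lborel. c x * \<phi> x) - (LINT x|lborel. bdist \<Omega> x * laplacian \<phi> x)"
    by (rule bdist_laplacian_functional[OF \<Omega> cm cb lim])
  interpret R: radon_minus_density \<Omega> F.riesz_measure c
    by unfold_locales
      (rule \<Omega>(1), rule F.sets_riesz_measure, erule (1) F.riesz_measure_compact_finite,
        rule F.riesz_measure_outside, rule cm, erule (1) cb)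
  have "represents_neg_laplacian \<Omega> (bdist \<Omega>) R.nu"
    unfolding represents_neg_laplacian_def
  proof (intro allI impI)
    fix \<phi> assume \<phi>: "test_function \<Omega> \<phi>"
    define K where "K = closure {x. \<phi> x \<noteq> 0}"
    have K: "compact K" "K \<subseteq> \<Omega>" using \<phi> by (auto simp: test_function_def K_def)
    have out: "\<phi> x = 0" if "x \<notin> K" for x
      using that closure_subset[of "{x. \<phi> x \<noteq> 0}"] unfolding K_def by blast
    have C: "\<phi> \<in> C2c \<Omega>"
      unfolding C2c_def using \<phi> K out by (auto simp: test_function_def simp del: Ck_on.simps)
    have "signed_integral \<Omega> R.nu \<phi> = (LINT x|F.riesz_measure. \<phi> x) - (LINT x|lborel. c x * \<phi> x)"
      by (rule R.signed_integral_eq[OF C2c_continuous[OF C] K out])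
    also have "\<dots> = - (LINT x|lborel. bdist \<Omega> x * laplacian \<phi> x)"
      using F.functional_eq_integral[OF C] by simp
    also have "(LINT x|lborel. bdist \<Omega> x * laplacian \<phi> x) = (LINT x:\<Omega>|lborel. bdist \<Omega> x * laplacian \<phi> x)"
      unfolding set_lebesgue_integral_def
      by (intro Bochner_Integration.integral_cong) (auto split: split_indicator simp: bdist_outside)
    finally show "- (LINT x:\<Omega>|lborel. bdist \<Omega> x * laplacian \<phi> x) = signed_integral \<Omega> R.nu \<phi>" by simp
  qed
  then show ?thesis
    using R.signed_radon_nu R.lebesgue_decomposition_exists R.decomposition_density by blast
qed

theorem mainTheorem2:
  fixes \<Omega> :: "(real ^ 'n) set"
  assumes "CARD('n) \<ge> 2"
    and "open \<Omega>" and "connected \<Omega>" and "\<Omega> \<noteq> UNIV"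
    and "C2_boundary \<Omega>"
    and "uniform_interior_sphere \<Omega>"
  shows "\<exists>\<mu>. signed_radon \<Omega> \<mu> \<and> represents_neg_laplacian \<Omega> (bdist \<Omega>) \<mu> \<and>
    (\<exists>\<mu>ac \<mu>s. lebesgue_decomposition \<Omega> \<mu> \<mu>ac \<mu>s) \<and>
    (\<forall>\<mu>ac \<mu>s. lebesgue_decomposition \<Omega> \<mu> \<mu>ac \<mu>s \<longrightarrow>
       signed_nonneg \<Omega> \<mu>s \<and>
       (\<exists>g. has_lebesgue_density \<Omega> \<mu>ac g \<and>
          (AE x in lborel. x \<in> \<Omega> \<longrightarrow>
             ereal (real CARD('n) - 1) * (INF y\<in>frontier \<Omega>. ereal (mean_curvature \<Omega> y))
               \<le> ereal (g x))))"
proof -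
  let ?I = "INF y\<in>frontier \<Omega>. ereal (mean_curvature \<Omega> y)"
  note \<Omega> = assms(2,4)
  have n: "0 < real CARD('n) - 1" using assms(1) by simp
  \<comment> \<open>The fourth property is the only link between c and the infimum, which is taken
    in the extended reals and may be infinite.\<close>
  obtain c where c: "c \<in> borel_measurable borel"
    "\<And>K. compact K \<Longrightarrow> K \<subseteq> \<Omega> \<Longrightarrow> \<exists>B. \<forall>x\<in>K. \<bar>c x\<bar> \<le> B"
    "\<And>x \<epsilon>. x \<in> \<Omega> \<Longrightarrow> 0 < \<epsilon> \<Longrightarrow>
      \<forall>\<^sub>F t in at_right 0. (\<Sum>b\<in>Basis. second_diff (bdist \<Omega>) x b t) < c x + \<epsilon>"
    "\<And>x. x \<in> \<Omega> \<Longrightarrow> ereal (real CARD('n) - 1) * ?I \<le> ereal (- c x)"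
  proof (cases ?I)
    case (real H)
    have H: "H \<le> mean_curvature \<Omega> y" if "y \<in> frontier \<Omega>" for y
      using INF_lower[OF that, of "\<lambda>y. ereal (mean_curvature \<Omega> y)"] real by simp
    show thesis
    proof (rule that[of "\<lambda>x. - ((real CARD('n) - 1) * H)"])
      show "\<forall>\<^sub>F t in at_right 0. (\<Sum>b\<in>Basis. second_diff (bdist \<Omega>) x b t) < - ((real CARD('n) - 1) * H) + \<epsilon>"
        if "x \<in> \<Omega>" "0 < \<epsilon>" for x \<epsilon>
        using second_diff_bdist_curvature[OF \<Omega> assms(5) _ H that] assms(1) by simp
    qed (use real in auto)
  next
    case PInf
    \<comment> \<open>Mean curvatures are real, so the infimum is \<infinity> only over the empty
      set. A proper subset of the space with empty frontier is empty.\<close>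
    have "frontier \<Omega> = {}"
    proof (rule ccontr)
      assume "frontier \<Omega> \<noteq> {}"
      then obtain y where "y \<in> frontier \<Omega>" by blast
      from INF_lower[OF this, of "\<lambda>y. ereal (mean_curvature \<Omega> y)"] show False using PInf by simp
    qed
    then have "\<Omega> = {}" using \<Omega>(2) by (simp add: frontier_eq_empty)
    then show thesis by (intro that[of "\<lambda>x. 0"]) auto
  next
    case MInf
    \<comment> \<open>As n - 1 > 0, the required lower bound for the density is - \<infinity> and
      every c has the fourth property. Semiconcavity still supplies a locally bounded c, hence a
      measure.\<close>
    show thesis
    proof (rule that[of "\<lambda>x. real CARD('n) / bdist \<Omega> x"])
      show "(\<lambda>x. real CARD('n) / bdist \<Omega> x) \<in> borel_measurable borel"
        by (intro borel_measurable_divide borel_measurable_const borel_measurable_continuous_onI continuous_bdist)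
      show "\<exists>B. \<forall>x\<in>K. \<bar>real CARD('n) / bdist \<Omega> x\<bar> \<le> B" if K: "compact K" "K \<subseteq> \<Omega>" for K
      proof -
        have "continuous_on K (\<lambda>x. real CARD('n) / bdist \<Omega> x)"
          using bdist_pos[OF \<Omega>] K(2) by (intro continuous_intros continuous_bdist) force
        then have "bounded ((\<lambda>x. real CARD('n) / bdist \<Omega> x) ` K)"
          by (intro compact_imp_bounded compact_continuous_image K)
        then show ?thesis by (auto simp: bounded_iff)
      qed
      show "\<forall>\<^sub>F t in at_right 0. (\<Sum>b\<in>Basis. second_diff (bdist \<Omega>) x b t) < real CARD('n) / bdist \<Omega> x + \<epsilon>"
        if x: "x \<in> \<Omega>" and "0 < \<epsilon>" for x \<epsilon>
        using eventually_at_right_less[of "0 :: real"]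
      proof eventually_elim
        case (elim t)
        have "(\<Sum>b\<in>Basis. second_diff (bdist \<Omega>) x b t) \<le> (\<Sum>b\<in>(Basis :: (real ^ 'n) set). 1 / bdist \<Omega> x)"
          by (intro sum_mono second_diff_bdist_le \<Omega> x elim) simp
        then show ?case using \<open>0 < \<epsilon>\<close> by simp
      qed
    qed (use MInf n in simp)
  qed
  have dens: "\<exists>g. has_lebesgue_density \<Omega> \<mu>ac g \<and>
      (AE x in lborel. x \<in> \<Omega> \<longrightarrow> ereal (real CARD('n) - 1) * ?I \<le> ereal (g x))"
    if ex: "\<exists>g. has_lebesgue_density \<Omega> \<mu>ac g \<and> (AE x in lborel. x \<in> \<Omega> \<longrightarrow> - c x \<le> g x)" for \<mu>ac
  proof -
    obtain g where g: "has_lebesgue_density \<Omega> \<mu>ac g" "AE x in lborel. x \<in> \<Omega> \<longrightarrow> - c x \<le> g x"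
      using ex by blast
    from g(2) have "AE x in lborel. x \<in> \<Omega> \<longrightarrow> ereal (real CARD('n) - 1) * ?I \<le> ereal (g x)"
    proof eventually_elim
      case (elim x)
      show ?case
      proof
        assume x: "x \<in> \<Omega>"
        then have "ereal (- c x) \<le> ereal (g x)" using elim by simp
        with c(4)[OF x] show "ereal (real CARD('n) - 1) * ?I \<le> ereal (g x)" by (rule order_trans)
      qed
    qed
    with g(1) show ?thesis by blast
  qed
  obtain \<mu> where \<mu>: "signed_radon \<Omega> \<mu>" "represents_neg_laplacian \<Omega> (bdist \<Omega>) \<mu>"
    "\<exists>\<mu>ac \<mu>s. lebesgue_decomposition \<Omega> \<mu> \<mu>ac \<mu>s"
    "\<And>\<mu>ac \<mu>s. lebesgue_decomposition \<Omega> \<mu> \<mu>ac \<mu>s \<Longrightarrow> signed_nonneg \<Omega> \<mu>s"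
    "\<And>\<mu>ac \<mu>s. lebesgue_decomposition \<Omega> \<mu> \<mu>ac \<mu>s \<Longrightarrow>
      \<exists>g. has_lebesgue_density \<Omega> \<mu>ac g \<and> (AE x in lborel. x \<in> \<Omega> \<longrightarrow> - c x \<le> g x)"
    using neg_laplacian_measure[OF \<Omega> c(1-3)] by blast
  show ?thesis
    by (intro exI[of _ \<mu>] conjI \<mu>(1-3) allI impI) (erule \<mu>(4), rule dens, erule \<mu>(5))
qed

end
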